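(* Let $A=\{\mathbf a_1,\ldots,\mathbf a_N\}\subset\mathbb Z^r$ be a finite set of $N>r$ distinct vectors whose $\mathbb Z$-span is $\mathbb Z^r$ and for which there is a linear form $h$ with $h(\mathbf a_i)=1$ for all $i$. Let $\alpha\in\mathbb C^r$. Suppose that the toric ideal $I_A$ has the Cohen-Macaulay property and that the convex hull $Q(A)$ of $A$ is not a pyramid. If the A-hypergeometric system $H_A(\alpha)$ is resonant, then it is reducible.
   Context: Write $\mathbf a_j=(a_{1j},\ldots,a_{rj})^T$ and $\partial_j=\partial/\partial v_j$ for $j=1,\ldots,N$. Put $Z_i=\sum_{j=1}^N a_{ij}v_j\partial_j$ for $i=1,\ldots,r$. Let $L=\{(l_1,\ldots,l_N)\in\mathbb Z^N : \sum_j l_j\mathbf a_j=\mathbf 0\}$ and, for $\mathbf l\in L$, let $\Box_{\mathbf l}=\prod_{l_i>0}\partial_i^{l_i}-\prod_{l_i<0}\partial_i^{-l_i}$. The A-hypergeometric system $H_A(\alpha)$, $\alpha=(\alpha_1,\ldots,\alpha_r)$, is the system of differential equations $(Z_i-\alpha_i)\Phi=0$ $(i=1,\ldots,r)$ and $\Box_{\mathbf l}\Phi=0$ $(\mathbf l\in L)$. The toric ideal $I_A$ is the ideal of the commutative polynomial ring $\mathbb C[\partial_1,\ldots,\partial_N]$ generated by all $\Box_{\mathbf l}$, $\mathbf l\in L$; it has the Cohen-Macaulay property if $\mathbb C[\partial_1,\ldots,\partial_N]/I_A$ is a Cohen-Macaulay ring. $Q(A)$ is called a pyramid if $A$ consists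 of $N-1$ points lying in an $(r-2)$-dimensional affine plane and exactly one point outside of that plane. Let $K=\mathbb C(v_1,\ldots,v_N)$, let $K[\partial_1,\ldots,\partial_N]$ be the (noncommutative) ring of linear differential operators with coefficients in $K$, and let $\mathcal H_A(\alpha)$ be its left ideal generated by all $Z_i-\alpha_i$ and all $\Box_{\mathbf l}$. The system $H_A(\alpha)$ is called irreducible if the left $K[\partial_1,\ldots,\partial_N]$-module $K[\partial_1,\ldots,\partial_N]/\mathcal H_A(\alpha)$ has no submodules besides $0$ and the module itself, and reducible otherwise. Let $C(A)=\{\sum_j\lambda_j\mathbf a_j:\lambda_j\in\mathbb R_{\ge0}\}\subset\mathbb R^r\subset\mathbb C^r$. The system $H_A(\alpha)$ is called resonant if the set $\alpha+\mathbb Z^r$ has non-empty intersection with the boundary of $C(A)$ (boundary taken in $\mathbb R^r$). *)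

theory Defs
  imports
    "HOL-Analysis.Analysis"
    "HOL-Library.Poly_Mapping"
    "HOL-Library.Extended_Nat"
    "HOL-Computational_Algebra.Fraction_Field"
    "HOL-Algebra.Algebra"
begin

text \<open>
  The points \<open>a\<^sub>1, \<dots>, a\<^sub>N\<close> are a family \<open>a :: 'n \<Rightarrow> int ^ 'r\<close> with \<open>N = CARD('n)\<close> and
  \<open>r = CARD('r)\<close>. The index type \<open>'n\<close> is linearly ordered, like \<open>1, \<dots>, N\<close>; the library needs
  the order to know that multivariate polynomial rings are integral domains.
\<close>

section \<open>Cohen-Macaulay rings\<close>

definition regular_sequence :: "('a, 'b) ring_scheme \<Rightarrow> 'a list \<Rightarrow> bool" where
  "regular_sequence R xs \<longleftrightarrow>
     set xs \<subseteq> carrier R \<and>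
     genideal R (set xs) \<noteq> carrier R \<and>
     (\<forall>i < length xs. \<forall>y \<in> carrier R.
        xs ! i \<otimes>\<^bsub>R\<^esub> y \<in> genideal R (set (take i xs)) \<longrightarrow> y \<in> genideal R (set (take i xs)))"

definition ideal_depth :: "('a, 'b) ring_scheme \<Rightarrow> 'a set \<Rightarrow> enat" where
  "ideal_depth R I = Sup {enat (length xs) | xs. regular_sequence R xs \<and> set xs \<subseteq> I}"

definition prime_height :: "('a, 'b) ring_scheme \<Rightarrow> 'a set \<Rightarrow> enat" where
  "prime_height R P =
     Sup {enat n | n. \<exists>c :: nat \<Rightarrow> 'a set.
       (\<forall>i \<le> n. primeideal (c i) R) \<and> (\<forall>i < n. c i \<subset> c (Suc i)) \<and> c n = P}"

text \<open>
  Eisenbud's definition (Commutative Algebra with a View Toward Algebraic Geometry, Section 18.2):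
  a Noetherian ring with depth equal to codimension at every maximal ideal.
\<close>

definition Cohen_Macaulay :: "('a, 'b) ring_scheme \<Rightarrow> bool" where
  "Cohen_Macaulay R \<longleftrightarrow>
     cring R \<and> noetherian_ring R \<and>
     (\<forall>P. maximalideal P R \<longrightarrow> ideal_depth R P = prime_height R P)"


section \<open>The toric ideal\<close>

type_synonym 'n cpoly = "('n \<Rightarrow>\<^sub>0 nat) \<Rightarrow>\<^sub>0 complex"

definition poly_var :: "'n \<Rightarrow> 'n cpoly" where
  "poly_var j = Poly_Mapping.single (Poly_Mapping.single j 1) 1"

definition cpoly_ring :: "'n cpoly ring" where
  "cpoly_ring = \<lparr>carrier = UNIV, mult = (*), one = 1, ring.zero = 0, add = (+)\<rparr>"

definition relation_lattice :: "('n::finite \<Rightarrow> int ^ 'r) \<Rightarrow> ('n \<Rightarrow> int) set" where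
  "relation_lattice a = {l. (\<Sum>j\<in>UNIV. l j *s a j) = 0}"

definition box_poly :: "('n::finite \<Rightarrow> int) \<Rightarrow> 'n cpoly" where
  "box_poly l = (\<Prod>j | l j > 0. poly_var j ^ nat (l j)) - (\<Prod>j | l j < 0. poly_var j ^ nat (- l j))"

definition toric_ideal :: "('n::finite \<Rightarrow> int ^ 'r) \<Rightarrow> 'n cpoly set" where
  "toric_ideal a = genideal cpoly_ring (box_poly ` relation_lattice a)"

definition toric_Cohen_Macaulay :: "('n::finite \<Rightarrow> int ^ 'r) \<Rightarrow> bool" where
  "toric_Cohen_Macaulay a \<longleftrightarrow> Cohen_Macaulay (cpoly_ring Quot toric_ideal a)"


section \<open>The cone, resonance and pyramids\<close>

definition real_point :: "int ^ 'r \<Rightarrow> real ^ 'r" where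
  "real_point p = (\<chi> i. of_int (p $ i))"

definition cone_of :: "('n::finite \<Rightarrow> int ^ 'r) \<Rightarrow> (real ^ 'r) set" where
  "cone_of a = {\<Sum>j\<in>UNIV. c j *\<^sub>R real_point (a j) | c. \<forall>j. c j \<ge> 0}"

definition resonant :: "('n::finite \<Rightarrow> int ^ 'r) \<Rightarrow> complex ^ 'r \<Rightarrow> bool" where
  "resonant a \<alpha> \<longleftrightarrow>
     (\<exists>z :: int ^ 'r. \<exists>x \<in> frontier (cone_of a).
        \<forall>i. \<alpha> $ i + of_int (z $ i) = complex_of_real (x $ i))"

definition pyramid :: "('n \<Rightarrow> int ^ 'r) \<Rightarrow> bool" where
  "pyramid a \<longleftrightarrow>
     (\<exists>H j. affine H \<and> aff_dim H = int CARD('r) - 2 \<and>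
        (\<forall>k. k \<noteq> j \<longrightarrow> real_point (a k) \<in> H) \<and> real_point (a j) \<notin> H)"


section \<open>The field of rational functions and its partial derivatives\<close>

type_synonym 'n ratfun = "'n cpoly fract"

definition poly_deriv :: "'n \<Rightarrow> 'n cpoly \<Rightarrow> 'n cpoly" where
  "poly_deriv j p =
     (\<Sum>m\<in>Poly_Mapping.keys p. Poly_Mapping.single (m - Poly_Mapping.single j 1)
                     (of_nat (Poly_Mapping.lookup m j) * Poly_Mapping.lookup p m))"

lemma poly_deriv_superset:
  assumes "finite M" "Poly_Mapping.keys p \<subseteq> M"
  shows "poly_deriv j p =
     (\<Sum>m\<in>M. Poly_Mapping.single (m - Poly_Mapping.single j 1)
               (of_nat (Poly_Mapping.lookup m j) * Poly_Mapping.lookup p m))"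
  unfolding poly_deriv_def
  by (rule sum.mono_neutral_left) (use assms in \<open>auto simp: in_keys_iff\<close>)

lemma poly_deriv_add: "poly_deriv j (p + q) = poly_deriv j p + poly_deriv j q"
proof -
  have "finite (Poly_Mapping.keys p \<union> Poly_Mapping.keys q)"
    "Poly_Mapping.keys (p + q) \<subseteq> Poly_Mapping.keys p \<union> Poly_Mapping.keys q"
    using Poly_Mapping.keys_add[of p q] by auto
  then show ?thesis
    by (simp add: poly_deriv_superset[of "Poly_Mapping.keys p \<union> Poly_Mapping.keys q"] lookup_add
        distrib_left single_add sum.distrib)
qed

lemma poly_deriv_single:
  "poly_deriv j (Poly_Mapping.single m c) =
     Poly_Mapping.single (m - Poly_Mapping.single j 1) (of_nat (Poly_Mapping.lookup m j) * c)"
  by (subst poly_deriv_superset[of "{m}"]) auto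

lemma poly_deriv_one: "poly_deriv j 1 = 0"
  using poly_deriv_single[of j 0 1] by simp

lemma poly_deriv_mult_single:
  fixes m n :: "'n \<Rightarrow>\<^sub>0 nat"
  shows "poly_deriv j (Poly_Mapping.single m c * Poly_Mapping.single n d) =
     poly_deriv j (Poly_Mapping.single m c) * Poly_Mapping.single n d +
     Poly_Mapping.single m c * poly_deriv j (Poly_Mapping.single n d)"
proof -
  have *: "x - Poly_Mapping.single j 1 + y = x + y - Poly_Mapping.single j 1"
    if "Poly_Mapping.lookup x j > 0" for x y :: "'n \<Rightarrow>\<^sub>0 nat"
    by (rule poly_mapping_eqI)
       (use that in \<open>auto simp: lookup_add lookup_minus lookup_single when_def\<close>)
  show ?thesis
    using *[of m n] *[of n m]
    by (cases "Poly_Mapping.lookup m j > 0"; cases "Poly_Mapping.lookup n j > 0")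
       (auto simp: poly_deriv_single mult_single lookup_add add.commute algebra_simps
         simp flip: single_add)
qed

lemma cpoly_induct [case_names single add]:
  fixes p :: "'n cpoly"
  assumes "\<And>m c. P (Poly_Mapping.single m c)" and "\<And>p q. P p \<Longrightarrow> P q \<Longrightarrow> P (p + q)"
  shows "P p"
proof -
  have "P (\<Sum>m\<in>M. Poly_Mapping.single m (Poly_Mapping.lookup p m))" if "finite M" for M
    using that assms(1)[of undefined 0] by induction (auto intro: assms)
  moreover have "(\<Sum>m\<in>Poly_Mapping.keys p. Poly_Mapping.single m (Poly_Mapping.lookup p m)) = p"
    by (rule poly_mapping_eqI) (auto simp: lookup_sum lookup_single when_def in_keys_iff)
  ultimately show ?thesis
    using finite_keys[of p] by metis
qed

lemma poly_deriv_mult: "poly_deriv j (p * q) = poly_deriv j p * q + p * poly_deriv j q"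
proof (induction p rule: cpoly_induct)
  case (single m c)
  show ?case
    by (induction q rule: cpoly_induct)
       (simp_all add: poly_deriv_mult_single poly_deriv_add algebra_simps)
qed (simp add: poly_deriv_add algebra_simps)

lift_definition partial_deriv :: "'n::linorder \<Rightarrow> 'n ratfun \<Rightarrow> 'n ratfun"
  is "\<lambda>j (p, q). (poly_deriv j p * q - p * poly_deriv j q, q * q)"
proof (clarsimp, goal_cases)
  case (1 j p q p' q')
  have "poly_deriv j p * q' + p * poly_deriv j q' = poly_deriv j p' * q + p' * poly_deriv j q"
    using arg_cong[OF 1(3), of "poly_deriv j"] by (simp add: poly_deriv_mult)
  moreover have "(poly_deriv j p * q - p * poly_deriv j q) * (q' * q') -
        (poly_deriv j p' * q' - p' * poly_deriv j q') * (q * q) =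
      q * q' * (poly_deriv j p * q' + p * poly_deriv j q' -
                (poly_deriv j p' * q + p' * poly_deriv j q)) +
      (poly_deriv j q * q' + poly_deriv j q' * q) * (p' * q - p * q')"
    by (simp add: algebra_simps)
  ultimately show ?case
    using 1(3) by simp
qed

lemma partial_deriv_Fract:
  assumes "q \<noteq> 0"
  shows "partial_deriv j (Fract p q) = Fract (poly_deriv j p * q - p * poly_deriv j q) (q * q)"
  using assms by (simp add: Fract.abs_eq partial_deriv.abs_eq)

lemma quotient_rule_add:
  fixes p :: "'a::idom"
  shows "(P * s + p * S + (R * q + r * Q)) * (q * s) - (p * s + r * q) * (Q * s + q * S) =
    (P * q - p * Q) * (s * s) + (R * s - r * S) * (q * q)"
  by Groebner_Basis.algebra

lemma quotient_rule_mult: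
  fixes p :: "'a::idom"
  shows "((P * r + p * R) * (q * s) - p * r * (Q * s + q * S)) * (q * s) =
    (P * q - p * Q) * r * (q * (s * s)) + p * (R * s - r * S) * (q * q * s)"
  by Groebner_Basis.algebra

lemma partial_deriv_add: "partial_deriv j (f + g) = partial_deriv j f + partial_deriv j g"
  by (cases f, cases g)
     (simp add: partial_deriv_Fract eq_fract poly_deriv_add poly_deriv_mult quotient_rule_add)

lemma partial_deriv_mult: "partial_deriv j (f * g) = partial_deriv j f * g + f * partial_deriv j g"
  by (cases f, cases g)
     (simp add: partial_deriv_Fract eq_fract poly_deriv_mult quotient_rule_mult)

definition ratfun_var :: "'n::linorder \<Rightarrow> 'n ratfun" where
  "ratfun_var j = Fract (poly_var j) 1"

definition ratfun_const :: "complex \<Rightarrow> 'n::linorder ratfun" where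
  "ratfun_const c = Fract (Poly_Mapping.single 0 c) 1"

lemma partial_deriv_Fract_1: "partial_deriv j (Fract p 1) = Fract (poly_deriv j p) 1"
  by (simp add: partial_deriv_Fract poly_deriv_one)

lemma partial_deriv_var: "partial_deriv j (ratfun_var i) = (if i = j then 1 else 0)"
  unfolding ratfun_var_def poly_var_def partial_deriv_Fract_1
  by (simp add: poly_deriv_single lookup_single One_fract_def Zero_fract_def)

lemma partial_deriv_const: "partial_deriv j (ratfun_const c) = 0"
  unfolding ratfun_const_def partial_deriv_Fract_1
  by (simp add: poly_deriv_single Zero_fract_def)


section \<open>Linear differential operators\<close>

text \<open>
  A linear differential operator with coefficients in \<open>K\<close> is taken to be the map \<open>K \<Rightarrow> K\<close> that it
  induces, so that the product is composition. Distinct operators induce distinct maps, since the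
  base field has characteristic 0.
\<close>

inductive_set diff_ops :: "('n::linorder ratfun \<Rightarrow> 'n ratfun) set" where
  coeff: "(\<lambda>f. g * f) \<in> diff_ops"
| deriv: "partial_deriv j \<in> diff_ops"
| add: "P \<in> diff_ops \<Longrightarrow> Q \<in> diff_ops \<Longrightarrow> (\<lambda>f. P f + Q f) \<in> diff_ops"
| comp: "P \<in> diff_ops \<Longrightarrow> Q \<in> diff_ops \<Longrightarrow> P \<circ> Q \<in> diff_ops"

definition diff_op_ring :: "('n::linorder ratfun \<Rightarrow> 'n ratfun) ring" where
  "diff_op_ring =
     \<lparr>carrier = diff_ops, mult = (\<circ>), one = id, ring.zero = (\<lambda>f. 0), add = (\<lambda>P Q f. P f + Q f)\<rparr>"

lemma diff_ops_add:
  assumes "P \<in> diff_ops"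
  shows "P (f + g) = P f + P g"
  using assms
  by (induction arbitrary: f g) (auto simp: partial_deriv_add algebra_simps)

lemma ring_diff_op_ring: "ring (diff_op_ring :: ('n::linorder ratfun \<Rightarrow> 'n ratfun) ring)"
proof (rule ringI)
  have zero: "(\<lambda>f. 0) \<in> (diff_ops :: ('n ratfun \<Rightarrow> 'n ratfun) set)"
  proof -
    have "(\<lambda>f. 0) = (*) (0 :: 'n ratfun)" by (simp add: fun_eq_iff)
    then show ?thesis using diff_ops.coeff by metis
  qed
  have neg: "(\<lambda>f. - P f) \<in> diff_ops" if "P \<in> diff_ops" for P :: "'n ratfun \<Rightarrow> 'n ratfun"
  proof -
    have "(\<lambda>f. - P f) = (*) (- 1) \<circ> P" by (simp add: fun_eq_iff)
    then show ?thesis using diff_ops.comp[OF diff_ops.coeff that] by metis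
  qed
  have one: "id \<in> (diff_ops :: ('n ratfun \<Rightarrow> 'n ratfun) set)"
  proof -
    have "id = (*) (1 :: 'n ratfun)" by (simp add: fun_eq_iff)
    then show ?thesis using diff_ops.coeff by metis
  qed
  show "abelian_group (diff_op_ring :: ('n ratfun \<Rightarrow> 'n ratfun) ring)"
  proof (rule abelian_groupI, goal_cases)
    case (6 P)
    then show ?case
      using neg by (intro bexI[of _ "\<lambda>f. - P f"]) (auto simp: diff_op_ring_def)
  qed (auto simp: diff_op_ring_def zero fun_eq_iff algebra_simps intro: diff_ops.add)
  show "Group.monoid (diff_op_ring :: ('n ratfun \<Rightarrow> 'n ratfun) ring)"
    by (rule monoidI) (auto simp: diff_op_ring_def one comp_assoc intro: diff_ops.comp)
qed (auto simp: diff_op_ring_def diff_ops_add fun_eq_iff)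

definition left_ideal :: "'a set \<Rightarrow> ('a, 'b) ring_scheme \<Rightarrow> bool" where
  "left_ideal I R \<longleftrightarrow>
     additive_subgroup I R \<and> (\<forall>x \<in> carrier R. \<forall>y \<in> I. x \<otimes>\<^bsub>R\<^esub> y \<in> I)"

definition gen_left_ideal :: "('a, 'b) ring_scheme \<Rightarrow> 'a set \<Rightarrow> 'a set" where
  "gen_left_ideal R S = \<Inter>{I. left_ideal I R \<and> S \<subseteq> I}"

text \<open>
  The left module \<open>R / I\<close> of cosets of a left ideal. The fields \<open>mult\<close> and \<open>one\<close>, which the record
  type \<open>module\<close> inherits from \<open>ring\<close>, carry no meaning. The library's predicate \<open>submodule\<close> does
  not require the ring of scalars to be commutative.
\<close>

definition left_quotient :: "('a, 'b) ring_scheme \<Rightarrow> 'a set \<Rightarrow> ('a, 'a set) module" where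
  "left_quotient R I =
     \<lparr>carrier = a_rcosets\<^bsub>R\<^esub> I, mult = undefined, one = undefined,
      ring.zero = I, add = set_add R, smult = (\<lambda>x C. \<Union>y\<in>C. I +>\<^bsub>R\<^esub> (x \<otimes>\<^bsub>R\<^esub> y))\<rparr>"


section \<open>The A-hypergeometric system\<close>

definition euler_op :: "('n::{finite,linorder} \<Rightarrow> int ^ 'r) \<Rightarrow> 'r \<Rightarrow> 'n ratfun \<Rightarrow> 'n ratfun" where
  "euler_op a i f = (\<Sum>j\<in>UNIV. of_int (a j $ i) * ratfun_var j * partial_deriv j f)"

definition deriv_monomial :: "('n::{finite,linorder} \<Rightarrow> nat) \<Rightarrow> 'n ratfun \<Rightarrow> 'n ratfun" where
  "deriv_monomial e =
     foldr (\<lambda>j P. (partial_deriv j ^^ e j) \<circ> P) (sorted_list_of_set UNIV) id"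

text \<open>Since \<open>nat\<close> truncates, the exponents below are the positive and the negative part of \<open>l\<close>.\<close>

definition box_op :: "('n::{finite,linorder} \<Rightarrow> int) \<Rightarrow> 'n ratfun \<Rightarrow> 'n ratfun" where
  "box_op l f = deriv_monomial (\<lambda>j. nat (l j)) f - deriv_monomial (\<lambda>j. nat (- l j)) f"

definition hypergeom_ideal ::
    "('n::{finite,linorder} \<Rightarrow> int ^ 'r) \<Rightarrow> complex ^ 'r \<Rightarrow> ('n ratfun \<Rightarrow> 'n ratfun) set" where
  "hypergeom_ideal a \<alpha> =
     gen_left_ideal diff_op_ring
       (range (\<lambda>i f. euler_op a i f - ratfun_const (\<alpha> $ i) * f) \<union> box_op ` relation_lattice a)"

definition hypergeom_module ::
    "('n::{finite,linorder} \<Rightarrow> int ^ 'r) \<Rightarrow> complex ^ 'r \<Rightarrow>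
     ('n ratfun \<Rightarrow> 'n ratfun, ('n ratfun \<Rightarrow> 'n ratfun) set) module" where
  "hypergeom_module a \<alpha> = left_quotient diff_op_ring (hypergeom_ideal a \<alpha>)"

definition hypergeom_irreducible ::
    "('n::{finite,linorder} \<Rightarrow> int ^ 'r) \<Rightarrow> complex ^ 'r \<Rightarrow> bool" where
  "hypergeom_irreducible a \<alpha> \<longleftrightarrow>
     (\<forall>S. submodule S diff_op_ring (hypergeom_module a \<alpha>) \<longrightarrow>
        S = {\<zero>\<^bsub>hypergeom_module a \<alpha>\<^esub>} \<or> S = carrier (hypergeom_module a \<alpha>))"

abbreviation hypergeom_reducible ::
    "('n::{finite,linorder} \<Rightarrow> int ^ 'r) \<Rightarrow> complex ^ 'r \<Rightarrow> bool" where
  "hypergeom_reducible a \<alpha> \<equiv> \<not> hypergeom_irreducible a \<alpha>"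

end

theory Submission
  imports Defs
begin

text \<open>
  Write \<open>M(\<alpha>)\<close> for the module \<open>K[\<partial>] / \<H>(\<alpha>)\<close> of the system with parameter \<open>\<alpha>\<close>. Since
  \<open>(Z\<^sub>i - \<alpha>\<^sub>i + a\<^sub>i\<^sub>j) \<partial>\<^sub>j = \<partial>\<^sub>j (Z\<^sub>i - \<alpha>\<^sub>i)\<close>, right multiplication by \<open>\<partial>\<^sub>j\<close> is a homomorphism of left modules
  \<open>M(\<alpha> - a\<^sub>j) \<rightarrow> M(\<alpha>)\<close>. The theorem follows from three facts about these homomorphisms.

  \<^item> All \<open>M(\<alpha>)\<close> have the same finite dimension over \<open>K\<close>. Hence such a homomorphism is injective if and
    only if it is surjective.
  \<^item> If \<open>Q(A)\<close> is not a pyramid, then \<open>\<partial>\<^sub>j \<notin> \<H>(\<alpha>)\<close>, so none of these homomorphisms vanishes.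
  \<^item> If \<open>\<alpha> + \<int>\<^sup>r\<close> meets the boundary of the cone, then for some \<open>\<beta> \<in> \<alpha> + \<int>\<^sup>r\<close> and some \<open>k\<close> the
    homomorphism into \<open>M(\<beta>)\<close> given by \<open>\<partial>\<^sub>k\<close> is not surjective.

  By Schur's argument the first two facts make every homomorphism into or out of an irreducible
  \<open>M(\<alpha>)\<close> an isomorphism. Irreducibility therefore spreads from \<open>\<alpha>\<close> to all of \<open>\<alpha> + \<int>\<^sup>r\<close>
  (\<open>irreducible_shift\<close>), and all homomorphisms into irreducible systems are surjective
  (\<open>xi_surjective_if_irreducible\<close>). That contradicts the third fact.

  Equality of dimensions. An operator \<open>\<Sum> c\<^sub>u \<partial>\<^sup>u\<close> is represented by its symbol \<open>\<Sum> c\<^sub>u \<xi>\<^sup>u\<close>, an element of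
  the commutative ring \<open>K[\<xi>]\<close>. Filter by total degree. The leading forms of \<open>\<H>(\<alpha>)\<close> contain the ideal
  \<open>J\<close> generated by the toric ideal and the Euler forms \<open>\<theta>\<^sub>i = \<Sum>\<^sub>j a\<^sub>i\<^sub>j v\<^sub>j \<xi>\<^sub>j\<close>. They are exactly \<open>J\<close>, for
  every \<open>\<alpha>\<close>, if all relations between the \<open>\<theta>\<^sub>i\<close> modulo the toric ideal are the trivial ones: then a
  cancellation of leading forms comes from the commutators of the \<open>Z\<^sub>i - \<alpha>\<^sub>i\<close>, which vanish
  (\<open>euler_ideal_representation\<close>). So a set of monomials that is a basis modulo \<open>J\<close> is a basis
  of every \<open>M(\<alpha>)\<close> (\<open>monomial_complement_euler_ideal\<close>). The same description of leading forms in degree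
  one gives the second fact, since \<open>\<partial>\<^sub>j \<in> \<H>(\<alpha>)\<close> would yield a linear form that vanishes on all
  points except \<open>a\<^sub>j\<close> (\<open>separated_if_xi_in_euler_ideal\<close>).

  Triviality of the relations. A chain of \<open>r + 1\<close> primes shows that the irrelevant ideal has height at
  least \<open>r\<close> in \<open>\<complex>[\<xi>] / I\<^sub>A\<close>. By the Cohen-Macaulay property it contains a regular sequence
  \<open>f\<^sub>1, \<dots>, f\<^sub>r\<close> (\<open>regular_sequence_modulo_toric_kernel\<close>), which stays regular over \<open>K\<close>
  (\<open>extended_sequence_regular\<close>). All monomials of large degree lie in \<open>J\<close>
  (\<open>large_monomials_in_toric_euler_ideal\<close>), so powers of the \<open>f\<^sub>i\<close> lie in the ideal of the \<open>\<theta>\<^sub>i\<close>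
  modulo the toric ideal, and this forces the first Koszul homology of the \<open>\<theta>\<^sub>i\<close> to vanish
  (\<open>koszul_first_syzygies\<close>). The statement on monomials of large degree also makes the dimension
  finite. It is a counting argument: modulo the \<open>\<theta>\<^sub>i\<close> and the toric ideal there are
  too few monomials for the products of the \<open>v\<^sub>j\<close> to remain linearly independent
  (\<open>power_of_xi_in_toric_euler_ideal\<close>).

  The third fact. Move a point of \<open>\<alpha> + \<int>\<^sup>r\<close> on the boundary to \<open>\<beta> = \<Sum> \<gamma>\<^sub>j a\<^sub>j\<close> with \<open>\<gamma>\<^sub>j \<ge> 0\<close>, where \<open>\<gamma>\<close>
  is supported on linearly independent points of a proper face. The series
  \<open>\<Phi> = \<Sum>\<^sub>l \<Prod>\<^sub>j v\<^sub>j\<^bsup>\<gamma>\<^sub>j + l\<^sub>j\<^esup> / \<Gamma>(\<gamma>\<^sub>j + l\<^sub>j + 1)\<close>, \<open>l \<in> L\<close>, is a formal solution of the system for \<open>\<beta>\<close>. It is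
  annihilated by \<open>\<partial>\<^sub>k\<close> for every point \<open>a\<^sub>k\<close> off the face, since only exponents \<open>l\<close> along the face
  occur, but by no nonzero polynomial. So \<open>1\<close> is not in \<open>\<H>(\<beta>) + K[\<partial>] \<partial>\<^sub>k\<close>
  (\<open>one_notin_hypergeom_symbols_plus_xi\<close>), that is, \<open>\<partial>\<^sub>k\<close> does not map onto \<open>M(\<beta>)\<close>.
\<close>

(* Exponents are built from the numeral 1, so 1 must not be rewritten to Suc 0. *)
declare One_nat_def [simp del]


section \<open>Additive maps on finitely supported functions\<close>

abbreviation coef :: "('a \<Rightarrow>\<^sub>0 'b::zero) \<Rightarrow> 'a \<Rightarrow> 'b" where "coef \<equiv> Poly_Mapping.lookup"
abbreviation supp :: "('a \<Rightarrow>\<^sub>0 'b::zero) \<Rightarrow> 'a set" where "supp \<equiv> Poly_Mapping.keys"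
abbreviation mon :: "'a \<Rightarrow> 'b \<Rightarrow> ('a \<Rightarrow>\<^sub>0 'b::zero)" where "mon \<equiv> Poly_Mapping.single"

abbreviation addhom :: "('a::ab_group_add \<Rightarrow> 'b::ab_group_add) \<Rightarrow> bool" where
  "addhom \<equiv> Modules.additive"
lemmas addhom_def = Modules.additive_def
lemmas addhom_add = Modules.additive.add
lemmas addhom_zero = Modules.additive.zero
lemmas addhom_minus = Modules.additive.minus
lemmas addhom_diff = Modules.additive.diff
lemmas addhom_sum = Modules.additive.sum

text \<open>
  The additive extension of a map that is prescribed on monomials.
\<close>

definition ext :: "('a \<Rightarrow> 'b \<Rightarrow> 'c) \<Rightarrow> ('a \<Rightarrow>\<^sub>0 'b::zero) \<Rightarrow> 'c::comm_monoid_add" where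
  "ext F p = (\<Sum>u\<in>supp p. F u (coef p u))"

lemma ext_superset:
  assumes "finite M" "supp p \<subseteq> M" "\<And>u. F u 0 = 0"
  shows "ext F p = (\<Sum>u\<in>M. F u (coef p u))"
  unfolding ext_def by (rule sum.mono_neutral_left) (use assms in \<open>auto simp: in_keys_iff\<close>)

lemma addhomI: "(\<And>x y. f (x + y) = f x + f y) \<Longrightarrow> addhom f"
  by (simp add: addhom_def)

lemma addhom_comp: "addhom f \<Longrightarrow> addhom g \<Longrightarrow> addhom (\<lambda>x. f (g x))"
  by (simp add: addhom_def)

lemma addhom_plus: "addhom f \<Longrightarrow> addhom g \<Longrightarrow> addhom (\<lambda>x. f x + g x)"
  by (simp add: addhom_def algebra_simps)

lemma addhom_subtract: "addhom f \<Longrightarrow> addhom g \<Longrightarrow> addhom (\<lambda>x. f x - g x)"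
  by (simp add: addhom_def algebra_simps)

lemma addhom_times: "addhom f \<Longrightarrow> addhom (\<lambda>x. c * f x :: 'a :: ring)"
  by (simp add: addhom_def algebra_simps)

lemma addhom_times_right: "addhom f \<Longrightarrow> addhom (\<lambda>x. f x * c :: 'a :: ring)"
  by (simp add: addhom_def algebra_simps)

lemma addhom_id: "addhom (\<lambda>x. x)"
  by (simp add: addhom_def)

lemma addhom_sumI: "(\<And>i. i \<in> I \<Longrightarrow> addhom (f i)) \<Longrightarrow> addhom (\<lambda>x. \<Sum>i\<in>I. f i x)"
  by (simp add: addhom_def sum.distrib)

lemmas addhom_intros = addhom_plus addhom_subtract addhom_times
  addhom_times_right addhom_id addhom_sumI

lemma addhom_mon: "addhom (mon u)"
  by (simp add: addhom_def single_add)

lemma addhom_coef: "addhom (\<lambda>p. coef p u)"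
  by (simp add: addhom_def lookup_add)

lemma addhom_ext:
  fixes F :: "'a \<Rightarrow> 'b::ab_group_add \<Rightarrow> 'c::ab_group_add"
  assumes "\<And>u. addhom (F u)"
  shows "addhom (ext F)"
proof (rule addhomI)
  fix p q :: "'a \<Rightarrow>\<^sub>0 'b"
  have 0: "F u 0 = 0" for u using addhom_zero[OF assms] .
  have "finite (supp p \<union> supp q)" "supp (p + q) \<subseteq> supp p \<union> supp q"
    using Poly_Mapping.keys_add[of p q] by auto
  then show "ext F (p + q) = ext F p + ext F q"
    by (simp add: ext_superset[of "supp p \<union> supp q" _ F] 0 lookup_add
        addhom_add[OF assms] sum.distrib)
qed

lemma ext_single: "F u 0 = 0 \<Longrightarrow> ext F (mon u c) = F u c"
  by (cases "c = 0") (auto simp: ext_def)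

lemma sum_single: "(\<Sum>u\<in>supp p. mon u (coef p u)) = (p :: 'a \<Rightarrow>\<^sub>0 'b::comm_monoid_add)"
  by (rule poly_mapping_eqI) (auto simp: lookup_sum lookup_single when_def in_keys_iff)

lemma pm_induct [case_names single add]:
  fixes p :: "'a \<Rightarrow>\<^sub>0 'b::comm_monoid_add"
  assumes "\<And>u c. P (mon u c)" and "\<And>p q. P p \<Longrightarrow> P q \<Longrightarrow> P (p + q)"
  shows "P p"
proof -
  have "P (\<Sum>m\<in>M. mon m (coef p m))" if "finite M" for M
    using that assms(1)[of undefined 0] by induction (auto intro: assms)
  then show ?thesis
    using finite_keys[of p] sum_single[of p] by metis
qed

text \<open>
  Identities between additive maps need to be checked on monomials only; most identities for
  symbols below are obtained this way, as equations between functions.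
\<close>

lemma addhom_eqI:
  fixes f g :: "('a \<Rightarrow>\<^sub>0 'b::ab_group_add) \<Rightarrow> 'c::ab_group_add"
  assumes "addhom f" "addhom g" "\<And>u c. f (mon u c) = g (mon u c)"
  shows "f = g"
proof
  show "f p = g p" for p
    by (induction p rule: pm_induct) (simp_all add: assms addhom_add[OF assms(1)] addhom_add[OF assms(2)])
qed

lemma underdetermined_system:
  fixes lam :: "'x \<Rightarrow> 'y \<Rightarrow> 'k::field"
  assumes "finite Y" "finite M" "card Y < card M"
  shows "\<exists>c. (\<exists>x\<in>M. c x \<noteq> 0) \<and> (\<forall>y\<in>Y. (\<Sum>x\<in>M. c x * lam x y) = 0)"
  using assms
proof (induction Y arbitrary: M lam rule: finite_induct)
  case empty
  then obtain x where "x \<in> M" by fastforce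
  then show ?case by (intro exI[of _ "\<lambda>_. 1"]) auto
next
  case (insert y0 Y)
  show ?case
  proof (cases "\<forall>x\<in>M. lam x y0 = 0")
    case True
    obtain c where "\<exists>x\<in>M. c x \<noteq> 0" "\<forall>y\<in>Y. (\<Sum>x\<in>M. c x * lam x y) = 0"
      using insert.IH[of M lam] insert.prems insert.hyps by auto
    then show ?thesis using True by (intro exI[of _ c]) auto
  next
    case False
    then obtain x0 where x0: "x0 \<in> M" "lam x0 y0 \<noteq> 0" by auto
    define M' where "M' = M - {x0}"
    have M': "finite M'" "card Y < card M'" "M = insert x0 M'" "x0 \<notin> M'"
      using insert.prems insert.hyps x0 by (auto simp: M'_def card_Diff_singleton)
    obtain c where c: "\<exists>x\<in>M'. c x \<noteq> 0"
      "\<forall>y\<in>Y. (\<Sum>x\<in>M'. c x * (lam x y - lam x y0 / lam x0 y0 * lam x0 y)) = 0"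
      using insert.IH[OF M'(1,2), of "\<lambda>x y. lam x y - lam x y0 / lam x0 y0 * lam x0 y"] by auto
    define s where "s = (\<Sum>x\<in>M'. c x * lam x y0)"
    define c' where "c' = c(x0 := - s / lam x0 y0)"
    have c'M: "(\<Sum>x\<in>M'. c' x * lam x y) = (\<Sum>x\<in>M'. c x * lam x y)" for y
      using M'(4) by (intro sum.cong) (auto simp: c'_def)
    have sum: "(\<Sum>x\<in>M. c' x * lam x y) = (\<Sum>x\<in>M'. c x * lam x y) - s / lam x0 y0 * lam x0 y" for y
      using M' c'M[of y] by (simp add: c'_def)
    have "(\<Sum>x\<in>M. c' x * lam x y) = 0" if "y \<in> Y" for y
    proof -
      have "(\<Sum>x\<in>M'. c x * (lam x y - lam x y0 / lam x0 y0 * lam x0 y)) =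
          (\<Sum>x\<in>M'. c x * lam x y) - (\<Sum>x\<in>M'. c x * lam x y0) * (lam x0 y / lam x0 y0)"
        by (simp add: algebra_simps sum_subtractf sum_distrib_left sum_distrib_right)
      then show ?thesis using c(2) that sum[of y] by (simp add: s_def algebra_simps)
    qed
    moreover have "(\<Sum>x\<in>M. c' x * lam x y0) = 0"
      using sum[of y0] x0 by (simp add: s_def)
    moreover have "\<exists>x\<in>M. c' x \<noteq> 0"
      using c(1) M' by (auto simp: c'_def)
    ultimately show ?thesis by (intro exI[of _ c']) auto
  qed
qed


section \<open>Koszul complexes and first syzygies\<close>

text \<open>
  Ideals of a commutative ring given by a type class, where the carrier is the whole type.
\<close>

definition ring_ideal :: "'a::comm_ring_1 set \<Rightarrow> bool" where
  "ring_ideal I \<longleftrightarrow> 0 \<in> I \<and> (\<forall>x\<in>I. \<forall>y\<in>I. x + y \<in> I) \<and> (\<forall>x\<in>I. \<forall>c. c * x \<in> I)"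

lemma ring_idealD:
  assumes "ring_ideal I"
  shows "0 \<in> I" "\<And>x y. x \<in> I \<Longrightarrow> y \<in> I \<Longrightarrow> x + y \<in> I" "\<And>x c. x \<in> I \<Longrightarrow> c * x \<in> I"
    "\<And>x c. x \<in> I \<Longrightarrow> x * c \<in> I"
    "\<And>x. x \<in> I \<Longrightarrow> - x \<in> I" "\<And>x y. x \<in> I \<Longrightarrow> y \<in> I \<Longrightarrow> x - y \<in> I"
proof -
  show *: "0 \<in> I" "\<And>x y. x \<in> I \<Longrightarrow> y \<in> I \<Longrightarrow> x + y \<in> I" "\<And>x c. x \<in> I \<Longrightarrow> c * x \<in> I"
    using assms by (auto simp: ring_ideal_def)
  show "x * c \<in> I" if "x \<in> I" for x c using *(3)[OF that, of c] by (simp add: mult.commute)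
  show neg: "- x \<in> I" if "x \<in> I" for x using *(3)[OF that, of "- 1"] by simp
  show "x - y \<in> I" if "x \<in> I" "y \<in> I" for x y using *(2)[OF that(1) neg[OF that(2)]] by simp
qed

lemma ring_ideal_sum: "ring_ideal I \<Longrightarrow> (\<And>i. i \<in> B \<Longrightarrow> f i \<in> I) \<Longrightarrow> sum f B \<in> I"
  by (induction B rule: infinite_finite_induct) (auto simp: ring_idealD)

text \<open>
  The Koszul complex of \<open>\<theta>\<^sub>0, \<dots>, \<theta>\<^bsub>r - 1\<^esub>\<close>. A chain is a function \<open>x\<close> on the finite subsets of \<open>{..<r}\<close>, with
  \<open>x A\<close> the coefficient of the exterior product of the basis vectors \<open>e\<^sub>i\<close>, \<open>i \<in> A\<close>. The sign is the one
  that moves \<open>e\<^sub>i\<close> to its place in this product. The differential \<open>koszul_d\<close> contracts with \<open>\<theta>\<close> and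
  \<open>koszul_wedge\<close> multiplies with \<open>\<Sum> g\<^sub>i e\<^sub>i\<close>.
\<close>

definition koszul_sign :: "nat \<Rightarrow> nat set \<Rightarrow> 'a::comm_ring_1" where
  "koszul_sign i A = (- 1) ^ card {b\<in>A. b < i}"

definition koszul_d :: "nat \<Rightarrow> (nat \<Rightarrow> 'a) \<Rightarrow> (nat set \<Rightarrow> 'a) \<Rightarrow> nat set \<Rightarrow> 'a::comm_ring_1" where
  "koszul_d r \<theta> x A = (\<Sum>i\<in>{..<r} - A. koszul_sign i A * \<theta> i * x (insert i A))"

definition koszul_wedge :: "nat \<Rightarrow> (nat \<Rightarrow> 'a) \<Rightarrow> (nat set \<Rightarrow> 'a) \<Rightarrow> nat set \<Rightarrow> 'a::comm_ring_1" where
  "koszul_wedge r g x A = (\<Sum>i\<in>A \<inter> {..<r}. koszul_sign i A * g i * x (A - {i}))"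

definition koszul_degree :: "nat \<Rightarrow> nat \<Rightarrow> (nat set \<Rightarrow> 'a::comm_ring_1) \<Rightarrow> bool" where
  "koszul_degree r d x \<longleftrightarrow> (\<forall>A. x A \<noteq> 0 \<longrightarrow> A \<subseteq> {..<r} \<and> card A = d)"

lemma koszul_sign_insert:
  assumes "finite A" "i \<notin> A" "i \<noteq> j"
  shows "koszul_sign j (insert i A) = (if i < j then - koszul_sign j A else koszul_sign j A)"
proof -
  have "{b\<in>insert i A. b < j} = (if i < j then insert i {b\<in>A. b < j} else {b\<in>A. b < j})"
    by auto
  then show ?thesis using assms by (simp add: koszul_sign_def)
qed

lemma koszul_sign_self: "koszul_sign i (insert i A) = koszul_sign i A" "koszul_sign i (A - {i}) = koszul_sign i A"
  unfolding koszul_sign_def by (rule arg_cong[where f="\<lambda>S. (-1) ^ card S"]; auto)+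

lemma koszul_sign_square: "koszul_sign i A * koszul_sign i A = 1" "koszul_sign i A * (koszul_sign i A * y) = y"
  unfolding koszul_sign_def mult.assoc[symmetric] power_add[symmetric] by simp_all

text \<open>
  The standard homotopy: the ideal generated by \<open>\<theta>\<close> annihilates Koszul homology.
\<close>

lemma koszul_homotopy:
  assumes "A \<subseteq> {..<r}"
  shows "koszul_d r \<theta> (koszul_wedge r g x) A + koszul_wedge r g (koszul_d r \<theta> x) A =
    (\<Sum>i<r. g i * \<theta> i) * x A"
proof -
  have finA: "finite A" using assms finite_subset by blast
  let ?s = "koszul_sign :: nat \<Rightarrow> nat set \<Rightarrow> 'a"
  have AA: "A \<inter> {..<r} = A" using assms by auto
  have 1: "?s i A * \<theta> i * koszul_wedge r g x (insert i A) = g i * \<theta> i * x A +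
      (\<Sum>j\<in>A. ?s i A * ?s j (insert i A) * (\<theta> i * g j * x (insert i (A - {j}))))"
    if "i \<in> {..<r} - A" for i
  proof -
    have "insert i A \<inter> {..<r} = insert i A" "i \<notin> A" using that assms by auto
    then have "koszul_wedge r g x (insert i A) = ?s i (insert i A) * g i * x A +
       (\<Sum>j\<in>A. ?s j (insert i A) * g j * x (insert i A - {j}))"
      using finA by (simp add: koszul_wedge_def)
    also have "(\<Sum>j\<in>A. ?s j (insert i A) * g j * x (insert i A - {j})) =
       (\<Sum>j\<in>A. ?s j (insert i A) * g j * x (insert i (A - {j})))"
      using that by (intro sum.cong refl) (auto simp: insert_Diff_if)
    finally show ?thesis
      by (simp add: koszul_sign_self distrib_left sum_distrib_left mult_ac koszul_sign_square)
  qed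
  have 2: "?s j A * g j * koszul_d r \<theta> x (A - {j}) = g j * \<theta> j * x A +
      (\<Sum>i\<in>{..<r} - A. ?s j A * ?s i (A - {j}) * (\<theta> i * g j * x (insert i (A - {j}))))"
    if "j \<in> A" for j
  proof -
    have "{..<r} - (A - {j}) = insert j ({..<r} - A)" "insert j (A - {j}) = A" using that assms by auto
    then have "koszul_d r \<theta> x (A - {j}) = ?s j (A - {j}) * \<theta> j * x A +
       (\<Sum>i\<in>{..<r} - A. ?s i (A - {j}) * \<theta> i * x (insert i (A - {j})))"
      using that by (simp add: koszul_d_def)
    then show ?thesis
      by (simp add: koszul_sign_self distrib_left sum_distrib_left mult_ac koszul_sign_square)
  qed
  have 3: "?s i A * ?s j (insert i A) * y + ?s j A * ?s i (A - {j}) * y = 0"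
    if "i \<in> {..<r} - A" "j \<in> A" for i j y
  proof -
    have ij: "i \<noteq> j" "i \<notin> A" "i \<notin> A - {j}" "j \<notin> A - {j}" "finite (A - {j})" using that finA by auto
    have "?s i A = ?s i (insert j (A - {j}))" using that by (simp add: insert_absorb)
    also have "\<dots> = (if j < i then - ?s i (A - {j}) else ?s i (A - {j}))"
      using ij by (subst koszul_sign_insert) auto
    finally show ?thesis
      using ij finA by (auto simp: koszul_sign_insert mult_ac)
  qed
  have "koszul_d r \<theta> (koszul_wedge r g x) A + koszul_wedge r g (koszul_d r \<theta> x) A =
     (\<Sum>i\<in>{..<r} - A. g i * \<theta> i * x A +
      (\<Sum>j\<in>A. ?s i A * ?s j (insert i A) * (\<theta> i * g j * x (insert i (A - {j}))))) +
     (\<Sum>j\<in>A. g j * \<theta> j * x A +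
      (\<Sum>i\<in>{..<r} - A. ?s j A * ?s i (A - {j}) * (\<theta> i * g j * x (insert i (A - {j})))))"
    unfolding koszul_d_def[of r \<theta> "koszul_wedge r g x"] koszul_wedge_def[of r g "koszul_d r \<theta> x"] AA
    by (intro arg_cong2[where f="(+)"] sum.cong refl 1 2)
  also have "\<dots> = (\<Sum>i\<in>{..<r} - A. g i * \<theta> i * x A) + (\<Sum>j\<in>A. g j * \<theta> j * x A) +
     ((\<Sum>i\<in>{..<r} - A. \<Sum>j\<in>A. ?s i A * ?s j (insert i A) * (\<theta> i * g j * x (insert i (A - {j})))) +
     (\<Sum>j\<in>A. \<Sum>i\<in>{..<r} - A. ?s j A * ?s i (A - {j}) * (\<theta> i * g j * x (insert i (A - {j})))))"
    by (simp add: sum.distrib)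
  also have "(\<Sum>j\<in>A. \<Sum>i\<in>{..<r} - A. ?s j A * ?s i (A - {j}) * (\<theta> i * g j * x (insert i (A - {j})))) =
     (\<Sum>i\<in>{..<r} - A. \<Sum>j\<in>A. ?s j A * ?s i (A - {j}) * (\<theta> i * g j * x (insert i (A - {j}))))"
    by (rule sum.swap)
  also have "(\<Sum>i\<in>{..<r} - A. \<Sum>j\<in>A. ?s i A * ?s j (insert i A) * (\<theta> i * g j * x (insert i (A - {j})))) +
      (\<Sum>i\<in>{..<r} - A. \<Sum>j\<in>A. ?s j A * ?s i (A - {j}) * (\<theta> i * g j * x (insert i (A - {j})))) = 0"
    unfolding sum.distrib[symmetric] by (intro sum.neutral ballI) (use 3 in auto)
  also have "(\<Sum>i\<in>{..<r} - A. g i * \<theta> i * x A) + (\<Sum>j\<in>A. g j * \<theta> j * x A) = (\<Sum>i<r. g i * \<theta> i * x A)"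
    by (rule sum.subset_diff[symmetric]) (use assms in auto)
  finally show ?thesis by (simp add: sum_distrib_right)
qed

lemma koszul_d_d:
  fixes x :: "nat set \<Rightarrow> 'a::comm_ring_1"
  assumes "A \<subseteq> {..<r}"
  shows "koszul_d r \<theta> (koszul_d r \<theta> x) A = 0"
proof -
  have finA: "finite A" using assms finite_subset by blast
  let ?s = "koszul_sign :: nat \<Rightarrow> nat set \<Rightarrow> 'a"
  define C where "C = {..<r} - A"
  have finC: "finite C" by (simp add: C_def)
  define F where "F i j = ?s i A * ?s j (insert i A) * (\<theta> i * \<theta> j * x (insert i (insert j A)))" for i j
  have "koszul_d r \<theta> (koszul_d r \<theta> x) A = (\<Sum>i\<in>C. \<Sum>j\<in>C - {i}. F i j)"
    unfolding koszul_d_def C_def F_def sum_distrib_left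
    by (intro sum.cong refl) (auto simp: mult_ac insert_commute)
  also have "\<dots> = (\<Sum>i\<in>C. \<Sum>j\<in>C. if i = j then 0 else F i j)" (is "_ = ?S")
    using finC by (intro sum.cong refl sum.mono_neutral_cong_left) auto
  finally have S: "koszul_d r \<theta> (koszul_d r \<theta> x) A = ?S" .
  have anti: "F i j = - F j i" if "i \<in> C" "j \<in> C" "i \<noteq> j" for i j
    using that finA by (auto simp: F_def C_def koszul_sign_insert mult_ac insert_commute)
  let ?L = "\<Sum>i\<in>C. \<Sum>j\<in>C. if i < j then F i j else 0"
  have "?S = ?L + (\<Sum>i\<in>C. \<Sum>j\<in>C. if j < i then F i j else 0)"
    unfolding sum.distrib[symmetric] by (intro sum.cong refl) auto
  also have "(\<Sum>i\<in>C. \<Sum>j\<in>C. if j < i then F i j else 0) = (\<Sum>j\<in>C. \<Sum>i\<in>C. if j < i then F i j else 0)"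
    by (rule sum.swap)
  also have "\<dots> = - ?L"
    unfolding sum_negf[symmetric]
  proof (intro sum.cong refl)
    fix j i assume "j \<in> C" "i \<in> C"
    then show "(if j < i then F i j else 0) = - (if j < i then F j i else 0)"
      using anti[of i j] by auto
  qed
  finally have "?S = 0" by simp
  with S show ?thesis by simp
qed

lemma koszul_d_mult: "koszul_d r \<theta> (\<lambda>A. c * x A) A = c * koszul_d r \<theta> x A"
  by (simp add: koszul_d_def sum_distrib_left mult_ac)

lemma koszul_d_add: "koszul_d r \<theta> (\<lambda>A. x A + y A) A = koszul_d r \<theta> x A + koszul_d r \<theta> y A"
  by (simp add: koszul_d_def sum.distrib distrib_left)

lemma koszul_d_in:
  assumes "ring_ideal I" "\<And>A. A \<subseteq> {..<r} \<Longrightarrow> x A \<in> I" "A \<subseteq> {..<r}"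
  shows "koszul_d r \<theta> x A \<in> I"
  unfolding koszul_d_def using assms by (intro ring_ideal_sum ring_idealD(3)) auto

lemma koszul_wedge_in:
  assumes "ring_ideal I" "\<And>A. A \<subseteq> {..<r} \<Longrightarrow> x A \<in> I" "A \<subseteq> {..<r}"
  shows "koszul_wedge r g x A \<in> I"
  unfolding koszul_wedge_def
proof (intro ring_ideal_sum ring_idealD(3) assms(1))
  show "x (A - {i}) \<in> I" for i using assms(3) by (intro assms(2)) auto
qed

lemma koszul_degree_wedge:
  assumes "koszul_degree r d x"
  shows "koszul_degree r (Suc d) (koszul_wedge r g x)"
  unfolding koszul_degree_def
proof (intro allI impI)
  fix A assume "koszul_wedge r g x A \<noteq> 0"
  then obtain i where "i \<in> A \<inter> {..<r}" "koszul_sign i A * g i * x (A - {i}) \<noteq> 0"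
    unfolding koszul_wedge_def by (rule sum.not_neutral_contains_not_neutral)
  then have i: "i \<in> A" "i < r" "x (A - {i}) \<noteq> 0" by auto
  then have *: "A - {i} \<subseteq> {..<r}" "card (A - {i}) = d" using assms by (auto simp: koszul_degree_def)
  have "finite (A - {i})" using *(1) by (rule finite_subset) simp
  then have "finite A" by simp
  then have "card A = Suc d" using * i by (metis card_Suc_Diff1)
  then show "A \<subseteq> {..<r} \<and> card A = Suc d" using * i by auto
qed

text \<open>
  Depth sensitivity of the Koszul complex, in the special form that is needed: a sequence \<open>f\<close> that is
  regular modulo \<open>J 0\<close>, with \<open>J k\<close> the ideal after \<open>k\<close> of its members, and whose members have powers in
  the ideal of \<open>\<theta>\<close>, makes the homology modulo \<open>J k\<close> vanish in the degrees above \<open>k\<close>. The induction goes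
  down from \<open>k = r\<close>, where there are no nonzero chains of degree above \<open>r\<close>. By the homotopy, \<open>f\<^sub>k\<^sup>n x\<close> is a
  boundary modulo \<open>J k\<close> for every cycle \<open>x\<close>, and the factors \<open>f\<^sub>k\<close> are removed one at a time.
\<close>

lemma koszul_acyclic:
  fixes \<theta> f :: "nat \<Rightarrow> 'a::comm_ring_1" and J :: "nat \<Rightarrow> 'a set"
  assumes idl: "\<And>k. k \<le> r \<Longrightarrow> ring_ideal (J k)"
    and reg: "\<And>k y. k < r \<Longrightarrow> f k * y \<in> J k \<Longrightarrow> y \<in> J k"
    and Suc: "\<And>k. k < r \<Longrightarrow> J (Suc k) = {b + f k * c | b c. b \<in> J k}"
    and pow: "\<And>k. k < r \<Longrightarrow> \<exists>n g b. f k ^ n = (\<Sum>i<r. g i * \<theta> i) + b \<and> b \<in> J 0"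
    and "k \<le> r" "k < d" "koszul_degree r d x" "\<And>A. A \<subseteq> {..<r} \<Longrightarrow> koszul_d r \<theta> x A \<in> J k"
  shows "\<exists>w. koszul_degree r (Suc d) w \<and> (\<forall>A\<subseteq>{..<r}. x A - koszul_d r \<theta> w A \<in> J k)"
  using assms(5-8)
proof (induction "r - k" arbitrary: k d x)
  case 0
  have "x A = 0" for A
    using 0 card_mono[of "{..<r}" A] by (auto simp: koszul_degree_def)
  then show ?case
    using idl[OF "0.prems"(1)] by (intro exI[of _ "\<lambda>_. 0"]) (auto simp: koszul_degree_def koszul_d_def ring_idealD)
next
  case (Suc m)
  then have k: "k < r" by auto
  note I = ring_idealD[OF idl[OF Suc.prems(1)]]
  have Jmono: "J 0 \<subseteq> J k'" if "k' \<le> r" for k'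
    using that
  proof (induction k')
    case (Suc j)
    have "b \<in> J (Suc j)" if "b \<in> J j" for b
    proof -
      have "b = b + f j * 0" by simp
      moreover have "j < r" using Suc.prems by simp
      ultimately show ?thesis using assms(3)[of j] that by blast
    qed
    then have "J j \<subseteq> J (Suc j)" by blast
    then show ?case using Suc by auto
  qed auto
  (* If f k * x is the boundary of y modulo J k, then y is a cycle modulo J (k + 1), hence a boundary
     there. So y can be corrected to a multiple of f k, and regularity cancels the factor f k. *)
  have step: "\<exists>w. koszul_degree r (Suc d) w \<and> (\<forall>A\<subseteq>{..<r}. x A - koszul_d r \<theta> w A \<in> J k)"
    if x: "koszul_degree r d x" and y: "koszul_degree r (Suc d) y"
      and xy: "\<And>A. A \<subseteq> {..<r} \<Longrightarrow> f k * x A - koszul_d r \<theta> y A \<in> J k" for x y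
  proof -
    have "koszul_d r \<theta> y A \<in> J (Suc k)" if "A \<subseteq> {..<r}" for A
    proof -
      have "koszul_d r \<theta> y A = - (f k * x A - koszul_d r \<theta> y A) + f k * x A" by simp
      then show ?thesis using I(5)[OF xy[OF that]] assms(3)[OF k] by blast
    qed
    then have "\<exists>z. koszul_degree r (Suc (Suc d)) z \<and> (\<forall>A\<subseteq>{..<r}. y A - koszul_d r \<theta> z A \<in> J (Suc k))"
      by (intro Suc.hyps(1)) (use Suc.hyps(2) Suc.prems(2) y k in \<open>simp_all\<close>)
    then obtain z where z: "\<And>A. A \<subseteq> {..<r} \<Longrightarrow> y A - koszul_d r \<theta> z A \<in> J (Suc k)"
      and zd: "koszul_degree r (Suc (Suc d)) z"
      by blast
    have "\<exists>w b. y A = koszul_d r \<theta> z A + f k * w + b \<and> b \<in> J k \<and> (\<not> (A \<subseteq> {..<r} \<and> card A = Suc d) \<longrightarrow> w = 0)"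
      if sub: "A \<subseteq> {..<r}" for A
    proof (cases "card A = Suc d")
      case True
      obtain b c where "y A - koszul_d r \<theta> z A = b + f k * c" "b \<in> J k"
        using z[OF sub] assms(3)[OF k] by auto
      moreover from this have "y A = koszul_d r \<theta> z A + f k * c + b" by (simp add: diff_eq_eq add_ac)
      ultimately show ?thesis using True sub by blast
    next
      case False
      then have "y A = 0" using y by (auto simp: koszul_degree_def)
      moreover have "z (insert i A) = 0" if "i \<notin> A" for i
        using zd False that finite_subset[OF \<open>A \<subseteq> {..<r}\<close>] by (auto simp: koszul_degree_def)
      then have "koszul_d r \<theta> z A = 0" by (auto simp: koszul_d_def intro!: sum.neutral)
      ultimately show ?thesis using I(1) by (intro exI[of _ 0]) auto
    qed
    then obtain w b where w: "\<And>A. A \<subseteq> {..<r} \<Longrightarrow> y A = koszul_d r \<theta> z A + f k * w A + b A"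
      "\<And>A. A \<subseteq> {..<r} \<Longrightarrow> b A \<in> J k"
      "\<And>A. A \<subseteq> {..<r} \<Longrightarrow> \<not> (A \<subseteq> {..<r} \<and> card A = Suc d) \<Longrightarrow> w A = 0"
      by metis
    define w' where "w' A = (if A \<subseteq> {..<r} then w A else 0)" for A
    have "koszul_degree r (Suc d) w'" using w(3) by (auto simp: w'_def koszul_degree_def split: if_splits)
    moreover have "x A - koszul_d r \<theta> w' A \<in> J k" if A: "A \<subseteq> {..<r}" for A
    proof -
      have "koszul_d r \<theta> y A = koszul_d r \<theta> (\<lambda>A. koszul_d r \<theta> z A + f k * w' A + b A) A"
        unfolding koszul_d_def[of r \<theta> y] koszul_d_def[of r \<theta> "\<lambda>A. koszul_d r \<theta> z A + f k * w' A + b A"]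
      proof (intro sum.cong refl)
        fix i assume "i \<in> {..<r} - A"
        then have "insert i A \<subseteq> {..<r}" using A by auto
        then show "koszul_sign i A * \<theta> i * y (insert i A) = koszul_sign i A * \<theta> i *
            (koszul_d r \<theta> z (insert i A) + f k * w' (insert i A) + b (insert i A))"
          using w(1)[of "insert i A"] by (simp add: w'_def)
      qed
      also have "\<dots> = f k * koszul_d r \<theta> w' A + koszul_d r \<theta> b A"
        using koszul_d_d[OF A, of \<theta> z] by (simp add: koszul_d_add koszul_d_mult)
      finally have "f k * (x A - koszul_d r \<theta> w' A) = (f k * x A - koszul_d r \<theta> y A) + koszul_d r \<theta> b A"
        by (simp add: algebra_simps)
      moreover have "koszul_d r \<theta> b A \<in> J k"
        using idl[OF Suc.prems(1)] w(2) A by (intro koszul_d_in) auto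
      ultimately have "f k * (x A - koszul_d r \<theta> w' A) \<in> J k" using I(2)[OF xy[OF A]] by simp
      then show ?thesis by (rule reg[OF k])
    qed
    ultimately show ?thesis by blast
  qed
  have iter: "\<exists>w. koszul_degree r (Suc d) w \<and> (\<forall>A\<subseteq>{..<r}. x A - koszul_d r \<theta> w A \<in> J k)"
    if "koszul_degree r (Suc d) y" "\<And>A. A \<subseteq> {..<r} \<Longrightarrow> f k ^ n * x A - koszul_d r \<theta> y A \<in> J k" for n y
    using that
  proof (induction n arbitrary: y)
    case 0
    then show ?case by auto
  next
    case (Suc n)
    have "koszul_degree r d (\<lambda>A. f k ^ n * x A)"
      using \<open>koszul_degree r d x\<close> unfolding koszul_degree_def by (metis mult_zero_right)
    then obtain w where "koszul_degree r (Suc d) w" "\<forall>A\<subseteq>{..<r}. f k ^ n * x A - koszul_d r \<theta> w A \<in> J k"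
      using step[of "\<lambda>A. f k ^ n * x A" y] Suc.prems by (simp add: mult.assoc) blast
    then show ?case using Suc.IH by blast
  qed
  obtain n g b where ngb: "f k ^ n = (\<Sum>i<r. g i * \<theta> i) + b" "b \<in> J 0" using pow[OF k] by auto
  show ?case
  proof (rule iter)
    show "koszul_degree r (Suc d) (koszul_wedge r g x)" by (rule koszul_degree_wedge) (rule Suc.prems)
    fix A assume A: "A \<subseteq> {..<r}"
    have "f k ^ n * x A - koszul_d r \<theta> (koszul_wedge r g x) A = koszul_wedge r g (koszul_d r \<theta> x) A + b * x A"
      unfolding ngb(1) distrib_right koszul_homotopy[OF A, symmetric] by simp
    also have "\<dots> \<in> J k"
      using idl[OF Suc.prems(1)] Suc.prems(4) A ngb(2) Jmono[OF Suc.prems(1)]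
      by (intro I(2) koszul_wedge_in I(4)) auto
    finally show "f k ^ n * x A - koszul_d r \<theta> (koszul_wedge r g x) A \<in> J k" .
  qed
qed

text \<open>
  The case of degree one and \<open>k = 0\<close>: every syzygy of \<open>\<theta>\<close> is an antisymmetric combination of the
  trivial ones. The matrix \<open>c\<close> lists the coefficients of a Koszul chain on the pairs \<open>{i, j}\<close>.
\<close>

lemma koszul_first_syzygies:
  fixes \<theta> f p :: "nat \<Rightarrow> 'a::comm_ring_1" and J :: "nat \<Rightarrow> 'a set"
  assumes idl: "\<And>k. k \<le> r \<Longrightarrow> ring_ideal (J k)"
    and reg: "\<And>k y. k < r \<Longrightarrow> f k * y \<in> J k \<Longrightarrow> y \<in> J k"
    and Suc: "\<And>k. k < r \<Longrightarrow> J (Suc k) = {b + f k * c | b c. b \<in> J k}"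
    and pow: "\<And>k. k < r \<Longrightarrow> \<exists>n g b. f k ^ n = (\<Sum>i<r. g i * \<theta> i) + b \<and> b \<in> J 0"
    and syz: "(\<Sum>i<r. p i * \<theta> i) \<in> J 0"
  shows "\<exists>c. (\<forall>i<r. \<forall>j<r. c i j = - c j i) \<and> (\<forall>i<r. p i - (\<Sum>j<r. c i j * \<theta> j) \<in> J 0)"
proof -
  define x where "x A = (if \<exists>i<r. A = {i} then p (the_elem A) else 0)" for A
  have xi: "x {i} = p i" if "i < r" for i using that by (auto simp: x_def)
  have xdeg: "koszul_degree r 1 x" by (auto simp: koszul_degree_def x_def)
  have "koszul_d r \<theta> x A \<in> J 0" if A: "A \<subseteq> {..<r}" for A
  proof (cases "A = {}")
    case True
    have "koszul_d r \<theta> x A = (\<Sum>i<r. p i * \<theta> i)"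
      by (auto simp: koszul_d_def True koszul_sign_def xi mult_ac intro!: sum.cong)
    then show ?thesis using syz by simp
  next
    case False
    have "x (insert i A) = 0" if "i \<notin> A" for i
      using False that xdeg finite_subset[OF A] by (auto simp: koszul_degree_def)
    then have "koszul_d r \<theta> x A = 0" by (auto simp: koszul_d_def intro!: sum.neutral)
    then show ?thesis using ring_idealD(1)[OF idl] by simp
  qed
  then obtain w where w: "\<And>A. A \<subseteq> {..<r} \<Longrightarrow> x A - koszul_d r \<theta> w A \<in> J 0"
    using koszul_acyclic[OF idl reg Suc pow _ _ xdeg, of 0] by auto
  define c where "c i j = (if i = j then 0 else koszul_sign j {i} * w {i, j})" for i j
  have anti: "c i j = - c j i" for i j
  proof -
    have *: "{b. b = i \<and> b < j} = (if i < j then {i} else {})" for i j :: nat by auto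
    show ?thesis by (auto simp: c_def koszul_sign_def insert_commute *)
  qed
  have "p i - (\<Sum>j<r. c i j * \<theta> j) \<in> J 0" if i: "i < r" for i
  proof -
    have "(\<Sum>j<r. c i j * \<theta> j) = koszul_d r \<theta> w {i}"
      unfolding koszul_d_def c_def
      by (intro sum.mono_neutral_cong_right) (auto simp: mult_ac insert_commute)
    then show ?thesis using w[of "{i}"] i xi by auto
  qed
  with anti show ?thesis by blast
qed


section \<open>Symbols, the toric kernel and the Euler forms\<close>

instance fract :: ("{idom,ring_char_0}") ring_char_0
proof
  show "inj (of_nat :: nat \<Rightarrow> 'a fract)"
    by (rule injI) (simp add: of_nat_fract eq_fract)
qed

text \<open>
  Symbols are polynomials in commuting variables \<open>\<xi>\<^sub>j\<close>, represented like the polynomials in \<open>v\<^sub>j\<close> as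
  finitely supported functions on exponents. The ring of coefficients is arbitrary at first, because
  the same notions are used over \<open>\<complex>\<close>, over \<open>\<complex>[v]\<close> and over \<open>K = \<complex>(v)\<close>.
\<close>

abbreviation cst :: "'k::zero \<Rightarrow> (('n \<Rightarrow>\<^sub>0 nat) \<Rightarrow>\<^sub>0 'k)" where "cst c \<equiv> mon 0 c"

definition xi :: "'n \<Rightarrow> (('n \<Rightarrow>\<^sub>0 nat) \<Rightarrow>\<^sub>0 'k::comm_ring_1)" where
  "xi j = mon (mon j 1) 1"

lemma xi_mon: "xi j * mon u c = mon (mon j 1 + u) c"
  by (simp add: xi_def mult_single)

lemma cst_mon: "cst c * mon u d = mon u (c * d)"
  by (simp add: mult_single)

lemma of_int_mon: "of_int n * mon u c = mon u (of_int n * c)" for u :: "'n \<Rightarrow>\<^sub>0 nat"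
  using cst_mon[of "of_int n" u c] by simp

lemma cst_coef: "coef (cst c * p) u = c * coef p u" for p :: "('n \<Rightarrow>\<^sub>0 nat) \<Rightarrow>\<^sub>0 'k::comm_ring_1"
proof -
  have "(\<lambda>p. coef (cst c * p) u) = (\<lambda>p. c * coef p u)"
    by (rule addhom_eqI) (auto intro!: addhomI simp: distrib_left lookup_add cst_mon lookup_single when_def)
  from fun_cong[OF this] show ?thesis .
qed

definition total_degree :: "('n::finite \<Rightarrow>\<^sub>0 nat) \<Rightarrow> nat" where
  "total_degree u = (\<Sum>j\<in>UNIV. coef u j)"

lemma total_degree_add: "total_degree (u + v) = total_degree u + total_degree v"
  by (simp add: total_degree_def lookup_add sum.distrib)

lemma total_degree_single: "total_degree (mon j n) = n"
  by (simp add: total_degree_def lookup_single when_def)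

lemma total_degree_0: "total_degree u = 0 \<longleftrightarrow> u = 0"
  by (auto simp: total_degree_def intro: poly_mapping_eqI)

lemma total_degree_zero [simp]: "total_degree 0 = 0"
  by (simp add: total_degree_0)

definition point_sum :: "('n::finite \<Rightarrow> int ^ 'r) \<Rightarrow> ('n \<Rightarrow>\<^sub>0 nat) \<Rightarrow> int ^ 'r" where
  "point_sum a u = (\<Sum>j\<in>UNIV. int (coef u j) *s a j)"

lemma point_sum_add: "point_sum a (u + v) = point_sum a u + point_sum a v"
  by (simp add: point_sum_def lookup_add sum.distrib vector_sadd_rdistrib)

lemma point_sum_single: "point_sum a (mon j n) = int n *s a j"
proof -
  have "point_sum a (mon j n) = (\<Sum>i\<in>UNIV. if i = j then int n *s a j else 0)"
    unfolding point_sum_def by (intro sum.cong) (auto simp: lookup_single when_def)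
  then show ?thesis by simp
qed

lemma point_sum_zero [simp]: "point_sum a 0 = 0"
  by (simp add: point_sum_def)

text \<open>
  The homomorphism \<open>\<xi>\<^sub>j \<mapsto> t\<^bsup>a\<^sub>j\<^esup>\<close> into Laurent polynomials. Its kernel is the toric ideal
  (\<open>toric_ideal_eq\<close>), and membership in the kernel is easier to handle than generation by box
  operators.
\<close>

definition toric_map :: "('n::finite \<Rightarrow> int ^ 'r) \<Rightarrow> (('n \<Rightarrow>\<^sub>0 nat) \<Rightarrow>\<^sub>0 'k::comm_ring_1) \<Rightarrow> (int ^ 'r \<Rightarrow>\<^sub>0 'k)" where
  "toric_map a = ext (\<lambda>u c. mon (point_sum a u) c)"

lemma addhom_toric_map: "addhom (toric_map a)"
  unfolding toric_map_def by (intro addhom_ext addhom_mon)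

lemma toric_map_single: "toric_map a (mon u c) = mon (point_sum a u) c"
  unfolding toric_map_def by (rule ext_single) simp

lemma toric_map_mult: "toric_map a (p * q) = toric_map a p * toric_map a q"
proof (induction p rule: pm_induct)
  case (single u c)
  show ?case
    by (induction q rule: pm_induct)
       (simp_all add: mult_single toric_map_single point_sum_add distrib_left addhom_add[OF addhom_toric_map])
qed (simp add: distrib_right addhom_add[OF addhom_toric_map])

definition toric_kernel :: "('n::finite \<Rightarrow> int ^ 'r) \<Rightarrow> (('n \<Rightarrow>\<^sub>0 nat) \<Rightarrow>\<^sub>0 'k::comm_ring_1) set" where
  "toric_kernel a = {p. toric_map a p = 0}"

lemma ring_ideal_toric_kernel: "ring_ideal (toric_kernel a)"
  unfolding ring_ideal_def toric_kernel_def
  by (auto simp: toric_map_mult addhom_add[OF addhom_toric_map] addhom_zero[OF addhom_toric_map])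

definition degree_part :: "nat \<Rightarrow> (('n::finite \<Rightarrow>\<^sub>0 nat) \<Rightarrow>\<^sub>0 'k::comm_ring_1) \<Rightarrow> (('n \<Rightarrow>\<^sub>0 nat) \<Rightarrow>\<^sub>0 'k)" where
  "degree_part d = ext (\<lambda>u c. if total_degree u = d then mon u c else 0)"

lemma addhom_if: "(P \<Longrightarrow> addhom f) \<Longrightarrow> addhom (\<lambda>c. if P then f c else 0)"
  by (cases P) (auto simp: addhom_def)

lemma addhom_degree_part: "addhom (degree_part d)"
  unfolding degree_part_def by (intro addhom_ext addhom_if addhom_mon)

lemma degree_part_single: "degree_part d (mon u c) = (if total_degree u = d then mon u c else 0)"
  unfolding degree_part_def by (rule ext_single) simp

lemma coef_degree_part: "coef (degree_part d p) u = (if total_degree u = d then coef p u else 0)"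
proof -
  have "(\<lambda>p. coef (degree_part d p) u) = (\<lambda>p. if total_degree u = d then coef p u else 0)"
    by (rule addhom_eqI)
       (auto intro!: addhom_comp[OF addhom_coef addhom_degree_part] addhom_if addhom_coef
         simp: degree_part_single lookup_single when_def)
  from fun_cong[OF this] show ?thesis .
qed

lemma degree_part_part: "degree_part d (degree_part e p) = (if d = e then degree_part d p else 0)"
  by (rule poly_mapping_eqI) (auto simp: coef_degree_part)

lemma degree_part_cst: "degree_part d (cst c * p) = cst c * degree_part d p"
  by (rule poly_mapping_eqI) (auto simp: coef_degree_part cst_coef)

definition degree_less :: "nat \<Rightarrow> (('n::finite \<Rightarrow>\<^sub>0 nat) \<Rightarrow>\<^sub>0 'k::comm_ring_1) \<Rightarrow> bool" where
  "degree_less d p \<longleftrightarrow> (\<forall>e\<ge>d. degree_part e p = 0)"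

lemma degree_less_iff: "degree_less d p \<longleftrightarrow> (\<forall>u\<in>supp p. total_degree u < d)"
  unfolding degree_less_def
proof (intro iffI ballI allI impI)
  fix u assume *: "\<forall>e\<ge>d. degree_part e p = 0" "u \<in> supp p"
  show "total_degree u < d"
    using *(1)[rule_format, of "total_degree u"] *(2) coef_degree_part[of "total_degree u" p u]
    by (cases "total_degree u < d") (auto simp: in_keys_iff)
next
  fix e assume "\<forall>u\<in>supp p. total_degree u < d" "d \<le> e"
  then show "degree_part e p = 0"
    by (intro poly_mapping_eqI) (force simp: coef_degree_part in_keys_iff)
qed

lemma degree_less_exists: "\<exists>d. degree_less d p"
proof (intro exI[of _ "Suc (Max (total_degree ` supp p))"])
  show "degree_less (Suc (Max (total_degree ` supp p))) p"
    unfolding degree_less_iff by (auto intro!: le_imp_less_Suc Max_ge)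
qed

lemma degree_less_diff: "degree_less d p \<Longrightarrow> degree_less d q \<Longrightarrow> degree_less d (p - q)"
  by (simp add: degree_less_def addhom_diff[OF addhom_degree_part])

lemma degree_less_sum: "(\<And>i. i \<in> I \<Longrightarrow> degree_less d (f i)) \<Longrightarrow> degree_less d (sum f I)"
  by (simp add: degree_less_def addhom_sum[OF addhom_degree_part])

lemma degree_less_mono: "degree_less d p \<Longrightarrow> d \<le> e \<Longrightarrow> degree_less e p"
  by (auto simp: degree_less_def)

lemma degree_less_drop_top:
  assumes "degree_less (Suc d) p"
  shows "degree_less d (p - degree_part d p)"
  unfolding degree_less_def
proof (intro allI impI)
  fix e assume "d \<le> e"
  then show "degree_part e (p - degree_part d p) = 0"
    using assms by (cases "e = d") (simp_all add: degree_less_def addhom_diff[OF addhom_degree_part] degree_part_part)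
qed

text \<open>
  The leading form of \<open>Z\<^sub>i\<close>. The map \<open>euler_weight\<close> is the derivation with eigenvalue \<open>\<Sum>\<^sub>j u\<^sub>j a\<^sub>i\<^sub>j\<close> on
  \<open>\<xi>\<^sup>u\<close>, which is the commutator term in \<open>\<partial>\<^sup>u Z\<^sub>i = (Z\<^sub>i + \<Sum>\<^sub>j u\<^sub>j a\<^sub>i\<^sub>j) \<partial>\<^sup>u\<close>. Hence \<open>euler_mult a v c i\<close> is right
  multiplication by \<open>Z\<^sub>i - c\<^sub>i\<close> for constants \<open>c\<^sub>i\<close>, expressed on symbols, and \<open>euler_ideal\<close> is the symbol counterpart of the
  hypergeometric left ideal. Neither of them differentiates coefficients, so they make sense for any \<open>v\<close>.
\<close>

definition euler_form :: "('n::finite \<Rightarrow> int ^ 'r) \<Rightarrow> ('n \<Rightarrow> 'k) \<Rightarrow> 'r \<Rightarrow> (('n \<Rightarrow>\<^sub>0 nat) \<Rightarrow>\<^sub>0 'k::comm_ring_1)" where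
  "euler_form a v i = (\<Sum>j\<in>UNIV. mon (mon j 1) (of_int (a j $ i) * v j))"

definition euler_weight :: "('n::finite \<Rightarrow> int ^ 'r) \<Rightarrow> 'r \<Rightarrow> (('n \<Rightarrow>\<^sub>0 nat) \<Rightarrow>\<^sub>0 'k::comm_ring_1) \<Rightarrow> (('n \<Rightarrow>\<^sub>0 nat) \<Rightarrow>\<^sub>0 'k)" where
  "euler_weight a i = ext (\<lambda>u c. mon u (of_int (point_sum a u $ i) * c))"

definition euler_mult :: "('n::finite \<Rightarrow> int ^ 'r) \<Rightarrow> ('n \<Rightarrow> 'k) \<Rightarrow> ('r \<Rightarrow> 'k) \<Rightarrow> 'r \<Rightarrow> (('n \<Rightarrow>\<^sub>0 nat) \<Rightarrow>\<^sub>0 'k::comm_ring_1) \<Rightarrow> (('n \<Rightarrow>\<^sub>0 nat) \<Rightarrow>\<^sub>0 'k)" where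
  "euler_mult a v c i p = euler_form a v i * p + euler_weight a i p - cst (c i) * p"

definition euler_ideal :: "('n::finite \<Rightarrow> int ^ 'r) \<Rightarrow> ('n \<Rightarrow> 'k) \<Rightarrow> ('r \<Rightarrow> 'k) \<Rightarrow> (('n \<Rightarrow>\<^sub>0 nat) \<Rightarrow>\<^sub>0 'k::comm_ring_1) set" where
  "euler_ideal a v c = {t + (\<Sum>i\<in>UNIV. euler_mult a v c i (q i)) | t q. t \<in> toric_kernel a}"

lemma addhom_euler_weight: "addhom (euler_weight a i)"
  unfolding euler_weight_def by (intro addhom_ext addhom_comp[OF addhom_mon] addhom_times addhom_id)

lemma euler_weight_single: "euler_weight a i (mon u c) = mon u (of_int (point_sum a u $ i) * c)"
  unfolding euler_weight_def by (rule ext_single) simp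

lemma addhom_euler_mult: "addhom (euler_mult a v c i)"
  unfolding euler_mult_def[abs_def] by (intro addhom_intros addhom_euler_weight)

lemma euler_form_single:
  "euler_form a v i * mon u c = (\<Sum>j\<in>UNIV. mon (mon j 1 + u) (of_int (a j $ i) * v j * c))"
  by (simp add: euler_form_def sum_distrib_right mult_single)

lemma point_sum_step: "point_sum a (mon j 1 + u) $ i = a j $ i + point_sum a u $ i"
  by (simp add: point_sum_add point_sum_single)

lemma euler_weight_form:
  "euler_weight a i (euler_form a v k * p) =
     euler_form a v k * euler_weight a i p +
     (\<Sum>j\<in>UNIV. mon (mon j 1) (of_int (a j $ i) * of_int (a j $ k) * v j)) * p"
proof -
  have "(\<lambda>p. euler_weight a i (euler_form a v k * p)) = (\<lambda>p. euler_form a v k * euler_weight a i p +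
     (\<Sum>j\<in>UNIV. mon (mon j 1) (of_int (a j $ i) * of_int (a j $ k) * v j)) * p)"
  proof (rule addhom_eqI)
    fix u c
    show "euler_weight a i (euler_form a v k * mon u c) = euler_form a v k * euler_weight a i (mon u c) +
     (\<Sum>j\<in>UNIV. mon (mon j 1) (of_int (a j $ i) * of_int (a j $ k) * v j)) * mon u c"
      unfolding euler_weight_single euler_form_single
      by (simp add: addhom_sum[OF addhom_euler_weight] euler_weight_single point_sum_step,
        simp add: sum_distrib_right sum_distrib_left mult_single distrib_left distrib_right mult_ac add_ac single_add sum.distrib)
  qed (intro addhom_intros addhom_euler_weight addhom_comp[OF addhom_euler_weight])+
  from fun_cong[OF this] show ?thesis .
qed

lemma euler_weight_cst: "euler_weight a i (cst c * p) = cst c * euler_weight a i p"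
proof -
  have "(\<lambda>p. euler_weight a i (cst c * p)) = (\<lambda>p. cst c * euler_weight a i p)"
    by (rule addhom_eqI)
      (auto intro!: addhom_comp[OF addhom_euler_weight addhom_times[OF addhom_id]] addhom_times[OF addhom_euler_weight]
         simp: cst_mon euler_weight_single mult.left_commute)
  from fun_cong[OF this] show ?thesis .
qed

lemma euler_weight_commute: "euler_weight a i (euler_weight a k p) = euler_weight a k (euler_weight a i p)"
proof -
  have "(\<lambda>p. euler_weight a i (euler_weight a k p)) = (\<lambda>p. euler_weight a k (euler_weight a i p))"
    by (rule addhom_eqI)
       (auto intro!: addhom_comp[OF addhom_euler_weight] addhom_euler_weight simp: euler_weight_single mult.left_commute)
  from fun_cong[OF this] show ?thesis .
qed

text \<open>
  The operators \<open>Z\<^sub>i - c\<^sub>i\<close> commute. The second order terms agree by symmetry in \<open>i\<close> and \<open>k\<close>.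
\<close>

lemma euler_mult_commute:
  "euler_mult a v c i (euler_mult a v c k p) = euler_mult a v c k (euler_mult a v c i p)"
  unfolding euler_mult_def addhom_add[OF addhom_euler_weight] addhom_diff[OF addhom_euler_weight]
      euler_weight_form euler_weight_cst euler_weight_commute[of a i k]
  by (simp add: algebra_simps)

lemma euler_weight_xi:
  fixes p :: "('n::finite \<Rightarrow>\<^sub>0 nat) \<Rightarrow>\<^sub>0 'k::comm_ring_1"
  shows "euler_weight a i (xi j * p) = xi j * (euler_weight a i p + of_int (a j $ i) * p)"
proof -
  have "(\<lambda>p :: ('n \<Rightarrow>\<^sub>0 nat) \<Rightarrow>\<^sub>0 'k. euler_weight a i (xi j * p)) = (\<lambda>p. xi j * (euler_weight a i p + of_int (a j $ i) * p))"
  proof (rule addhom_eqI)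
    fix u and c :: 'k
    show "euler_weight a i (xi j * mon u c) = xi j * (euler_weight a i (mon u c) + of_int (a j $ i) * mon u c)"
      unfolding xi_mon euler_weight_single of_int_mon point_sum_step
      by (simp add: distrib_left distrib_right xi_mon single_add)
  qed (intro addhom_intros addhom_euler_weight addhom_comp[OF addhom_euler_weight])+
  from fun_cong[OF this] show ?thesis .
qed

text \<open>
  The contiguity relation: passing \<open>\<xi>\<^sub>j\<close> changes the parameter by \<open>a\<^sub>j\<close>.
\<close>

lemma euler_mult_xi:
  "euler_mult a v c i (xi j * p) = xi j * euler_mult a v (\<lambda>i. c i - of_int (a j $ i)) i p"
  unfolding euler_mult_def euler_weight_xi single_diff single_of_int by (simp add: algebra_simps)

lemma toric_map_euler_weight:
  "toric_map a (euler_weight a i p) = ext (\<lambda>z c. mon z (of_int (z $ i) * c)) (toric_map a p)"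
proof -
  have ah: "addhom (ext (\<lambda>z c. mon z (of_int (z $ i) * c)))"
    by (intro addhom_ext addhom_comp[OF addhom_mon] addhom_times addhom_id)
  have "(\<lambda>p. toric_map a (euler_weight a i p)) = (\<lambda>p. ext (\<lambda>z c. mon z (of_int (z $ i) * c)) (toric_map a p))"
    by (rule addhom_eqI)
       (auto intro!: addhom_comp[OF addhom_toric_map addhom_euler_weight] addhom_comp[OF ah addhom_toric_map]
          simp: euler_weight_single toric_map_single ext_single)
  from fun_cong[OF this] show ?thesis .
qed

lemma euler_mult_toric_kernel: "t \<in> toric_kernel a \<Longrightarrow> euler_mult a v c i t \<in> toric_kernel a"
  by (simp add: toric_kernel_def euler_mult_def addhom_add[OF addhom_toric_map] addhom_diff[OF addhom_toric_map]
      toric_map_mult toric_map_euler_weight ext_def)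

lemma degree_part_euler_weight: "degree_part d (euler_weight a i p) = euler_weight a i (degree_part d p)"
proof -
  have "(\<lambda>p. degree_part d (euler_weight a i p)) = (\<lambda>p. euler_weight a i (degree_part d p))"
    by (rule addhom_eqI)
       (auto intro!: addhom_comp[OF addhom_degree_part addhom_euler_weight] addhom_comp[OF addhom_euler_weight addhom_degree_part]
          simp: euler_weight_single degree_part_single addhom_zero[OF addhom_euler_weight])
  from fun_cong[OF this] show ?thesis .
qed

lemma degree_part_linear:
  fixes l :: "'n::finite \<Rightarrow> 'k::comm_ring_1"
  shows "degree_part d ((\<Sum>j\<in>J. mon (mon j 1) (l j)) * p) =
     (if d = 0 then 0 else (\<Sum>j\<in>J. mon (mon j 1) (l j)) * degree_part (d - 1) p)"
proof -
  let ?L = "\<Sum>j\<in>J. mon (mon j (1::nat)) (l j)"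
  have "(\<lambda>p. degree_part d (?L * p)) = (\<lambda>p. if d = 0 then 0 else ?L * degree_part (d - 1) p)"
  proof (rule addhom_eqI)
    show "addhom (\<lambda>p. degree_part d (?L * p))"
      by (intro addhom_comp[OF addhom_degree_part] addhom_times addhom_id)
    show "addhom (\<lambda>p. if d = 0 then 0 else ?L * degree_part (d - 1) p)"
      using addhom_times[OF addhom_degree_part] by (auto simp: addhom_def)
    show "degree_part d (?L * mon u c) = (if d = 0 then 0 else ?L * degree_part (d - 1) (mon u c))" for u c
    proof -
      have "1 + total_degree u = d \<longleftrightarrow> d \<noteq> 0 \<and> total_degree u = d - 1" by arith
      then show ?thesis
        by (auto simp: sum_distrib_right mult_single addhom_sum[OF addhom_degree_part]
          degree_part_single total_degree_add total_degree_single)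
    qed
  qed
  from fun_cong[OF this] show ?thesis .
qed

lemma degree_part_euler_mult:
  "degree_part d (euler_mult a v c i p) =
     (if d = 0 then 0 else euler_form a v i * degree_part (d - 1) p) +
     euler_weight a i (degree_part d p) - cst (c i) * degree_part d p"
  by (simp add: euler_mult_def addhom_add[OF addhom_degree_part] addhom_diff[OF addhom_degree_part]
    degree_part_euler_weight degree_part_cst euler_form_def degree_part_linear)


section \<open>Leading forms of hypergeometric ideals\<close>

lemma height_of_point_sum:
  assumes "linear (h :: real ^ 'r \<Rightarrow> real)" "\<And>j. h (real_point (a j)) = 1"
  shows "h (real_point (point_sum a u)) = real (total_degree u)"
proof -
  have "real_point (point_sum a u) = (\<Sum>j\<in>UNIV. real (coef u j) *\<^sub>R real_point (a j))"
    by (simp add: real_point_def point_sum_def vec_eq_iff)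
  then show ?thesis
    by (simp add: linear_sum[OF assms(1)] linear_scale[OF assms(1)] assms(2) total_degree_def)
qed

locale homogeneous_points =
  fixes a :: "'n::{finite,linorder} \<Rightarrow> int ^ 'r"
  assumes on_hyperplane: "\<exists>h :: real ^ 'r \<Rightarrow> real. linear h \<and> (\<forall>j. h (real_point (a j)) = 1)"
begin

text \<open>
  The toric kernel is homogeneous because the points lie on the hyperplane \<open>h = 1\<close>: the degree of a
  monomial can be read off from its image under the toric map.
\<close>

lemma toric_kernel_degree_part:
  assumes "p \<in> toric_kernel a"
  shows "degree_part d p \<in> toric_kernel a"
proof -
  obtain h :: "real ^ 'r \<Rightarrow> real" where h: "linear h" "\<And>j. h (real_point (a j)) = 1"
    using on_hyperplane by auto
  let ?F = "\<lambda>z c. if h (real_point z) = real d then mon z c else 0"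
  have ah: "addhom (ext ?F)" by (intro addhom_ext addhom_if addhom_mon)
  have "(\<lambda>p. toric_map a (degree_part d p)) = (\<lambda>p. ext ?F (toric_map a p))"
    by (rule addhom_eqI)
       (auto intro!: addhom_comp[OF addhom_toric_map addhom_degree_part] addhom_comp[OF ah addhom_toric_map]
         simp: degree_part_single toric_map_single ext_single height_of_point_sum[OF h] addhom_zero[OF addhom_toric_map])
  from fun_cong[OF this, of p] show ?thesis using assms by (simp add: toric_kernel_def ext_def)
qed

end

definition toric_euler_ideal :: "('n::finite \<Rightarrow> int ^ 'r) \<Rightarrow> ('n \<Rightarrow> 'k) \<Rightarrow> (('n \<Rightarrow>\<^sub>0 nat) \<Rightarrow>\<^sub>0 'k::comm_ring_1) set" where
  "toric_euler_ideal a v = {t + (\<Sum>i\<in>UNIV. q i * euler_form a v i) | t q. t \<in> toric_kernel a}"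

definition spanned_by :: "('n \<Rightarrow>\<^sub>0 nat) set \<Rightarrow> (('n \<Rightarrow>\<^sub>0 nat) \<Rightarrow>\<^sub>0 'k::zero) set" where
  "spanned_by B = {p. supp p \<subseteq> B}"

lemma spanned_by_iff: "p \<in> spanned_by B \<longleftrightarrow> (\<forall>u. u \<notin> B \<longrightarrow> coef p u = 0)"
  by (auto simp: spanned_by_def in_keys_iff)

lemma spanned_by_closed:
  fixes p :: "('n \<Rightarrow>\<^sub>0 nat) \<Rightarrow>\<^sub>0 'k::comm_ring_1"
  assumes "p \<in> spanned_by B" "q \<in> spanned_by B"
  shows "p + q \<in> spanned_by B" "cst b * p \<in> spanned_by B" "p - q \<in> spanned_by B" "- p \<in> spanned_by B"
  using assms by (auto simp: spanned_by_iff lookup_add lookup_minus cst_coef)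

lemma toric_euler_idealI:
  "t \<in> toric_kernel a \<Longrightarrow> p = t + (\<Sum>i\<in>UNIV. q i * euler_form a v i) \<Longrightarrow> p \<in> toric_euler_ideal a v"
  by (auto simp: toric_euler_ideal_def)

lemma ring_ideal_toric_euler_ideal: "ring_ideal (toric_euler_ideal a v)"
  unfolding ring_ideal_def
proof (intro conjI ballI allI)
  note T = ring_idealD[OF ring_ideal_toric_kernel]
  show "0 \<in> toric_euler_ideal a v"
    by (rule toric_euler_idealI[OF T(1), of _ "\<lambda>_. 0"]) simp
  fix x assume "x \<in> toric_euler_ideal a v"
  then obtain t q where x: "x = t + (\<Sum>i\<in>UNIV. q i * euler_form a v i)" "t \<in> toric_kernel a"
    by (auto simp: toric_euler_ideal_def)
  have "b * x = b * t + (\<Sum>i\<in>UNIV. (b * q i) * euler_form a v i)" for b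
    by (simp add: x distrib_left sum_distrib_left mult_ac)
  then show "b * x \<in> toric_euler_ideal a v" for b
    by (rule toric_euler_idealI[OF T(3)[OF x(2)]])
  fix y assume "y \<in> toric_euler_ideal a v"
  then obtain t' q' where y: "y = t' + (\<Sum>i\<in>UNIV. q' i * euler_form a v i)" "t' \<in> toric_kernel a"
    by (auto simp: toric_euler_ideal_def)
  have "x + y = (t + t') + (\<Sum>i\<in>UNIV. (q i + q' i) * euler_form a v i)"
    by (simp add: x y distrib_right sum.distrib)
  then show "x + y \<in> toric_euler_ideal a v"
    by (rule toric_euler_idealI[OF T(2)[OF x(2) y(2)]])
qed

lemma euler_idealI:
  "t \<in> toric_kernel a \<Longrightarrow> p = t + (\<Sum>i\<in>UNIV. euler_mult a v c i (q i)) \<Longrightarrow> p \<in> euler_ideal a v c"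
  by (auto simp: euler_ideal_def)

text \<open>
  The hypothesis says that the syzygies of the Euler forms modulo the toric kernel are generated by the
  trivial ones.
\<close>

locale regular_euler_forms = homogeneous_points a
  for a :: "'n::{finite,linorder} \<Rightarrow> int ^ 'r" +
  fixes v :: "'n \<Rightarrow> 'k::{field,ring_char_0}"
  assumes syzygies: "\<And>p. (\<Sum>i\<in>UNIV. p i * euler_form a v i) \<in> toric_kernel a \<Longrightarrow>
      \<exists>c. (\<forall>i k. c i k = - c k i) \<and> (\<forall>i. p i - (\<Sum>k\<in>UNIV. c i k * euler_form a v k) \<in> toric_kernel a)"
begin

text \<open>
  Trivial syzygies lift to relations between the operators, since these commute.
\<close>

lemma euler_mult_antisymmetric:
  assumes anti: "\<And>i k. q i k = - q k i"
  shows "(\<Sum>i\<in>UNIV. euler_mult a v c i (\<Sum>k\<in>UNIV. euler_mult a v c k (q i k))) = 0"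
proof -
  let ?S = "\<Sum>i\<in>UNIV. \<Sum>k\<in>UNIV. euler_mult a v c i (euler_mult a v c k (q i k))"
  have "?S = (\<Sum>k\<in>UNIV. \<Sum>i\<in>UNIV. euler_mult a v c i (euler_mult a v c k (q i k)))"
    by (rule sum.swap)
  also have "\<dots> = - ?S"
    unfolding sum_negf[symmetric]
  proof (intro sum.cong refl)
    fix k i
    show "euler_mult a v c i (euler_mult a v c k (q i k)) = - euler_mult a v c k (euler_mult a v c i (q k i))"
      by (subst anti)
        (simp add: euler_mult_commute[of a v c i k] addhom_minus[OF addhom_euler_mult])
  qed
  finally have "?S = 0" by simp
  then show ?thesis by (simp add: addhom_sum[OF addhom_euler_mult])
qed

text \<open>
  Elements of degree at most \<open>d\<close> in the ideal need multipliers of degree less than \<open>d\<close> only. If the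
  multipliers have larger degree, their leading forms are a syzygy of the Euler forms modulo the toric
  kernel. This syzygy is trivial, so it lifts to a relation between the operators; subtracting the
  relation lowers the degree of the multipliers.
\<close>

lemma euler_ideal_representation:
  assumes "p \<in> euler_ideal a v c" "degree_less (Suc d) p"
  shows "\<exists>t q. t \<in> toric_kernel a \<and> p = t + (\<Sum>i\<in>UNIV. euler_mult a v c i (q i)) \<and> (\<forall>i. degree_less d (q i))"
proof -
  obtain t q where tq: "t \<in> toric_kernel a" "p = t + (\<Sum>i\<in>UNIV. euler_mult a v c i (q i))"
    using assms by (auto simp: euler_ideal_def)
  have "\<exists>D. \<forall>i. degree_less D (q i)"
  proof -
    have "\<forall>i. \<exists>D. degree_less D (q i)" using degree_less_exists by blast
    then obtain D where "\<And>i. degree_less (D i) (q i)" by metis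
    then have "degree_less (Max (range D)) (q i)" for i by (rule degree_less_mono) simp
    then show ?thesis by blast
  qed
  then obtain D where "\<And>i. degree_less (d + D) (q i)" 
    by (metis degree_less_mono le_add2)
  with tq show ?thesis
  proof (induction D arbitrary: t q)
    case 0
    then show ?case by auto
  next
    case (Suc D)
    define E where "E = d + D"
    note T = ring_idealD[OF ring_ideal_toric_kernel[of a, where 'b='k]]
    have qE: "degree_less (Suc E) (q i)" for i using Suc.prems(3) by (simp add: E_def)
    have top: "degree_part (Suc E) (q i) = 0" for i using qE by (simp add: degree_less_def)
    have "degree_part (Suc E) p = 0" using assms(2) by (simp add: degree_less_def E_def)
    then have "degree_part (Suc E) t + (\<Sum>i\<in>UNIV. euler_form a v i * degree_part E (q i)) = 0"
      unfolding Suc.prems(2) addhom_add[OF addhom_degree_part] addhom_sum[OF addhom_degree_part] degree_part_euler_mult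
      by (simp add: top addhom_zero[OF addhom_euler_weight])
    then have "(\<Sum>i\<in>UNIV. degree_part E (q i) * euler_form a v i) = - degree_part (Suc E) t"
      by (simp add: mult.commute eq_neg_iff_add_eq_0 add.commute)
    then have "(\<Sum>i\<in>UNIV. degree_part E (q i) * euler_form a v i) \<in> toric_kernel a"
      using T(5)[OF toric_kernel_degree_part[OF Suc.prems(1)]] by metis
    from syzygies[OF this] obtain b where b: "\<And>i k. b i k = - b k i"
      "\<And>i. degree_part E (q i) - (\<Sum>k\<in>UNIV. b i k * euler_form a v k) \<in> toric_kernel a"
      by blast
    (* Only the homogeneous component of b that contributes in degree E is kept; antisymmetry survives. *)
    define b' where "b' i k = (if E = 0 then 0 else degree_part (E - 1) (b i k))" for i k
    have anti: "b' i k = - b' k i" for i k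
      unfolding b'_def using arg_cong[OF b(1)[of i k], of "degree_part (E - 1)"]
      by (simp add: addhom_minus[OF addhom_degree_part])
    define s where "s i = degree_part E (q i) - (\<Sum>k\<in>UNIV. euler_form a v k * b' i k)" for i
    have s: "s i \<in> toric_kernel a" for i
    proof -
      have "degree_part E (b i k * euler_form a v k) = euler_form a v k * b' i k" for k
        unfolding mult.commute[of "b i k"] unfolding euler_form_def degree_part_linear b'_def by simp
      then have "s i = degree_part E (degree_part E (q i) - (\<Sum>k\<in>UNIV. b i k * euler_form a v k))"
        by (simp add: s_def addhom_diff[OF addhom_degree_part] addhom_sum[OF addhom_degree_part] degree_part_part)
      then show ?thesis using toric_kernel_degree_part[OF b(2)] by simp
    qed
    define r where "r i = q i - s i - (\<Sum>k\<in>UNIV. euler_mult a v c k (b' i k))" for i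
    have "p = (t + (\<Sum>i\<in>UNIV. euler_mult a v c i (s i))) + (\<Sum>i\<in>UNIV. euler_mult a v c i (r i))"
      unfolding Suc.prems(2) r_def addhom_diff[OF addhom_euler_mult] sum_subtractf
        euler_mult_antisymmetric[of b', OF anti] by simp
    moreover have "t + (\<Sum>i\<in>UNIV. euler_mult a v c i (s i)) \<in> toric_kernel a"
      by (intro T(2) Suc.prems(1) ring_ideal_sum[OF ring_ideal_toric_kernel] euler_mult_toric_kernel s)
    moreover have "degree_less (d + D) (r i)" for i
    proof -
      have "r i = (q i - degree_part E (q i)) - (\<Sum>k\<in>UNIV. euler_weight a k (b' i k) - cst (c k) * b' i k)"
        unfolding r_def s_def euler_mult_def by (simp add: sum.distrib sum_subtractf)
      moreover have "degree_less E (\<Sum>k\<in>UNIV. euler_weight a k (b' i k) - cst (c k) * b' i k)"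
        by (rule degree_less_sum) (auto simp: degree_less_def b'_def addhom_diff[OF addhom_degree_part] degree_part_euler_weight
             degree_part_cst degree_part_part addhom_zero[OF addhom_euler_weight] addhom_zero[OF addhom_degree_part])
      ultimately show ?thesis
        using degree_less_diff[OF degree_less_drop_top[OF qE[of i]]] by (simp only: E_def)
    qed
    ultimately show ?case by (intro Suc.IH)
  qed
qed

text \<open>
  Leading forms of the hypergeometric ideal do not depend on the parameter.
\<close>

lemma euler_ideal_top_part:
  assumes "p \<in> euler_ideal a v c" "degree_less (Suc d) p"
  shows "degree_part d p \<in> toric_euler_ideal a v"
proof -
  obtain t q where tq: "t \<in> toric_kernel a" "p = t + (\<Sum>i\<in>UNIV. euler_mult a v c i (q i))"
    "\<And>i. degree_less d (q i)"
    using euler_ideal_representation[OF assms] by auto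
  have "degree_part d (q i) = 0" for i using tq(3) by (simp add: degree_less_def)
  then have "degree_part d p = degree_part d t +
      (\<Sum>i\<in>UNIV. (if d = 0 then 0 else degree_part (d - 1) (q i)) * euler_form a v i)"
    unfolding tq(2) addhom_add[OF addhom_degree_part] addhom_sum[OF addhom_degree_part] degree_part_euler_mult
    by (auto simp: addhom_zero[OF addhom_euler_weight] mult.commute intro!: sum.cong)
  then show ?thesis
    by (rule toric_euler_idealI[OF toric_kernel_degree_part[OF tq(1), of d]])
qed


text \<open>
  By the degree bound, \<open>\<xi>\<^sub>j\<close> differs by an element of the toric kernel from a combination of the Euler
  operators with constant multipliers. In degree one the toric kernel is zero, as the points are
  distinct.
\<close>

lemma xi_in_euler_ideal:
  assumes "inj a" "xi j \<in> euler_ideal a v c"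
  shows "\<exists>b. \<forall>k. (\<Sum>i\<in>UNIV. b i * of_int (a k $ i)) * v k = (if k = j then 1 else 0)"
proof -
  have "degree_less (Suc 1) (xi j :: ('n \<Rightarrow>\<^sub>0 nat) \<Rightarrow>\<^sub>0 'k)"
    by (auto simp: degree_less_iff xi_def total_degree_single)
  from euler_ideal_representation[OF assms(2) this]
  obtain t q where tq: "t \<in> toric_kernel a" "xi j = t + (\<Sum>i\<in>UNIV. euler_mult a v c i (q i))"
    "\<And>i. degree_less 1 (q i)" by auto
  define b where "b i = coef (q i) 0" for i
  have q: "q i = cst (b i)" for i
    using tq(3)[of i] by (intro poly_mapping_eqI)
      (auto simp: degree_less_iff total_degree_0 b_def lookup_single when_def in_keys_iff)
  define l where "l k = (if k = j then 1 else 0) - (\<Sum>i\<in>UNIV. b i * of_int (a k $ i)) * v k" for k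
  have "degree_part 1 t = degree_part 1 (xi j - (\<Sum>i\<in>UNIV. euler_mult a v c i (q i)))"
    using tq(2) by simp
  also have "\<dots> = xi j - (\<Sum>i\<in>UNIV. euler_form a v i * cst (b i))"
    unfolding addhom_diff[OF addhom_degree_part] addhom_sum[OF addhom_degree_part] degree_part_euler_mult q
    by (simp add: xi_def degree_part_single total_degree_single addhom_zero[OF addhom_euler_weight])
  also have "\<dots> = (\<Sum>k\<in>UNIV. mon (mon k 1) (l k))"
  proof (rule poly_mapping_eqI)
    fix u :: "'n \<Rightarrow>\<^sub>0 nat"
    have "xi j = (\<Sum>k\<in>UNIV. mon (mon k 1) (if k = j then 1 else 0 :: 'k))"
      by (subst sum.remove[of _ j]) (auto simp: xi_def)
    moreover have "(\<Sum>i\<in>UNIV. euler_form a v i * cst (b i)) =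
        (\<Sum>k\<in>UNIV. mon (mon k 1) ((\<Sum>i\<in>UNIV. b i * of_int (a k $ i)) * v k))"
      unfolding euler_form_def sum_distrib_right
      by (subst sum.swap) (simp add: mult_single mult_ac addhom_sum[OF addhom_mon])
    ultimately show "coef (xi j - (\<Sum>i\<in>UNIV. euler_form a v i * cst (b i))) u = coef (\<Sum>k\<in>UNIV. mon (mon k 1) (l k)) u"
      by (simp add: l_def single_diff sum_subtractf)
  qed
  finally have "toric_map a (\<Sum>k\<in>UNIV. mon (mon k 1) (l k)) = 0"
    using toric_kernel_degree_part[OF tq(1), of 1] by (simp add: toric_kernel_def)
  then have 0: "(\<Sum>k\<in>UNIV. mon (a k) (l k)) = 0"
    by (simp add: addhom_sum[OF addhom_toric_map] toric_map_single point_sum_single)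
  have "l k = 0" for k
  proof -
    have "coef (\<Sum>k\<in>UNIV. mon (a k) (l k)) (a k) = (\<Sum>i\<in>UNIV. if i = k then l i else 0)"
      using assms(1) by (auto simp: lookup_sum lookup_single when_def inj_eq intro!: sum.cong)
    then show ?thesis using 0 by simp
  qed
  then show ?thesis by (intro exI[of _ b]) (auto simp: l_def)
qed

text \<open>
  A maximal set of monomials that is linearly independent modulo the ideal also spans modulo the ideal.
\<close>

lemma monomial_complement_toric_euler_ideal:
  assumes "\<And>u. total_degree u \<ge> n \<Longrightarrow> mon u 1 \<in> toric_euler_ideal a v"
  shows "\<exists>B. finite B \<and> spanned_by B \<inter> toric_euler_ideal a v \<subseteq> {0} \<and>
     (\<forall>p. \<exists>s\<in>spanned_by B. p - s \<in> toric_euler_ideal a v)"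
proof -
  note J = ring_idealD[OF ring_ideal_toric_euler_ideal[of a v]]
  define Q where "Q B \<longleftrightarrow> B \<subseteq> {u. total_degree u < n} \<and> spanned_by B \<inter> toric_euler_ideal a v \<subseteq> {0}" for B
  have fin: "finite {u :: 'n \<Rightarrow>\<^sub>0 nat. total_degree u < n}"
  proof (rule finite_imageD)
    show "inj_on coef {u :: 'n \<Rightarrow>\<^sub>0 nat. total_degree u < n}"
      by (auto simp: inj_on_def intro: poly_mapping_eqI)
    have "coef u j \<le> total_degree u" for u :: "'n \<Rightarrow>\<^sub>0 nat" and j
      unfolding total_degree_def by (rule member_le_sum) auto
    then have "coef u j < n" if "total_degree u < n" for u :: "'n \<Rightarrow>\<^sub>0 nat" and j
      using that le_less_trans by blast
    then have "coef ` {u :: 'n \<Rightarrow>\<^sub>0 nat. total_degree u < n} \<subseteq> Pi\<^sub>E UNIV (\<lambda>_. {..<n})"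
      by auto
    then show "finite (coef ` {u :: 'n \<Rightarrow>\<^sub>0 nat. total_degree u < n})"
      by (rule finite_subset) (auto intro!: finite_PiE)
  qed
  have "Q {}" by (auto simp: Q_def spanned_by_def)
  obtain B where B: "Q B" and max: "\<And>B'. Q B' \<Longrightarrow> B \<subseteq> B' \<Longrightarrow> B' = B"
  proof -
    have "finite {B. Q B}" by (rule finite_subset[of _ "Pow {u. total_degree u < n}"]) (use fin in \<open>auto simp: Q_def\<close>)
    then show ?thesis using finite_has_maximal[of "{B. Q B}"] \<open>Q {}\<close> that by (metis empty_iff mem_Collect_eq)
  qed
  have finB: "finite B" using B fin by (auto simp: Q_def intro: finite_subset)
  note sp = spanned_by_closed[of _ B]
  have mono: "\<exists>s\<in>spanned_by B. mon u 1 - s \<in> toric_euler_ideal a v" for u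
  proof (cases "u \<in> B")
    case True
    then show ?thesis using J(1) by (intro bexI[of _ "mon u 1"]) (auto simp: spanned_by_iff lookup_single when_def)
  next
    case uB: False
    show ?thesis
    proof (cases "total_degree u < n")
      case False
      then show ?thesis using assms[of u] by (intro bexI[of _ 0]) (auto simp: spanned_by_iff)
    next
      case True
      then have "\<not> Q (insert u B)" using max[of "insert u B"] uB by blast
      then obtain s where s: "s \<in> spanned_by (insert u B)" "s \<in> toric_euler_ideal a v" "s \<noteq> 0"
        using B True by (auto simp: Q_def)
      define s' where "s' = s - mon u (coef s u)"
      have s': "s' \<in> spanned_by B" using s(1) by (auto simp: s'_def spanned_by_iff lookup_minus lookup_single when_def)
      have nz: "coef s u \<noteq> 0"
      proof
        assume "coef s u = 0"
        then have "s \<in> spanned_by B" using s' by (simp add: s'_def)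
        then show False using s B by (auto simp: Q_def)
      qed
      have "mon u 1 - cst (- inverse (coef s u)) * s' = cst (inverse (coef s u)) * s"
        using nz by (simp add: s'_def right_diff_distrib cst_mon single_uminus)
      then show ?thesis
        using J(3)[OF s(2)] sp(2)[OF s' s'] by metis
    qed
  qed
  have "\<exists>s\<in>spanned_by B. p - s \<in> toric_euler_ideal a v" for p
  proof (induction p rule: pm_induct)
    case (single u c)
    obtain s where s: "s \<in> spanned_by B" "mon u 1 - s \<in> toric_euler_ideal a v" using mono by blast
    have "cst c * (mon u 1 - s) = mon u c - cst c * s" by (simp add: right_diff_distrib cst_mon)
    then show ?case using J(3)[OF s(2), of "cst c"] sp(2)[OF s(1) s(1)] by metis
  next
    case (add p q)
    then obtain s t where st: "s \<in> spanned_by B" "p - s \<in> toric_euler_ideal a v" "t \<in> spanned_by B" "q - t \<in> toric_euler_ideal a v"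
      by blast
    have "p + q - (s + t) = (p - s) + (q - t)" by simp
    then show ?case using J(2)[OF st(2,4)] sp(1)[OF st(1,3)] by metis
  qed
  then show ?thesis using finB B by (auto simp: Q_def)
qed

lemma euler_ideal_add: "p \<in> euler_ideal a v c \<Longrightarrow> q \<in> euler_ideal a v c \<Longrightarrow> p + q \<in> euler_ideal a v c"
proof -
  assume "p \<in> euler_ideal a v c" "q \<in> euler_ideal a v c"
  then obtain t r t' r' where *: "p = t + (\<Sum>i\<in>UNIV. euler_mult a v c i (r i))" "t \<in> toric_kernel a"
    "q = t' + (\<Sum>i\<in>UNIV. euler_mult a v c i (r' i))" "t' \<in> toric_kernel a"
    by (auto simp: euler_ideal_def)
  have "p + q = (t + t') + (\<Sum>i\<in>UNIV. euler_mult a v c i (r i + r' i))"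
    by (simp add: * addhom_add[OF addhom_euler_mult] sum.distrib)
  then show ?thesis by (rule euler_idealI[OF ring_idealD(2)[OF ring_ideal_toric_kernel *(2,4)]])
qed

text \<open>
  A monomial complement of the ideal of leading forms is a complement of the filtered ideal, by descent
  on the degree. Monomials matter here: their span contains the homogeneous components of its elements.
\<close>

lemma monomial_complement_euler_ideal:
  assumes B: "spanned_by B \<inter> toric_euler_ideal a v \<subseteq> {0}"
     "\<And>p. \<exists>s\<in>spanned_by B. p - s \<in> toric_euler_ideal a v"
  shows "spanned_by B \<inter> euler_ideal a v c \<subseteq> {0}" "\<exists>s\<in>spanned_by B. p - s \<in> euler_ideal a v c"
proof -
  have part: "degree_part d s \<in> spanned_by B" if "s \<in> spanned_by B" for d s
    using that by (auto simp: spanned_by_iff coef_degree_part)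
  show "spanned_by B \<inter> euler_ideal a v c \<subseteq> {0}"
  proof
    fix s assume s: "s \<in> spanned_by B \<inter> euler_ideal a v c"
    have "degree_less d s \<Longrightarrow> s = 0" for d
    proof (induction d)
      case 0
      then show ?case by (intro poly_mapping_eqI) (auto simp: degree_less_iff in_keys_iff)
    next
      case (Suc d)
      have "degree_part d s \<in> toric_euler_ideal a v"
        using euler_ideal_top_part Suc.prems s by auto
      then have "degree_part d s = 0" using part s B(1) by blast
      then show ?case using degree_less_drop_top[OF Suc.prems] Suc.IH by simp
    qed
    then show "s \<in> {0}" using degree_less_exists[of s] by blast
  qed
  note E = euler_ideal_add
  have "\<exists>s\<in>spanned_by B. p - s \<in> euler_ideal a v c" if "degree_less d p" for d
    using that
  proof (induction d arbitrary: p)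
    case 0
    then have "p = 0" by (intro poly_mapping_eqI) (auto simp: degree_less_iff in_keys_iff)
    moreover have "0 \<in> euler_ideal a v c"
      by (rule euler_idealI[OF ring_idealD(1)[OF ring_ideal_toric_kernel], of _ _ _ _ "\<lambda>_. 0"])
         (simp add: addhom_zero[OF addhom_euler_mult])
    ultimately show ?case by (intro bexI[of _ 0]) (auto simp: spanned_by_def)
  next
    case (Suc d)
    obtain s t q where s: "s \<in> spanned_by B" "t \<in> toric_kernel a"
      "p - s = t + (\<Sum>i\<in>UNIV. q i * euler_form a v i)"
      using B(2)[of p] by (auto simp: toric_euler_ideal_def)
    define q' where "q' i = (if d = 0 then 0 else degree_part (d - 1) (q i))" for i
    define p' where "p' = p - degree_part d s - degree_part d t - (\<Sum>i\<in>UNIV. euler_mult a v c i (q' i))"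
    have "degree_part d (p - s) = degree_part d t + (\<Sum>i\<in>UNIV. euler_form a v i * q' i)"
      unfolding s(3) addhom_add[OF addhom_degree_part] addhom_sum[OF addhom_degree_part] mult.commute[of "q _"]
      unfolding euler_form_def degree_part_linear q'_def by (auto intro!: sum.cong)
    then have dp: "degree_part d p = degree_part d s + degree_part d t + (\<Sum>i\<in>UNIV. euler_form a v i * q' i)"
      by (simp add: addhom_diff[OF addhom_degree_part] algebra_simps)
    have "p' = (p - degree_part d p) - (\<Sum>i\<in>UNIV. euler_weight a i (q' i) - cst (c i) * q' i)"
      unfolding p'_def dp euler_mult_def by (simp add: sum.distrib sum_subtractf)
    moreover have "degree_less d (\<Sum>i\<in>UNIV. euler_weight a i (q' i) - cst (c i) * q' i)"
      by (rule degree_less_sum) (auto simp: degree_less_def q'_def addhom_diff[OF addhom_degree_part] degree_part_euler_weight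
           degree_part_cst degree_part_part addhom_zero[OF addhom_euler_weight] addhom_zero[OF addhom_degree_part])
    ultimately have "degree_less d p'"
      using degree_less_diff[OF degree_less_drop_top[OF Suc.prems]] by (simp only:)
    then obtain s' where s': "s' \<in> spanned_by B" "p' - s' \<in> euler_ideal a v c" using Suc.IH by blast
    have "degree_part d t + (\<Sum>i\<in>UNIV. euler_mult a v c i (q' i)) \<in> euler_ideal a v c"
      by (rule euler_idealI[OF toric_kernel_degree_part[OF s(2)] refl])
    from E[OF s'(2) this] have "p - (s' + degree_part d s) \<in> euler_ideal a v c"
      by (simp add: p'_def algebra_simps)
    moreover have "s' + degree_part d s \<in> spanned_by B"
      using s'(1) part[OF s(1)] by (auto simp: spanned_by_iff lookup_add)
    ultimately show ?case by blast
  qed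
  then show "\<exists>s\<in>spanned_by B. p - s \<in> euler_ideal a v c" using degree_less_exists by blast
qed

end


section \<open>Contiguity\<close>

lemma nonzero_coef: "p \<noteq> 0 \<Longrightarrow> \<exists>u. coef p u \<noteq> 0"
  by (metis lookup_zero poly_mapping_eqI)

lemma spanned_by_sum:
  "(\<And>i. i \<in> I \<Longrightarrow> f i \<in> spanned_by B) \<Longrightarrow> sum f I \<in> spanned_by B"
  for f :: "'i \<Rightarrow> (('n \<Rightarrow>\<^sub>0 nat) \<Rightarrow>\<^sub>0 'k::comm_ring_1)"
  by (induction I rule: infinite_finite_induct) (auto simp: spanned_by_closed, auto simp: spanned_by_def)

text \<open>
  An endomorphism of a finite-dimensional space, where the scalars act as constant polynomials. Both
  directions produce a linear dependence among more vectors than there are coordinates.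
\<close>

lemma injective_iff_surjective_on_span:
  fixes g :: "(('n \<Rightarrow>\<^sub>0 nat) \<Rightarrow>\<^sub>0 'k::field) \<Rightarrow> (('n \<Rightarrow>\<^sub>0 nat) \<Rightarrow>\<^sub>0 'k)"
  assumes fin: "finite B" and add: "addhom g" and lin: "\<And>c p. g (cst c * p) = cst c * g p"
    and maps: "\<And>p. p \<in> spanned_by B \<Longrightarrow> g p \<in> spanned_by B"
  shows "(\<forall>s\<in>spanned_by B. g s = 0 \<longrightarrow> s = 0) \<longleftrightarrow> (\<forall>s\<in>spanned_by B. \<exists>s'\<in>spanned_by B. g s' = s)"
proof (intro iffI ballI impI)
  fix s :: "('n \<Rightarrow>\<^sub>0 nat) \<Rightarrow>\<^sub>0 'k"
  assume inj: "\<forall>s\<in>spanned_by B. g s = 0 \<longrightarrow> s = 0" and s: "s \<in> spanned_by B"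
  define f where "f x = (case x of None \<Rightarrow> s | Some b \<Rightarrow> g (mon b 1))" for x
  define D where "D = insert None (Some ` B)"
  have monB: "(mon b 1 :: ('n \<Rightarrow>\<^sub>0 nat) \<Rightarrow>\<^sub>0 'k) \<in> spanned_by B" if "b \<in> B" for b using that by (auto simp: spanned_by_def)
  have "card D = Suc (card B)" using fin by (simp add: D_def card_image)
  then obtain c where c: "\<exists>x\<in>D. c x \<noteq> 0" "\<forall>y\<in>B. (\<Sum>x\<in>D. c x * coef (f x) y) = 0"
    using underdetermined_system[of B D "\<lambda>x y. coef (f x) y"] fin by (auto simp: D_def)
  define w where "w = (\<Sum>b\<in>B. cst (c (Some b)) * mon b 1)"
  have w: "w \<in> spanned_by B" unfolding w_def using monB by (intro spanned_by_sum spanned_by_closed)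
  have "(\<Sum>x\<in>D. cst (c x) * f x) = 0"
  proof (rule poly_mapping_eqI)
    fix y
    have "f x \<in> spanned_by B" if "x \<in> D" for x using that s monB maps by (auto simp: f_def D_def)
    then show "coef (\<Sum>x\<in>D. cst (c x) * f x) y = coef 0 y"
      using c(2) by (cases "y \<in> B") (auto simp: lookup_sum cst_coef spanned_by_iff)
  qed
  moreover have "(\<Sum>x\<in>D. cst (c x) * f x) = cst (c None) * s + g w"
    using fin by (simp add: D_def f_def w_def sum.reindex lin addhom_sum[OF add])
  ultimately have rel: "cst (c None) * s + g w = 0" by simp
  have "c None \<noteq> 0"
  proof
    assume 0: "c None = 0"
    then have "w = 0" using rel inj w by simp
    then have "coef w b = 0" for b by simp
    moreover have "coef w b = c (Some b)" if "b \<in> B" for b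
      using fin that by (simp add: w_def cst_mon lookup_sum lookup_single when_def)
    ultimately show False using c(1) 0 by (auto simp: D_def)
  qed
  then have "cst (- inverse (c None)) * (cst (c None) * s + g w) = - s + cst (- inverse (c None)) * g w"
    by (simp add: distrib_left mult.assoc[symmetric] mult_single single_uminus)
  then have "g (cst (- inverse (c None)) * w) = s" unfolding rel lin by simp
  then show "\<exists>s'\<in>spanned_by B. g s' = s" using w spanned_by_closed(2)[OF w w] by blast
next
  fix u :: "('n \<Rightarrow>\<^sub>0 nat) \<Rightarrow>\<^sub>0 'k"
  assume surj: "\<forall>s\<in>spanned_by B. \<exists>s'\<in>spanned_by B. g s' = s" and u: "u \<in> spanned_by B" "g u = 0"
  show "u = 0"
  proof (rule ccontr)
    assume "u \<noteq> 0"
    then obtain b0 where b0: "coef u b0 \<noteq> 0" using nonzero_coef by blast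
    then have b0B: "b0 \<in> B" using u by (auto simp: spanned_by_iff)
    have "\<exists>s'\<in>spanned_by B. g s' = mon b 1" if "b \<in> B" for b
      using surj that by (auto simp: spanned_by_def)
    then obtain w where w: "\<And>b. b \<in> B \<Longrightarrow> w b \<in> spanned_by B" "\<And>b. b \<in> B \<Longrightarrow> g (w b) = mon b 1" by metis
    define w' where "w' b = w b - cst (coef (w b) b0 / coef u b0) * u" for b
    have w': "w' b \<in> spanned_by B" "g (w' b) = mon b 1" "coef (w' b) b0 = 0" if "b \<in> B" for b
      using w[OF that] spanned_by_closed[OF u(1) u(1)] b0
      by (auto simp: w'_def spanned_by_closed addhom_diff[OF add] lin u(2) lookup_minus cst_coef)
    have "card (B - {b0}) < card B" using fin b0B by (rule card_Diff1_less)
    then obtain c where c: "\<exists>x\<in>B. c x \<noteq> 0" "\<forall>y\<in>B - {b0}. (\<Sum>x\<in>B. c x * coef (w' x) y) = 0"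
      using underdetermined_system[of "B - {b0}" B "\<lambda>x y. coef (w' x) y"] fin by auto
    have "(\<Sum>x\<in>B. cst (c x) * w' x) = 0"
    proof (rule poly_mapping_eqI)
      fix y
      show "coef (\<Sum>x\<in>B. cst (c x) * w' x) y = coef 0 y"
        using c(2) w' by (cases "y \<in> B"; cases "y = b0") (auto simp: lookup_sum cst_coef spanned_by_iff)
    qed
    then have "g (\<Sum>x\<in>B. cst (c x) * w' x) = 0" using addhom_zero[OF add] by simp
    then have "(\<Sum>x\<in>B. mon x (c x)) = 0" using w' by (simp add: addhom_sum[OF add] lin cst_mon)
    then have "coef (\<Sum>x\<in>B. mon x (c x)) b = 0" for b by simp
    moreover have "coef (\<Sum>x\<in>B. mon x (c x)) b = c b" if "b \<in> B" for b
      using fin that by (simp add: lookup_sum lookup_single when_def)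
    ultimately show False using c(1) by auto
  qed
qed

lemma addhom_of_int: "addhom f \<Longrightarrow> f (of_int n * x) = of_int n * f x"
  for f :: "'a::ring_1 \<Rightarrow> 'b::ring_1"
proof -
  assume f: "addhom f"
  have nat: "f (of_nat n * x) = of_nat n * f x" for n
    by (induction n) (simp_all add: addhom_zero[OF f] addhom_add[OF f] distrib_right)
  show ?thesis
    using nat[of "nat n"] nat[of "nat (- n)"] addhom_minus[OF f, of "of_nat (nat (- n)) * x"]
    by (cases "n \<ge> 0") simp_all
qed

lemma ratfun_const_add: "ratfun_const (x + y) = ratfun_const x + ratfun_const y"
  by (simp add: ratfun_const_def single_add)

lemma ratfun_const_diff: "ratfun_const (x - y) = ratfun_const x - ratfun_const y"
  by (simp add: ratfun_const_def single_diff)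

lemma ratfun_const_mult: "ratfun_const (x * y) = ratfun_const x * ratfun_const y"
  by (simp add: ratfun_const_def mult_single)

lemma ratfun_const_1: "ratfun_const 1 = 1"
  by (simp add: ratfun_const_def One_fract_def)

lemma ratfun_const_0: "ratfun_const 0 = 0"
  by (simp add: ratfun_const_def Zero_fract_def)

lemma addhom_ratfun_const: "addhom ratfun_const"
  by (rule addhomI) (rule ratfun_const_add)

lemma ratfun_const_of_int: "ratfun_const (of_int n) = of_int n"
  using addhom_of_int[OF addhom_ratfun_const, of n 1] by (simp add: ratfun_const_1)

lemma addhom_partial_deriv: "addhom (partial_deriv k)"
  by (rule addhomI) (rule partial_deriv_add)

lemma partial_deriv_of_int_mult: "partial_deriv k (of_int n * f) = of_int n * partial_deriv k f"
  by (rule addhom_of_int[OF addhom_partial_deriv])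

lemma partial_deriv_of_int: "partial_deriv k (of_int n) = 0"
  using partial_deriv_const[of k "of_int n"] by (simp add: ratfun_const_of_int)

text \<open>
  Left multiplication by \<open>\<partial>\<^sub>k\<close> on symbols is \<open>deriv_symbol\<close>: by the Leibniz rule
  \<open>\<partial>\<^sub>k \<circ> c = c \<partial>\<^sub>k + \<partial>c/\<partial>v\<^sub>k\<close>. Right multiplication by \<open>\<partial>\<^sub>j\<close> is plain multiplication by \<open>\<xi>\<^sub>j\<close>.
\<close>

definition coef_deriv :: "'n::linorder \<Rightarrow> (('n \<Rightarrow>\<^sub>0 nat) \<Rightarrow>\<^sub>0 'n ratfun) \<Rightarrow> (('n \<Rightarrow>\<^sub>0 nat) \<Rightarrow>\<^sub>0 'n ratfun)" where
  "coef_deriv k = ext (\<lambda>u g. mon u (partial_deriv k g))"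

definition deriv_symbol :: "'n::linorder \<Rightarrow> (('n \<Rightarrow>\<^sub>0 nat) \<Rightarrow>\<^sub>0 'n ratfun) \<Rightarrow> (('n \<Rightarrow>\<^sub>0 nat) \<Rightarrow>\<^sub>0 'n ratfun)" where
  "deriv_symbol k p = xi k * p + coef_deriv k p"

lemma addhom_coef_deriv: "addhom (coef_deriv k)"
  unfolding coef_deriv_def by (intro addhom_ext addhom_comp[OF addhom_mon addhom_partial_deriv])

lemma addhom_deriv_symbol: "addhom (deriv_symbol k)"
  unfolding deriv_symbol_def[abs_def] by (intro addhom_intros addhom_coef_deriv)

lemma coef_deriv_single: "coef_deriv k (mon u g) = mon u (partial_deriv k g)"
  unfolding coef_deriv_def by (rule ext_single) (simp add: addhom_zero[OF addhom_partial_deriv])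

lemma coef_deriv_xi: "coef_deriv k (xi j * p) = xi j * coef_deriv k p"
proof -
  have "(\<lambda>p. coef_deriv k (xi j * p)) = (\<lambda>p. xi j * coef_deriv k p)"
    by (rule addhom_eqI) (simp_all add: addhom_comp[OF addhom_coef_deriv addhom_times[OF addhom_id]]
      addhom_times[OF addhom_coef_deriv] xi_mon coef_deriv_single)
  from fun_cong[OF this] show ?thesis .
qed

lemma coef_deriv_cst: "coef_deriv k (cst g * p) = cst g * coef_deriv k p + cst (partial_deriv k g) * p"
proof -
  have "(\<lambda>p. coef_deriv k (cst g * p)) = (\<lambda>p. cst g * coef_deriv k p + cst (partial_deriv k g) * p)"
  proof (rule addhom_eqI)
    show "coef_deriv k (cst g * mon u c) = cst g * coef_deriv k (mon u c) + cst (partial_deriv k g) * mon u c" for u c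
      by (simp add: cst_mon coef_deriv_single partial_deriv_mult single_add add.commute)
  qed (intro addhom_intros addhom_coef_deriv addhom_comp[OF addhom_coef_deriv])+
  from fun_cong[OF this] show ?thesis .
qed

lemma coef_deriv_euler_weight: "coef_deriv k (euler_weight a i p) = euler_weight a i (coef_deriv k p)"
proof -
  have "(\<lambda>p. coef_deriv k (euler_weight a i p)) = (\<lambda>p. euler_weight a i (coef_deriv k p))"
    by (rule addhom_eqI) (simp_all add: addhom_comp[OF addhom_coef_deriv addhom_euler_weight]
      addhom_comp[OF addhom_euler_weight addhom_coef_deriv] euler_weight_single coef_deriv_single
      partial_deriv_of_int_mult)
  from fun_cong[OF this] show ?thesis .
qed

lemma coef_deriv_euler_form:
  fixes a :: "'n::{finite,linorder} \<Rightarrow> int ^ 'r"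
  shows "coef_deriv k (euler_form a ratfun_var i * p) =
    euler_form a ratfun_var i * coef_deriv k p + xi k * (of_int (a k $ i) * p)"
proof -
  have "(\<lambda>p. coef_deriv k (euler_form a ratfun_var i * p)) =
    (\<lambda>p. euler_form a ratfun_var i * coef_deriv k p + xi k * (of_int (a k $ i) * p))"
  proof (rule addhom_eqI)
    fix u and c :: "'n ratfun"
    have "coef_deriv k (euler_form a ratfun_var i * mon u c) =
       (\<Sum>j\<in>UNIV. mon (mon j 1 + u) (of_int (a j $ i) * ratfun_var j * partial_deriv k c)) +
       (\<Sum>j\<in>UNIV. if k = j then mon (mon k 1 + u) (of_int (a k $ i) * c) else 0)"
      unfolding euler_form_single addhom_sum[OF addhom_coef_deriv] coef_deriv_single sum.distrib[symmetric] mult.assoc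
        partial_deriv_of_int_mult partial_deriv_mult
      by (intro sum.cong refl) (auto simp: partial_deriv_var partial_deriv_of_int distrib_left single_add)
    then show "coef_deriv k (euler_form a ratfun_var i * mon u c) =
      euler_form a ratfun_var i * coef_deriv k (mon u c) + xi k * (of_int (a k $ i) * mon u c)"
      by (simp add: coef_deriv_single euler_form_single of_int_mon xi_mon)
  qed (intro addhom_intros addhom_coef_deriv addhom_comp[OF addhom_coef_deriv])+
  from fun_cong[OF this] show ?thesis .
qed

lemma deriv_symbol_xi: "deriv_symbol k (xi j * p) = xi j * deriv_symbol k p"
  unfolding deriv_symbol_def coef_deriv_xi by (simp add: algebra_simps)

text \<open>
  Left and right multiplications commute. On symbols this rests on the identity
  \<open>\<partial>\<theta>\<^sub>i/\<partial>v\<^sub>k = a\<^sub>i\<^sub>k \<xi>\<^sub>k\<close>.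
\<close>

lemma deriv_symbol_euler_mult:
  assumes "partial_deriv k (c i) = 0"
  shows "deriv_symbol k (euler_mult a ratfun_var c i p) = euler_mult a ratfun_var c i (deriv_symbol k p)"
proof -
  have "deriv_symbol k (euler_mult a ratfun_var c i p) =
      xi k * euler_mult a ratfun_var c i p + (euler_form a ratfun_var i * coef_deriv k p + xi k * (of_int (a k $ i) * p))
      + euler_weight a i (coef_deriv k p) - cst (c i) * coef_deriv k p"
    unfolding deriv_symbol_def euler_mult_def addhom_add[OF addhom_coef_deriv] addhom_diff[OF addhom_coef_deriv]
      coef_deriv_euler_form coef_deriv_euler_weight coef_deriv_cst assms by simp
  also have "\<dots> = euler_mult a ratfun_var c i (deriv_symbol k p)"
    unfolding deriv_symbol_def euler_mult_def addhom_add[OF addhom_euler_weight] euler_weight_xi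
    by (simp add: algebra_simps)
  finally show ?thesis .
qed

lemma coef_deriv_toric_kernel: "p \<in> toric_kernel a \<Longrightarrow> coef_deriv k p \<in> toric_kernel a"
proof -
  assume p: "p \<in> toric_kernel a"
  let ?F = "\<lambda>z g. mon z (partial_deriv k g)"
  have ah: "addhom (ext ?F)" by (intro addhom_ext addhom_comp[OF addhom_mon addhom_partial_deriv])
  have "(\<lambda>p. toric_map a (coef_deriv k p)) = (\<lambda>p. ext ?F (toric_map a p))"
    by (rule addhom_eqI)
       (simp_all add: addhom_comp[OF addhom_toric_map addhom_coef_deriv] addhom_comp[OF ah addhom_toric_map]
         coef_deriv_single toric_map_single ext_single addhom_zero[OF addhom_partial_deriv])
  from fun_cong[OF this, of p] show ?thesis using p by (simp add: toric_kernel_def ext_def)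
qed

text \<open>
  Left \<open>K[\<partial>]\<close>-submodules, on the side of symbols.
\<close>

definition left_stable :: "(('n::linorder \<Rightarrow>\<^sub>0 nat) \<Rightarrow>\<^sub>0 'n ratfun) set \<Rightarrow> bool" where
  "left_stable N \<longleftrightarrow> (\<forall>p\<in>N. \<forall>q\<in>N. p + q \<in> N) \<and> (\<forall>p\<in>N. \<forall>g. cst g * p \<in> N) \<and> (\<forall>p\<in>N. \<forall>k. deriv_symbol k p \<in> N)"

lemma left_stableD:
  assumes "left_stable N"
  shows "\<And>p q. p \<in> N \<Longrightarrow> q \<in> N \<Longrightarrow> p + q \<in> N" "\<And>p g. p \<in> N \<Longrightarrow> cst g * p \<in> N"
    "\<And>p k. p \<in> N \<Longrightarrow> deriv_symbol k p \<in> N" "\<And>p. p \<in> N \<Longrightarrow> - p \<in> N"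
    "\<And>p q. p \<in> N \<Longrightarrow> q \<in> N \<Longrightarrow> p - q \<in> N"
proof -
  show *: "\<And>p q. p \<in> N \<Longrightarrow> q \<in> N \<Longrightarrow> p + q \<in> N" "\<And>p g. p \<in> N \<Longrightarrow> cst g * p \<in> N"
    "\<And>p k. p \<in> N \<Longrightarrow> deriv_symbol k p \<in> N"
    using assms by (auto simp: left_stable_def)
  show neg: "- p \<in> N" if "p \<in> N" for p
    using *(2)[OF that, of "- 1"] by (simp add: single_uminus)
  show "p - q \<in> N" if "p \<in> N" "q \<in> N" for p q
    using *(1)[OF that(1) neg[OF that(2)]] by simp
qed

definition hypergeom_symbols :: "('n::{finite,linorder} \<Rightarrow> int ^ 'r) \<Rightarrow> complex ^ 'r \<Rightarrow> (('n \<Rightarrow>\<^sub>0 nat) \<Rightarrow>\<^sub>0 'n ratfun) set" where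
  "hypergeom_symbols a \<alpha> = euler_ideal a ratfun_var (\<lambda>i. ratfun_const (\<alpha> $ i))"

lemma zero_in_hypergeom_symbols: "0 \<in> hypergeom_symbols a \<alpha>"
  unfolding hypergeom_symbols_def
  by (rule euler_idealI[OF ring_idealD(1)[OF ring_ideal_toric_kernel], where q = "\<lambda>_. 0"])
     (simp add: addhom_zero[OF addhom_euler_mult])

lemma euler_mult_cst: "euler_mult a v c i (cst b * p) = cst b * euler_mult a v c i p"
  unfolding euler_mult_def euler_weight_cst by (simp add: algebra_simps)

lemma left_stable_hypergeom_symbols:
  fixes a :: "'n::{finite,linorder} \<Rightarrow> int ^ 'r"
  shows "left_stable (hypergeom_symbols a \<alpha>)"
  unfolding left_stable_def
proof (intro conjI ballI allI)
  note T = ring_idealD[OF ring_ideal_toric_kernel[of a, where 'b="'n ratfun"]]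
  let ?E = "euler_mult a ratfun_var (\<lambda>i. ratfun_const (\<alpha> $ i))"
  fix p assume "p \<in> hypergeom_symbols a \<alpha>"
  then obtain t q where p: "t \<in> toric_kernel a" "p = t + (\<Sum>i\<in>UNIV. ?E i (q i))"
    by (auto simp: hypergeom_symbols_def euler_ideal_def)
  show "cst g * p \<in> hypergeom_symbols a \<alpha>" for g
    unfolding hypergeom_symbols_def
    by (rule euler_idealI[OF T(3)[OF p(1), of "cst g"], where q = "\<lambda>i. cst g * q i"])
       (simp add: p euler_mult_cst distrib_left sum_distrib_left)
  show "deriv_symbol k p \<in> hypergeom_symbols a \<alpha>" for k
  proof -
    have "deriv_symbol k t \<in> toric_kernel a"
      unfolding deriv_symbol_def by (intro T(2) T(3) coef_deriv_toric_kernel p(1))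
    then show ?thesis
    unfolding hypergeom_symbols_def
    by (rule euler_idealI[where q = "\<lambda>i. deriv_symbol k (q i)"])
       (simp add: p addhom_add[OF addhom_deriv_symbol] addhom_sum[OF addhom_deriv_symbol]
         deriv_symbol_euler_mult partial_deriv_const)
  qed
  fix p' assume "p' \<in> hypergeom_symbols a \<alpha>"
  then obtain t' q' where p': "t' \<in> toric_kernel a" "p' = t' + (\<Sum>i\<in>UNIV. ?E i (q' i))"
    by (auto simp: hypergeom_symbols_def euler_ideal_def)
  show "p + p' \<in> hypergeom_symbols a \<alpha>"
    unfolding hypergeom_symbols_def
    by (rule euler_idealI[OF T(2)[OF p(1) p'(1)], where q = "\<lambda>i. q i + q' i"])
       (simp add: p p' addhom_add[OF addhom_euler_mult] sum.distrib)
qed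

definition complex_point :: "int ^ 'r \<Rightarrow> complex ^ 'r" where
  "complex_point z = (\<chi> i. of_int (z $ i))"

text \<open>
  This makes multiplication by \<open>\<xi>\<^sub>j\<close> a homomorphism \<open>M(\<alpha> - a\<^sub>j) \<rightarrow> M(\<alpha>)\<close>.
\<close>

lemma xi_hypergeom_symbols:
  fixes a :: "'n::{finite,linorder} \<Rightarrow> int ^ 'r"
  assumes "p \<in> hypergeom_symbols a (\<alpha> - complex_point (a j))"
  shows "xi j * p \<in> hypergeom_symbols a \<alpha>"
proof -
  note T = ring_idealD[OF ring_ideal_toric_kernel[of a, where 'b="'n ratfun"]]
  obtain t q where p: "t \<in> toric_kernel a"
    "p = t + (\<Sum>i\<in>UNIV. euler_mult a ratfun_var (\<lambda>i. ratfun_const ((\<alpha> - complex_point (a j)) $ i)) i (q i))"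
    using assms by (auto simp: hypergeom_symbols_def euler_ideal_def)
  have c: "(\<lambda>i. ratfun_const ((\<alpha> - complex_point (a j)) $ i)) = (\<lambda>i. ratfun_const (\<alpha> $ i) - of_int (a j $ i))"
    by (simp add: complex_point_def ratfun_const_diff ratfun_const_of_int)
  show ?thesis
    unfolding hypergeom_symbols_def
    by (rule euler_idealI[OF T(3)[OF p(1), of "xi j"], where q = "\<lambda>i. xi j * q i"])
       (simp add: p(2)[unfolded c] euler_mult_xi distrib_left sum_distrib_left)
qed

definition irreducible_symbols :: "('n::{finite,linorder} \<Rightarrow> int ^ 'r) \<Rightarrow> complex ^ 'r \<Rightarrow> bool" where
  "irreducible_symbols a \<alpha> \<longleftrightarrow>
     (\<forall>N. left_stable N \<longrightarrow> hypergeom_symbols a \<alpha> \<subseteq> N \<longrightarrow> N = hypergeom_symbols a \<alpha> \<or> N = UNIV)"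

text \<open>
  The monomials in \<open>B\<close> are a common basis of all quotients \<open>M(\<alpha>)\<close>, and no \<open>\<xi>\<^sub>j\<close> acts as zero.
\<close>

locale contiguous_systems =
  fixes a :: "'n::{finite,linorder} \<Rightarrow> int ^ 'r" and B :: "('n \<Rightarrow>\<^sub>0 nat) set"
  assumes finite_basis: "finite B"
    and basis_independent: "\<And>\<alpha>. spanned_by B \<inter> hypergeom_symbols a \<alpha> \<subseteq> {0}"
    and basis_generates: "\<And>\<alpha> p. \<exists>s\<in>spanned_by B. p - s \<in> hypergeom_symbols a \<alpha>"
    and xi_notin: "\<And>\<alpha> j. xi j \<notin> hypergeom_symbols a \<alpha>"
begin

definition normal_form :: "complex ^ 'r \<Rightarrow> (('n \<Rightarrow>\<^sub>0 nat) \<Rightarrow>\<^sub>0 'n ratfun) \<Rightarrow> (('n \<Rightarrow>\<^sub>0 nat) \<Rightarrow>\<^sub>0 'n ratfun)" where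
  "normal_form \<alpha> p = (SOME s. s \<in> spanned_by B \<and> p - s \<in> hypergeom_symbols a \<alpha>)"

lemma normal_form: "normal_form \<alpha> p \<in> spanned_by B" "p - normal_form \<alpha> p \<in> hypergeom_symbols a \<alpha>"
  using someI_ex[of "\<lambda>s. s \<in> spanned_by B \<and> p - s \<in> hypergeom_symbols a \<alpha>"] basis_generates[of p \<alpha>]
  unfolding normal_form_def by blast+

lemma normal_form_eqI:
  assumes "s \<in> spanned_by B" "p - s \<in> hypergeom_symbols a \<alpha>"
  shows "normal_form \<alpha> p = s"
proof -
  have "(p - s) - (p - normal_form \<alpha> p) \<in> hypergeom_symbols a \<alpha>"
    using assms normal_form left_stableD(5)[OF left_stable_hypergeom_symbols] by blast
  then have "normal_form \<alpha> p - s \<in> hypergeom_symbols a \<alpha>" by simp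
  moreover have "normal_form \<alpha> p - s \<in> spanned_by B" by (intro spanned_by_closed normal_form assms)
  ultimately show ?thesis using basis_independent[of \<alpha>] by auto
qed

text \<open>
  In the basis \<open>B\<close> of both \<open>M(\<alpha> - a\<^sub>j)\<close> and \<open>M(\<alpha>)\<close>, multiplication by \<open>\<xi>\<^sub>j\<close> is an endomorphism of the span of
  \<open>B\<close>.
\<close>

lemma xi_injective_iff_surjective:
  "(\<forall>q. xi j * q \<in> hypergeom_symbols a \<alpha> \<longrightarrow> q \<in> hypergeom_symbols a (\<alpha> - complex_point (a j))) \<longleftrightarrow>
   (\<forall>p. \<exists>q. p - xi j * q \<in> hypergeom_symbols a \<alpha>)"
proof -
  define g where "g p = normal_form \<alpha> (xi j * p)" for p
  let ?H = "hypergeom_symbols a \<alpha>" and ?H' = "hypergeom_symbols a (\<alpha> - complex_point (a j))"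
  note H = left_stableD[OF left_stable_hypergeom_symbols[of a \<alpha>]]
  have g: "g p \<in> spanned_by B" "xi j * p - g p \<in> ?H" for p
    unfolding g_def by (rule normal_form)+
  have add: "addhom g"
  proof (rule addhomI)
    fix p q
    have "xi j * (p + q) - (g p + g q) = (xi j * p - g p) + (xi j * q - g q)" by (simp add: algebra_simps)
    then have "xi j * (p + q) - (g p + g q) \<in> ?H" using H(1)[OF g(2) g(2)] by metis
    then show "g (p + q) = g p + g q"
      using normal_form_eqI[OF spanned_by_closed(1)[OF g(1) g(1)]] unfolding g_def by blast
  qed
  have lin: "g (cst c * p) = cst c * g p" for c p
  proof -
    have "xi j * (cst c * p) - cst c * g p = cst c * (xi j * p - g p)" by (simp add: algebra_simps)
    then have "xi j * (cst c * p) - cst c * g p \<in> ?H" using H(2)[OF g(2)] by metis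
    then show ?thesis
      using normal_form_eqI[OF spanned_by_closed(2)[OF g(1) g(1)]] unfolding g_def by blast
  qed
  have "(\<forall>q. xi j * q \<in> ?H \<longrightarrow> q \<in> ?H') \<longleftrightarrow> (\<forall>s\<in>spanned_by B. g s = 0 \<longrightarrow> s = 0)"
  proof (intro iffI ballI allI impI)
    fix s :: "('n \<Rightarrow>\<^sub>0 nat) \<Rightarrow>\<^sub>0 'n ratfun"
    assume "\<forall>q. xi j * q \<in> ?H \<longrightarrow> q \<in> ?H'" "s \<in> spanned_by B" "g s = 0"
    then show "s = 0" using g(2)[of s] basis_independent[of "\<alpha> - complex_point (a j)"] by auto
  next
    fix q assume inj: "\<forall>s\<in>spanned_by B. g s = 0 \<longrightarrow> s = 0" and q: "xi j * q \<in> ?H"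
    obtain s where s: "s \<in> spanned_by B" "q - s \<in> ?H'" using basis_generates by blast
    have "xi j * s = xi j * q - xi j * (q - s)" by (simp add: algebra_simps)
    then have "xi j * s \<in> ?H" using H(5)[OF q xi_hypergeom_symbols[OF s(2)]] by metis
    then have "g s = 0" unfolding g_def by (intro normal_form_eqI) (auto simp: spanned_by_def)
    then show "q \<in> ?H'" using inj s by auto
  qed
  also have "\<dots> \<longleftrightarrow> (\<forall>s\<in>spanned_by B. \<exists>s'\<in>spanned_by B. g s' = s)"
    by (rule injective_iff_surjective_on_span[OF finite_basis add lin g(1)])
  also have "\<dots> \<longleftrightarrow> (\<forall>p. \<exists>q. p - xi j * q \<in> ?H)"
  proof (intro iffI ballI allI)
    fix p assume "\<forall>s\<in>spanned_by B. \<exists>s'\<in>spanned_by B. g s' = s"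
    then obtain q where q: "g q = normal_form \<alpha> p" using normal_form(1) by blast
    have "p - xi j * q = (p - normal_form \<alpha> p) - (xi j * q - g q)" by (simp add: q)
    then show "\<exists>q. p - xi j * q \<in> ?H" using H(5)[OF normal_form(2) g(2)] by metis
  next
    fix s :: "('n \<Rightarrow>\<^sub>0 nat) \<Rightarrow>\<^sub>0 'n ratfun"
    assume surj: "\<forall>p. \<exists>q. p - xi j * q \<in> ?H" and s: "s \<in> spanned_by B"
    obtain q where q: "s - xi j * q \<in> ?H" using surj by blast
    obtain s' where s': "s' \<in> spanned_by B" "q - s' \<in> ?H'" using basis_generates by blast
    have "xi j * s' - s = - ((s - xi j * q) + xi j * (q - s'))" by (simp add: algebra_simps)
    then have "xi j * s' - s \<in> ?H" using H(4)[OF H(1)[OF q xi_hypergeom_symbols[OF s'(2)]]] by metis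
    then have "g s' = s" unfolding g_def using s by (intro normal_form_eqI)
    then show "\<exists>s'\<in>spanned_by B. g s' = s" using s'(1) by blast
  qed
  finally show ?thesis .
qed

lemma left_stable_xi_image:
  assumes "left_stable N"
  shows "left_stable {xi j * n + h | n h. n \<in> N \<and> h \<in> hypergeom_symbols a \<alpha>}"
proof -
  note H = left_stableD[OF left_stable_hypergeom_symbols[of a \<alpha>]] and N = left_stableD[OF assms]
  show ?thesis
    unfolding left_stable_def
  proof safe
    fix n h n' h' assume *: "n \<in> N" "h \<in> hypergeom_symbols a \<alpha>" "n' \<in> N" "h' \<in> hypergeom_symbols a \<alpha>"
    show "\<exists>n'' h''. xi j * n + h + (xi j * n' + h') = xi j * n'' + h'' \<and> n'' \<in> N \<and> h'' \<in> hypergeom_symbols a \<alpha>"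
      by (intro exI[of _ "n + n'"] exI[of _ "h + h'"]) (simp add: algebra_simps H N *)
  next
    fix n h g assume *: "n \<in> N" "h \<in> hypergeom_symbols a \<alpha>"
    show "\<exists>n' h'. cst g * (xi j * n + h) = xi j * n' + h' \<and> n' \<in> N \<and> h' \<in> hypergeom_symbols a \<alpha>"
      by (intro exI[of _ "cst g * n"] exI[of _ "cst g * h"]) (simp add: algebra_simps H(2)[OF *(2), simplified mult.commute] N(2)[OF *(1), simplified mult.commute])
  next
    fix n h k assume *: "n \<in> N" "h \<in> hypergeom_symbols a \<alpha>"
    show "\<exists>n' h'. deriv_symbol k (xi j * n + h) = xi j * n' + h' \<and> n' \<in> N \<and> h' \<in> hypergeom_symbols a \<alpha>"
      by (intro exI[of _ "deriv_symbol k n"] exI[of _ "deriv_symbol k h"])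
         (simp add: addhom_add[OF addhom_deriv_symbol] deriv_symbol_xi H N *)
  qed
qed

lemma left_stable_xi_preimage:
  assumes "left_stable N"
  shows "left_stable {p. xi j * p \<in> N}"
proof -
  note N = left_stableD[OF assms]
  show ?thesis
    unfolding left_stable_def
    using N by (auto simp: distrib_left mult.left_commute[of "xi j" "cst _"] deriv_symbol_xi[symmetric])
qed

lemma left_stable_UNIV: "left_stable UNIV"
  by (simp add: left_stable_def)

text \<open>
  The image is a submodule, and it contains the nonzero class of \<open>\<xi>\<^sub>j\<close>.
\<close>

lemma xi_surjective_if_irreducible:
  assumes "irreducible_symbols a \<alpha>"
  shows "\<exists>q. p - xi j * q \<in> hypergeom_symbols a \<alpha>"
proof -
  let ?N = "{xi j * n + h | n h. n \<in> UNIV \<and> h \<in> hypergeom_symbols a \<alpha>}"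
  have "hypergeom_symbols a \<alpha> \<subseteq> ?N"
  proof
    fix h assume "h \<in> hypergeom_symbols a \<alpha>"
    then show "h \<in> ?N" by (intro CollectI exI[of _ 0] exI[of _ h]) auto
  qed
  moreover have "?N \<noteq> hypergeom_symbols a \<alpha>"
  proof -
    have "xi j = xi j * 1 + 0" by simp
    then have "xi j \<in> ?N" using zero_in_hypergeom_symbols by blast
    then show ?thesis using xi_notin by blast
  qed
  ultimately have "?N = UNIV"
    using assms left_stable_xi_image[OF left_stable_UNIV, of j \<alpha>] unfolding irreducible_symbols_def by blast
  then obtain n h where "p = xi j * n + h" "h \<in> hypergeom_symbols a \<alpha>" by blast
  then show ?thesis by (intro exI[of _ n]) simp
qed

text \<open>
  Multiplication by \<open>\<xi>\<^sub>j\<close> is surjective, hence injective, so submodules of \<open>M(\<alpha> - a\<^sub>j)\<close> correspond to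
  their images.
\<close>

lemma irreducible_shift_down:
  assumes irr: "irreducible_symbols a \<alpha>"
  shows "irreducible_symbols a (\<alpha> - complex_point (a j))"
  unfolding irreducible_symbols_def
proof (intro allI impI)
  let ?H = "hypergeom_symbols a \<alpha>" and ?H' = "hypergeom_symbols a (\<alpha> - complex_point (a j))"
  have inj: "q \<in> ?H'" if "xi j * q \<in> ?H" for q
    using xi_injective_iff_surjective xi_surjective_if_irreducible[OF irr] that by blast
  fix N assume N: "left_stable N" "?H' \<subseteq> N"
  let ?N = "{xi j * n + h | n h. n \<in> N \<and> h \<in> ?H}"
  have N0: "0 \<in> N" using N(2) zero_in_hypergeom_symbols by blast
  have "?H \<subseteq> ?N"
  proof
    fix h assume "h \<in> ?H"
    then show "h \<in> ?N" using N0 by (intro CollectI exI[of _ 0] exI[of _ h]) auto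
  qed
  then consider "?N = ?H" | "?N = UNIV"
    using irr left_stable_xi_image[OF N(1), of j \<alpha>] unfolding irreducible_symbols_def by blast
  then show "N = ?H' \<or> N = UNIV"
  proof cases
    case 1
    have "n \<in> ?H'" if "n \<in> N" for n
    proof (rule inj)
      have "xi j * n = xi j * n + 0" by simp
      then have "xi j * n \<in> ?N" using that zero_in_hypergeom_symbols by blast
      then show "xi j * n \<in> ?H" using 1 by blast
    qed
    then show ?thesis using N(2) by blast
  next
    case 2
    have "p \<in> N" for p
    proof -
      obtain n h where nh: "xi j * p = xi j * n + h" "n \<in> N" "h \<in> ?H" using 2 by blast
      then have "xi j * (p - n) = h" by (simp add: algebra_simps)
      then have "p - n \<in> ?H'" using inj nh(3) by simp
      then have "(p - n) + n \<in> N" using N nh(2) left_stableD(1) by blast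
      then show ?thesis by simp
    qed
    then show ?thesis by blast
  qed
qed

text \<open>
  The kernel of multiplication by \<open>\<xi>\<^sub>j\<close> is a proper submodule of an irreducible module, hence zero. So
  the map is also surjective, and submodules of \<open>M(\<alpha>)\<close> correspond to their preimages.
\<close>

lemma irreducible_shift_up:
  assumes irr: "irreducible_symbols a (\<alpha> - complex_point (a j))"
  shows "irreducible_symbols a \<alpha>"
  unfolding irreducible_symbols_def
proof (intro allI impI)
  let ?H = "hypergeom_symbols a \<alpha>" and ?H' = "hypergeom_symbols a (\<alpha> - complex_point (a j))"
  have pre: "{p. xi j * p \<in> N} = ?H' \<or> {p. xi j * p \<in> N} = UNIV" if "left_stable N" "?H \<subseteq> N" for N
  proof -
    have "?H' \<subseteq> {p. xi j * p \<in> N}" using xi_hypergeom_symbols that(2) by blast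
    then show ?thesis using irr left_stable_xi_preimage[OF that(1)] unfolding irreducible_symbols_def by blast
  qed
  have "{p. xi j * p \<in> ?H} \<noteq> UNIV"
  proof
    assume "{p. xi j * p \<in> ?H} = UNIV"
    then have "xi j * 1 \<in> ?H" by blast
    then show False using xi_notin by simp
  qed
  then have "{p. xi j * p \<in> ?H} = ?H'" using pre[OF left_stable_hypergeom_symbols order_refl] by blast
  then have surj: "\<exists>q. p - xi j * q \<in> ?H" for p using xi_injective_iff_surjective by blast
  fix N assume N: "left_stable N" "?H \<subseteq> N"
  note NN = left_stableD[OF N(1)]
  consider "{p. xi j * p \<in> N} = ?H'" | "{p. xi j * p \<in> N} = UNIV" using pre[OF N] by blast
  then show "N = ?H \<or> N = UNIV"
  proof cases
    case 1
    have "n \<in> ?H" if "n \<in> N" for n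
    proof -
      obtain q where q: "n - xi j * q \<in> ?H" using surj by blast
      have "xi j * q = n - (n - xi j * q)" by simp
      then have "xi j * q \<in> N" using NN(5) that q N(2) by (metis subsetD)
      then have "xi j * q \<in> ?H" using 1 xi_hypergeom_symbols by blast
      from left_stableD(1)[OF left_stable_hypergeom_symbols q this] show ?thesis by simp
    qed
    then show ?thesis using N(2) by blast
  next
    case 2
    have "p \<in> N" for p
    proof -
      obtain q where q: "p - xi j * q \<in> ?H" using surj by blast
      have "xi j * q \<in> N" using 2 by blast
      from NN(1)[OF subsetD[OF N(2) q] this] show ?thesis by simp
    qed
    then show ?thesis by blast
  qed
qed

lemma irreducible_shift:
  assumes irr: "irreducible_symbols a \<alpha>"
  shows "irreducible_symbols a (\<alpha> + complex_point (\<Sum>j\<in>UNIV. c j *s a j))"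
proof -
  have cp: "complex_point (x + y) = complex_point x + complex_point y" for x y :: "int ^ 'r"
    by (simp add: complex_point_def vec_eq_iff)
  have one: "irreducible_symbols a (\<beta> + complex_point (n *s a j))" if "irreducible_symbols a \<beta>" for \<beta> n j
  proof (induction n rule: int_induct[where k = 0])
    case base
    then show ?case using that by (simp add: complex_point_def vec_eq_iff flip: zero_vec_def)
  next
    case (step1 n)
    have "\<beta> + complex_point ((n + 1) *s a j) - complex_point (a j) = \<beta> + complex_point (n *s a j)"
      by (simp add: complex_point_def vec_eq_iff algebra_simps)
    then show ?case using irreducible_shift_up step1 by metis
  next
    case (step2 n)
    have "\<beta> + complex_point (n *s a j) - complex_point (a j) = \<beta> + complex_point ((n - 1) *s a j)"
      by (simp add: complex_point_def vec_eq_iff algebra_simps)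
    then show ?case using irreducible_shift_down step2 by metis
  qed
  have "irreducible_symbols a (\<alpha> + complex_point (\<Sum>j\<in>I. c j *s a j))" if "finite I" for I
    using that
  proof (induction I)
    case empty
    then show ?case using irr by (simp add: complex_point_def flip: zero_vec_def)
  next
    case (insert j I)
    have "\<alpha> + complex_point (\<Sum>j\<in>insert j I. c j *s a j) = (\<alpha> + complex_point (\<Sum>j\<in>I. c j *s a j)) + complex_point (c j *s a j)"
      using insert.hyps by (simp add: cp)
    then show ?case using one[OF insert.IH] by metis
  qed
  then show ?thesis by simp
qed

end


section \<open>Finiteness modulo the Euler forms\<close>

lemma power_diff_in_ideal:
  assumes "ring_ideal P" "p \<in> P"
  shows "x ^ n - (x - p) ^ n \<in> P"
proof (induction n)
  case 0
  then show ?case using ring_idealD(1)[OF assms(1)] by simp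
next
  case (Suc n)
  have "x ^ Suc n - (x - p) ^ Suc n = x * (x ^ n - (x - p) ^ n) + p * (x - p) ^ n"
    by (simp add: algebra_simps)
  then show ?case using ring_idealD(2,3,4)[OF assms(1)] Suc assms(2) by metis
qed

lemma mon_power: "mon u 1 ^ n = mon ((\<Sum>_<n. u) :: 'n \<Rightarrow>\<^sub>0 nat) (1 :: 'k::comm_ring_1)" for n :: nat
  by (induction n) (simp_all add: mult_single add.commute)

lemma supp_sum_subset: "(\<And>i. i \<in> I \<Longrightarrow> supp (f i) \<subseteq> G) \<Longrightarrow> supp (sum f I) \<subseteq> G"
  for f :: "'i \<Rightarrow> ('n \<Rightarrow>\<^sub>0 nat)"
  using keys_sum[of f I] by fastforce

lemma supp_add_nat: "supp (u + w) = supp u \<union> supp w" for u w :: "'n \<Rightarrow>\<^sub>0 nat"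
  by (auto simp: in_keys_iff lookup_add)

text \<open>
  This ideal takes the place of a prime ideal over \<open>J\<close> that does not contain \<open>\<xi>\<^sub>k\<close>: every variable is
  either in \<open>P\<close> or in the multiplicative set of monomials that avoids \<open>P\<close>. The variables are treated one
  after the other. If \<open>\<xi>\<^sub>j\<close> cannot join the multiplicative set, then \<open>\<xi>\<^sub>j\<^sup>n \<xi>\<^sup>t \<in> P\<close> for some admissible \<open>t\<close>, and
  this is why \<open>\<xi>\<^sub>j\<close> can be added to the ideal.
\<close>

lemma ideal_avoiding_monomials:
  fixes J :: "(('n::finite \<Rightarrow>\<^sub>0 nat) \<Rightarrow>\<^sub>0 'k::comm_ring_1) set"
  assumes J: "ring_ideal J" and k: "\<And>n. mon (mon k n) 1 \<notin> J"
  shows "\<exists>P G. ring_ideal P \<and> J \<subseteq> P \<and> k \<in> G \<and> (\<forall>j. j \<notin> G \<longrightarrow> xi j \<in> P) \<and> (\<forall>u. supp u \<subseteq> G \<longrightarrow> mon u 1 \<notin> P)"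
proof -
  have "\<exists>P G. ring_ideal P \<and> J \<subseteq> P \<and> k \<in> G \<and> G \<subseteq> insert k T \<and> (\<forall>j\<in>T - G. xi j \<in> P) \<and> (\<forall>u. supp u \<subseteq> G \<longrightarrow> mon u 1 \<notin> P)"
    if "finite T" for T
    using that
  proof (induction T)
    case empty
    have "mon u 1 \<notin> J" if "supp u \<subseteq> {k}" for u
    proof -
      have "u = mon k (coef u k)"
        using that by (intro poly_mapping_eqI) (auto simp: lookup_single when_def in_keys_iff)
      then show ?thesis using k by metis
    qed
    then show ?case using J by (intro exI[of _ J] exI[of _ "{k}"]) auto
  next
    case (insert j T)
    then obtain P G where PG: "ring_ideal P" "J \<subseteq> P" "k \<in> G" "G \<subseteq> insert k T"
      "\<And>i. i \<in> T - G \<Longrightarrow> xi i \<in> P" "\<And>u. supp u \<subseteq> G \<Longrightarrow> mon u 1 \<notin> P" by blast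
    note I = ring_idealD[OF PG(1)]
    consider "j \<in> G" | "j \<notin> G" "\<forall>u. supp u \<subseteq> insert j G \<longrightarrow> mon u 1 \<notin> P"
      | u0 where "j \<notin> G" "supp u0 \<subseteq> insert j G" "mon u0 1 \<in> P" by blast
    then show ?case
    proof cases
      case 1
      then show ?thesis using PG by (intro exI[of _ P] exI[of _ G]) auto
    next
      case 2
      then show ?thesis using PG by (intro exI[of _ P] exI[of _ "insert j G"]) auto
    next
      case 3
      (* If an admissible monomial were p + xi j * q with p in P, its n-th power would be
         xi j ^ n * q ^ n modulo P, so that its product with mon t 1 would lie in P. This product is a monomial in the variables of G. *)
      define n where "n = coef u0 j"
      define t where "t = u0 - mon j n"
      have u0: "u0 = mon j n + t"
        by (rule poly_mapping_eqI) (auto simp: t_def n_def lookup_add lookup_minus lookup_single when_def)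
      have t: "supp t \<subseteq> G"
        using 3(2) by (auto simp: t_def n_def in_keys_iff lookup_minus lookup_single when_def subset_iff split: if_splits)
      define P' where "P' = {p + xi j * q | p q. p \<in> P}"
      have sub: "P \<subseteq> P'"
      proof
        fix p assume "p \<in> P"
        moreover have "p = p + xi j * 0" by simp
        ultimately show "p \<in> P'" unfolding P'_def by blast
      qed
      have "ring_ideal P'"
        unfolding ring_ideal_def
      proof (intro conjI ballI allI)
        show "0 \<in> P'" using sub I(1) by blast
        fix x assume "x \<in> P'"
        then obtain p q where x: "x = p + xi j * q" "p \<in> P" by (auto simp: P'_def)
        show "c * x \<in> P'" for c
        proof -
          have "c * x = c * p + xi j * (c * q)" by (simp add: x algebra_simps)
          then show ?thesis unfolding P'_def using I(3)[OF x(2)] by blast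
        qed
        fix y assume "y \<in> P'"
        then obtain p' q' where y: "y = p' + xi j * q'" "p' \<in> P" by (auto simp: P'_def)
        have "x + y = (p + p') + xi j * (q + q')" by (simp add: x y algebra_simps)
        then show "x + y \<in> P'" unfolding P'_def using I(2)[OF x(2) y(2)] by blast
      qed
      moreover have "xi j \<in> P'"
      proof -
        have "xi j = 0 + xi j * 1" by simp
        then show ?thesis unfolding P'_def using I(1) by blast
      qed
      moreover have "mon u 1 \<notin> P'" if u: "supp u \<subseteq> G" for u
      proof
        assume "mon u 1 \<in> P'"
        then obtain p q where pq: "mon u 1 = p + xi j * q" "p \<in> P" by (auto simp: P'_def)
        have sum_mon: "(\<Sum>_<n. mon j 1) = mon j n" for n :: nat
          by (rule poly_mapping_eqI) (simp add: lookup_sum lookup_single when_def)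
        have xin: "xi j ^ n = mon (mon j n) (1 :: 'k)"
          unfolding xi_def mon_power sum_mon ..
        have "mon t 1 * (mon u 1 - p) ^ n = mon u0 1 * q ^ n"
          by (simp add: pq(1) power_mult_distrib xin u0 mult_single mult.assoc[symmetric] add.commute)
        also have "\<dots> \<in> P" using 3(3) I(4) by blast
        finally have "mon t 1 * (mon u 1 ^ n - (mon u 1 - p) ^ n) + mon t 1 * (mon u 1 - p) ^ n \<in> P"
          using I(2)[OF I(3)[OF power_diff_in_ideal[OF PG(1) pq(2)]]] by blast
        then have "mon (t + (\<Sum>_<n. u)) 1 \<in> P"
          by (simp add: algebra_simps mon_power mult_single)
        moreover have "supp (t + (\<Sum>_<n. u)) \<subseteq> G"
          using t u supp_sum_subset[of "{..<n}" "\<lambda>_. u" G] by (simp add: supp_add_nat)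
        ultimately show False using PG(6) by blast
      qed
      ultimately show ?thesis
        using PG sub by (intro exI[of _ P'] exI[of _ G]) blast
    qed
  qed
  from this[of UNIV] obtain P G where "ring_ideal P" "J \<subseteq> P" "k \<in> G" "\<forall>j\<in>UNIV - G. xi j \<in> P"
    "\<forall>u. supp u \<subseteq> G \<longrightarrow> mon u 1 \<notin> P" by auto
  then show ?thesis by (intro exI[of _ P] exI[of _ G]) auto
qed

text \<open>
  A subspace of dimension \<open>d\<close> embeds into \<open>d\<close> of the coordinates. Together with \<open>card_box_le\<close> this bounds the
  number of lattice points of bounded size on it.
\<close>

lemma coordinates_separating_subspace:
  fixes U :: "(real ^ 'r) set"
  assumes "subspace U"
  shows "\<exists>I. card I \<le> dim U \<and> (\<forall>x\<in>U. (\<forall>i\<in>I. x $ i = 0) \<longrightarrow> x = 0)"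
  using assms
proof (induction "dim U" arbitrary: U rule: less_induct)
  case less
  show ?case
  proof (cases "U \<subseteq> {0}")
    case True
    then show ?thesis by (intro exI[of _ "{}"]) auto
  next
    case False
    then obtain x where x: "x \<in> U" "x \<noteq> 0" by blast
    then obtain i where i: "x $ i \<noteq> 0" by (auto simp: vec_eq_iff)
    define U' where "U' = U \<inter> {y. y $ i = 0}"
    have sU': "subspace U'"
      using less.prems unfolding U'_def by (intro subspace_inter) (auto simp: subspace_def)
    have "U' \<subset> U" using x i by (auto simp: U'_def)
    then have lt: "dim U' < dim U"
      using sU' less.prems by (intro dim_psubset) (simp add: span_eq_iff[THEN iffD2])
    obtain I where I: "card I \<le> dim U'" "\<forall>y\<in>U'. (\<forall>i\<in>I. y $ i = 0) \<longrightarrow> y = 0"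
      using less.hyps[OF lt sU'] by blast
    have "card (insert i I) \<le> dim U" using I(1) lt card_insert_le_m1[of "dim U" I i] by simp
    moreover have "\<forall>y\<in>U. (\<forall>i\<in>insert i I. y $ i = 0) \<longrightarrow> y = 0" using I(2) by (auto simp: U'_def)
    ultimately show ?thesis by blast
  qed
qed

lemma card_box_le:
  fixes Q :: "'x set" and c :: "'x \<Rightarrow> 'i \<Rightarrow> 'v"
  assumes "finite I" "finite V" "\<And>x y. x \<in> Q \<Longrightarrow> y \<in> Q \<Longrightarrow> (\<And>i. i \<in> I \<Longrightarrow> c x i = c y i) \<Longrightarrow> x = y"
    "\<And>x i. x \<in> Q \<Longrightarrow> i \<in> I \<Longrightarrow> c x i \<in> V"
  shows "card Q \<le> card V ^ card I"
proof -
  have "card Q \<le> card (Pi\<^sub>E I (\<lambda>_. V))"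
  proof (rule card_inj_on_le)
    show "inj_on (\<lambda>x. restrict (c x) I) Q"
    proof (rule inj_onI)
      fix x y assume "x \<in> Q" "y \<in> Q" "restrict (c x) I = restrict (c y) I"
      then show "x = y" using assms(3)[of x y] by (metis restrict_apply')
    qed
    show "(\<lambda>x. restrict (c x) I) ` Q \<subseteq> Pi\<^sub>E I (\<lambda>_. V)" using assms(4) by auto
    show "finite (Pi\<^sub>E I (\<lambda>_. V))" using assms(1,2) by (auto intro: finite_PiE)
  qed
  then show ?thesis by (simp add: card_PiE assms(1))
qed

definition exponent :: "('n::finite \<Rightarrow> nat) \<Rightarrow> ('n \<Rightarrow>\<^sub>0 nat)" where
  "exponent e = (\<Sum>j\<in>UNIV. mon j (e j))"

lemma coef_exponent: "coef (exponent e) j = e j"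
  by (simp add: exponent_def lookup_sum lookup_single when_def)

text \<open>
  The monomials of degree \<open>d\<close> in the variables from \<open>G\<close>. Up to constants there are \<open>d\<^bsup>|G| - 1\<^esup>\<close> of them; the
  estimates below are crude but have this order of growth.
\<close>

definition exponents_in :: "'n::finite set \<Rightarrow> nat \<Rightarrow> ('n \<Rightarrow>\<^sub>0 nat) set" where
  "exponents_in G d = {m. supp m \<subseteq> G \<and> total_degree m = d}"

lemma coef_le_total_degree: "coef u j \<le> total_degree u"
  unfolding total_degree_def by (rule member_le_sum) auto

lemma exponents_in_eqI:
  assumes "x \<in> exponents_in G d" "y \<in> exponents_in G d" "\<And>i. i \<in> G - {j} \<Longrightarrow> coef x i = coef y i"
  shows "x = y"
proof (rule poly_mapping_eqI)
  have eq: "coef x i = coef y i" if "i \<noteq> j" for i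
  proof (cases "i \<in> G")
    case True
    with that show ?thesis by (intro assms(3)) simp
  next
    case False
    then have "i \<notin> supp x" "i \<notin> supp y" using assms(1,2) by (auto simp: exponents_in_def)
    then show ?thesis by (simp add: in_keys_iff)
  qed
  have "total_degree w = coef w j + (\<Sum>i\<in>UNIV - {j}. coef w i)" for w
    unfolding total_degree_def by (rule sum.remove) auto
  moreover have "(\<Sum>i\<in>UNIV - {j}. coef x i) = (\<Sum>i\<in>UNIV - {j}. coef y i)" using eq by (intro sum.cong) auto
  ultimately have "coef x j = coef y j" using assms(1,2) by (simp add: exponents_in_def)
  then show "coef x i = coef y i" for i using eq by (cases "i = j") auto
qed

lemma card_exponents_in_le:
  assumes "j \<in> G"
  shows "card (exponents_in G d) \<le> (d + 1) ^ (card G - 1)"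
proof -
  have "card (exponents_in G d) \<le> card {..d} ^ card (G - {j})"
  proof (rule card_box_le)
    show "x = y" if "x \<in> exponents_in G d" "y \<in> exponents_in G d" "\<And>i. i \<in> G - {j} \<Longrightarrow> coef x i = coef y i" for x y
      using exponents_in_eqI[OF that] .
    show "coef x i \<in> {..d}" if "x \<in> exponents_in G d" for x i
      using that coef_le_total_degree[of x i] by (simp add: exponents_in_def)
  qed auto
  then show ?thesis using assms by (simp add: card_Diff_singleton flip: Suc_eq_plus1)
qed

lemma finite_exponents_in: "finite (exponents_in G d)"
proof (rule finite_subset)
  show "exponents_in G d \<subseteq> exponent ` (Pi\<^sub>E UNIV (\<lambda>_. {..d}))"
  proof
    fix x assume "x \<in> exponents_in G d"
    then have "coef x \<in> Pi\<^sub>E UNIV (\<lambda>_. {..d})" using coef_le_total_degree[of x] by (auto simp: exponents_in_def)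
    moreover have "x = exponent (coef x)" by (rule poly_mapping_eqI) (simp add: coef_exponent)
    ultimately show "x \<in> exponent ` (Pi\<^sub>E UNIV (\<lambda>_. {..d}))" by blast
  qed
qed (auto intro!: finite_PiE)

text \<open>
  The exponents off \<open>k\<close> range freely over \<open>{..M}\<close>, and the exponent of \<open>k\<close> makes up for the rest of the degree.
\<close>

lemma card_exponents_in_ge:
  assumes "k \<in> G"
  shows "(M + 1) ^ (card G - 1) \<le> card (exponents_in G (card G * M))"
proof -
  define F where "F f = exponent (\<lambda>j. if j = k then card G * M - (\<Sum>i\<in>G - {k}. f i) else if j \<in> G then f j else 0)" for f :: "'a \<Rightarrow> nat"
  have finG: "finite G" by simp
  have "card (Pi\<^sub>E (G - {k}) (\<lambda>_. {..M})) \<le> card (exponents_in G (card G * M))"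
  proof (rule card_inj_on_le)
    show "finite (exponents_in G (card G * M))" by (rule finite_exponents_in)
    show "inj_on F (Pi\<^sub>E (G - {k}) (\<lambda>_. {..M}))"
    proof (rule inj_onI)
      fix f g assume fg: "f \<in> Pi\<^sub>E (G - {k}) (\<lambda>_. {..M})" "g \<in> Pi\<^sub>E (G - {k}) (\<lambda>_. {..M})" "F f = F g"
      have "f j = g j" if "j \<in> G - {k}" for j
        using arg_cong[OF fg(3), of "\<lambda>x. coef x j"] that by (simp add: F_def coef_exponent)
      then show "f = g" using fg(1,2) by (auto intro: PiE_ext)
    qed
    show "F ` Pi\<^sub>E (G - {k}) (\<lambda>_. {..M}) \<subseteq> exponents_in G (card G * M)"
    proof
      fix x assume "x \<in> F ` Pi\<^sub>E (G - {k}) (\<lambda>_. {..M})"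
      then obtain f where f: "x = F f" "f \<in> Pi\<^sub>E (G - {k}) (\<lambda>_. {..M})" by blast
      have "(\<Sum>i\<in>G - {k}. f i) \<le> (\<Sum>i\<in>G - {k}. M)" using f(2) by (intro sum_mono) auto
      also have "\<dots> \<le> card G * M" using finG by (simp add: card_mono)
      finally have le: "(\<Sum>i\<in>G - {k}. f i) \<le> card G * M" .
      have "total_degree x = (\<Sum>j\<in>G. coef x j)"
        unfolding total_degree_def f(1) F_def using assms by (intro sum.mono_neutral_right) (auto simp: coef_exponent)
      also have "\<dots> = coef x k + (\<Sum>j\<in>G - {k}. coef x j)" using assms finG by (rule sum.remove[rotated])
      also have "(\<Sum>j\<in>G - {k}. coef x j) = (\<Sum>j\<in>G - {k}. f j)"
        by (intro sum.cong) (auto simp: f(1) F_def coef_exponent)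
      finally have "total_degree x = card G * M" using le by (simp add: f(1) F_def coef_exponent)
      moreover have "supp x \<subseteq> G" using assms by (auto simp: f(1) F_def in_keys_iff coef_exponent split: if_splits)
      ultimately show "x \<in> exponents_in G (card G * M)" by (simp add: exponents_in_def)
    qed
  qed
  then show ?thesis using assms finG by (simp add: card_PiE card_Diff_singleton flip: Suc_eq_plus1)
qed

text \<open>
  The monomial \<open>v\<^sup>u\<close> as an element of \<open>K\<close>. The twisted monomial is \<open>y\<^sup>u\<close> for \<open>y\<^sub>j = v\<^sub>j \<xi>\<^sub>j\<close>. In these variables
  the Euler forms have constant coefficients.
\<close>

definition power_product :: "('n::linorder \<Rightarrow>\<^sub>0 nat) \<Rightarrow> 'n ratfun" where
  "power_product u = Fract (mon u 1) 1"

definition twisted_monomial :: "('n::linorder \<Rightarrow>\<^sub>0 nat) \<Rightarrow> (('n \<Rightarrow>\<^sub>0 nat) \<Rightarrow>\<^sub>0 'n ratfun)" where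
  "twisted_monomial u = mon u (power_product u)"

lemma power_product_add: "power_product (u + w) = power_product u * power_product w"
  by (simp add: power_product_def mult_single)

lemma twisted_monomial_add: "twisted_monomial (u + w) = twisted_monomial u * twisted_monomial w"
  by (simp add: twisted_monomial_def power_product_add mult_single)

lemma power_products_independent:
  assumes "finite A" "(\<Sum>m\<in>A. ratfun_const (c m) * power_product m) = 0" "m \<in> A"
  shows "c m = 0"
proof -
  have "(\<Sum>m\<in>A. ratfun_const (c m) * power_product m) = Fract (\<Sum>m\<in>A. mon m (c m)) 1"
    by (simp add: ratfun_const_def power_product_def mult_single addhom_sum[OF addhomI[of "\<lambda>g. Fract g 1"]])
  then have "(\<Sum>m\<in>A. mon m (c m)) = 0" using assms(2) by (simp add: Zero_fract_def eq_fract)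
  then have "coef (\<Sum>m\<in>A. mon m (c m)) m = 0" by simp
  then show ?thesis using assms(1,3) by (simp add: lookup_sum lookup_single when_def)
qed

lemma linear_functional_coordinates:
  fixes g :: "real ^ 'r \<Rightarrow> real"
  assumes "linear g"
  shows "g x = (\<Sum>i\<in>UNIV. x $ i * g (axis i 1))"
proof -
  have "g x = g (\<Sum>i\<in>UNIV. x $ i *\<^sub>R axis i 1)"
    using basis_expansion[of x] by (simp add: scalar_mult_eq_scaleR)
  then show ?thesis by (simp add: linear_sum[OF assms] linear_scale[OF assms])
qed

text \<open>
  If \<open>y\<^sub>j\<close>, \<open>j \<in> G - D\<close>, are combinations of the \<open>y\<^sub>i\<close>, \<open>i \<in> D\<close>, with complex coefficients modulo \<open>P\<close>, then
  the monomials \<open>y\<^sup>m\<close> of degree \<open>d\<close> on \<open>G\<close> are combinations of those on \<open>D\<close>. That the coefficients are complex is essential for the count.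
\<close>

lemma twisted_reduction:
  fixes P :: "(('n::{finite,linorder} \<Rightarrow>\<^sub>0 nat) \<Rightarrow>\<^sub>0 'n ratfun) set"
  assumes P: "ring_ideal P"
    and rel: "\<And>j. j \<in> G - D \<Longrightarrow>
      twisted_monomial (mon j 1) + (\<Sum>i\<in>D. cst (ratfun_const (q j i)) * twisted_monomial (mon i 1)) \<in> P"
    and m: "m \<in> exponents_in G d"
  shows "\<exists>c. twisted_monomial m - (\<Sum>e\<in>exponents_in D d. cst (ratfun_const (c e)) * twisted_monomial e) \<in> P"
proof -
  note I = ring_idealD[OF P]
  define Q where "Q d p \<longleftrightarrow> (\<exists>c. p - (\<Sum>e\<in>exponents_in D d. cst (ratfun_const (c e)) * twisted_monomial e) \<in> P)" for d p
  have Qadd: "Q d (p + p')" if "Q d p" "Q d p'" for d p p'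
  proof -
    obtain c c' where c: "p - (\<Sum>e\<in>exponents_in D d. cst (ratfun_const (c e)) * twisted_monomial e) \<in> P"
      "p' - (\<Sum>e\<in>exponents_in D d. cst (ratfun_const (c' e)) * twisted_monomial e) \<in> P"
      using \<open>Q d p\<close> \<open>Q d p'\<close> unfolding Q_def by blast
    have "p + p' - (\<Sum>e\<in>exponents_in D d. cst (ratfun_const (c e + c' e)) * twisted_monomial e) =
      (p - (\<Sum>e\<in>exponents_in D d. cst (ratfun_const (c e)) * twisted_monomial e)) +
      (p' - (\<Sum>e\<in>exponents_in D d. cst (ratfun_const (c' e)) * twisted_monomial e))"
      by (simp add: ratfun_const_add single_add distrib_right sum.distrib)
    also have "\<dots> \<in> P" using I(2)[OF c] .
    finally show ?thesis unfolding Q_def by (rule exI[of _ "\<lambda>e. c e + c' e"])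
  qed
  have Qmult: "Q d (cst (ratfun_const b) * p)" if "Q d p" for d p b
  proof -
    obtain c where c: "p - (\<Sum>e\<in>exponents_in D d. cst (ratfun_const (c e)) * twisted_monomial e) \<in> P"
      using \<open>Q d p\<close> unfolding Q_def by blast
    have "cst (ratfun_const b) * p - (\<Sum>e\<in>exponents_in D d. cst (ratfun_const (b * c e)) * twisted_monomial e) =
      cst (ratfun_const b) * (p - (\<Sum>e\<in>exponents_in D d. cst (ratfun_const (c e)) * twisted_monomial e))"
      by (simp add: ratfun_const_mult right_diff_distrib sum_distrib_left mult.assoc[symmetric] mult_single)
    also have "\<dots> \<in> P" using I(3)[OF c] .
    finally show ?thesis unfolding Q_def by (rule exI[of _ "\<lambda>e. b * c e"])
  qed
  have Q0: "Q d p" if "p \<in> P" for d p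
    unfolding Q_def using that by (intro exI[of _ "\<lambda>_. 0"]) (simp add: ratfun_const_0)
  have Qsum: "Q d (sum f A)" if "\<And>x. x \<in> A \<Longrightarrow> Q d (f x)" for d f and A :: "'x set"
    using that by (induction A rule: infinite_finite_induct) (auto intro: Qadd Q0 I(1))
  have Qbase: "Q d (twisted_monomial e)" if "e \<in> exponents_in D d" for d e
  proof -
    have "(\<Sum>x\<in>exponents_in D d. cst (ratfun_const (if x = e then 1 else 0)) * twisted_monomial x) =
        (\<Sum>x\<in>exponents_in D d. if x = e then twisted_monomial e else 0)"
      by (intro sum.cong refl) (simp add: ratfun_const_1 ratfun_const_0)
    also have "\<dots> = twisted_monomial e" using that by (simp add: finite_exponents_in)
    finally show ?thesis unfolding Q_def using I(1) by (intro exI[of _ "\<lambda>x. if x = e then 1 else 0"]) simp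
  qed
  have Qcong: "Q d p'" if "Q d p" "p' - p \<in> P" for d p p'
    using Qadd[OF that(1) Q0[OF that(2)]] by simp
  have "Q d (twisted_monomial m)" using m
  proof (induction d arbitrary: m)
    case 0
    then have "m = 0" by (simp add: exponents_in_def total_degree_0)
    moreover have "0 \<in> exponents_in D 0" by (simp add: exponents_in_def)
    ultimately show ?case using Qbase by blast
  next
    case (Suc d)
    then have "m \<noteq> 0" by (auto simp: exponents_in_def)
    then obtain j where j: "coef m j \<noteq> 0" using nonzero_coef by blast
    then have jG: "j \<in> G" using Suc.prems by (auto simp: exponents_in_def in_keys_iff)
    define m' where "m' = m - mon j 1"
    have mm': "m = mon j 1 + m'"
      using j by (intro poly_mapping_eqI) (auto simp: m'_def lookup_add lookup_minus lookup_single when_def)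
    have "m' \<in> exponents_in G d"
      using Suc.prems unfolding mm' by (simp add: exponents_in_def supp_add_nat total_degree_add total_degree_single)
    then obtain c where c: "twisted_monomial m' - (\<Sum>e\<in>exponents_in D d. cst (ratfun_const (c e)) * twisted_monomial e) \<in> P"
      using Suc.IH unfolding Q_def by blast
    have step: "Q (Suc d) (twisted_monomial (mon j 1) * twisted_monomial e)" if e: "e \<in> exponents_in D d" for e
    proof -
      have up: "mon i 1 + e \<in> exponents_in D (Suc d)" if "i \<in> D" for i
        using that e by (auto simp: exponents_in_def supp_add_nat total_degree_add total_degree_single)
      show ?thesis
      proof (cases "j \<in> D")
        case True
        then show ?thesis using Qbase[OF up[OF True]] by (simp add: twisted_monomial_add)
      next
        case False
        let ?s = "\<Sum>i\<in>D. cst (ratfun_const (q j i)) * twisted_monomial (mon i 1)"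
        have "Q (Suc d) (\<Sum>i\<in>D. cst (ratfun_const (- q j i)) * twisted_monomial (mon i 1 + e))"
          by (intro Qsum Qmult Qbase up)
        moreover have "(\<Sum>i\<in>D. cst (ratfun_const (- q j i)) * twisted_monomial (mon i 1 + e)) = - (?s * twisted_monomial e)"
          by (simp add: twisted_monomial_add sum_distrib_right mult.assoc addhom_minus[OF addhom_ratfun_const]
            single_uminus sum_negf)
        moreover have "(twisted_monomial (mon j 1) + ?s) * twisted_monomial e \<in> P"
          using rel[of j] jG False I(4) by blast
        moreover have "twisted_monomial (mon j 1) * twisted_monomial e - - (?s * twisted_monomial e) =
            (twisted_monomial (mon j 1) + ?s) * twisted_monomial e" by (simp add: distrib_right)
        ultimately show ?thesis
          using Qcong[of "Suc d" "- (?s * twisted_monomial e)" "twisted_monomial (mon j 1) * twisted_monomial e"] by simp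
      qed
    qed
    have "Q (Suc d) (\<Sum>e\<in>exponents_in D d. cst (ratfun_const (c e)) * (twisted_monomial (mon j 1) * twisted_monomial e))"
      by (intro Qsum Qmult step)
    moreover have "twisted_monomial m - (\<Sum>e\<in>exponents_in D d. cst (ratfun_const (c e)) * (twisted_monomial (mon j 1) * twisted_monomial e)) =
       twisted_monomial (mon j 1) * (twisted_monomial m' - (\<Sum>e\<in>exponents_in D d. cst (ratfun_const (c e)) * twisted_monomial e))"
      by (simp add: mm' twisted_monomial_add right_diff_distrib sum_distrib_left mult.left_commute)
    ultimately show ?case
      using Qcong[OF _ ssubst[of _ _ "\<lambda>x. x \<in> P", OF _ I(3)[OF c, of "twisted_monomial (mon j 1)"]]] by blast
  qed
  then show ?thesis by (simp add: Q_def)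
qed


text \<open>
  The left side grows like \<open>M\<^bsup>\<delta> + r1\<^esup>\<close>, one power less than the right side.
\<close>

lemma counting_inequality:
  fixes c \<delta> r1 K :: nat
  assumes "K > 0"
  shows "\<exists>M. (c * M + 1) ^ \<delta> * (K * (c * M) + 1) ^ r1 < (M + 1) ^ (\<delta> + r1 + 1)"
proof -
  define L where "L = K * c + 2"
  define M where "M = L ^ (\<delta> + r1)"
  have le: "c * M \<le> K * (c * M)" using assms by simp
  have 2: "K * (c * M) + 1 \<le> L * (M + 1)" by (simp add: L_def algebra_simps)
  with le have 1: "c * M + 1 \<le> L * (M + 1)" by linarith
  have "(c * M + 1) ^ \<delta> * (K * (c * M) + 1) ^ r1 \<le> (L * (M + 1)) ^ \<delta> * (L * (M + 1)) ^ r1"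
    by (intro mult_mono power_mono 1 2) auto
  also have "\<dots> = M * (M + 1) ^ (\<delta> + r1)" by (simp add: M_def power_add power_mult_distrib mult_ac)
  also have "\<dots> < (M + 1) * (M + 1) ^ (\<delta> + r1)" by simp
  also have "\<dots> = (M + 1) ^ (\<delta> + r1 + 1)" by (simp add: power_add)
  finally show ?thesis by blast
qed

lemma linear_combination_of_euler_forms:
  fixes a :: "'n::{finite,linorder} \<Rightarrow> int ^ 'r" and g :: "real ^ 'r \<Rightarrow> real"
  assumes "linear g"
  shows "(\<Sum>j\<in>UNIV. cst (ratfun_const (complex_of_real (g (real_point (a j))))) * twisted_monomial (mon j 1)) =
    (\<Sum>i\<in>UNIV. cst (ratfun_const (complex_of_real (g (axis i 1)))) * euler_form a ratfun_var i)"
proof -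
  have pp: "power_product (mon j 1) = ratfun_var j" for j :: 'n
    by (simp add: power_product_def ratfun_var_def poly_var_def)
  have g: "ratfun_const (complex_of_real (g (real_point (a j)))) =
      (\<Sum>i\<in>UNIV. of_int (a j $ i) * (ratfun_const (complex_of_real (g (axis i 1))) :: 'n ratfun))" for j
    by (subst linear_functional_coordinates[OF assms])
       (simp add: real_point_def addhom_sum[OF addhom_ratfun_const] ratfun_const_mult ratfun_const_of_int)
  show ?thesis
    by (simp only: euler_form_def twisted_monomial_def pp cst_mon g sum_distrib_left sum_distrib_right addhom_sum[OF addhom_mon])
       (subst sum.swap, simp add: mult_ac)
qed

lemma point_sum_bound:
  assumes "\<And>j i. \<bar>a j $ i\<bar> \<le> int C"
  shows "\<bar>point_sum a m $ i\<bar> \<le> int (C * total_degree m)"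
proof -
  have 1: "\<bar>\<Sum>j\<in>UNIV. int (coef m j) * a j $ i\<bar> \<le> (\<Sum>j\<in>UNIV. \<bar>int (coef m j) * a j $ i\<bar>)"
    by (rule sum_abs)
  have 2: "(\<Sum>j\<in>UNIV. \<bar>int (coef m j) * a j $ i\<bar>) \<le> (\<Sum>j\<in>UNIV. int (coef m j) * int C)"
    by (intro sum_mono) (simp add: abs_mult mult_left_mono assms)
  from order_trans[OF 1 2] show ?thesis
    by (simp add: point_sum_def total_degree_def sum_distrib_left mult.commute)
qed

lemma real_point_point_sum: "real_point (point_sum a m) = (\<Sum>j\<in>UNIV. real (coef m j) *\<^sub>R real_point (a j))"
  by (simp add: real_point_def point_sum_def vec_eq_iff)

text \<open>
  The exponent is one less than the dimension of the span, because sums of \<open>d\<close> points lie on the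
  hyperplane \<open>h = d\<close>.
\<close>

lemma (in homogeneous_points) card_point_sums_le:
  assumes "k \<in> G"
  shows "\<exists>C. \<forall>d. card (point_sum a ` exponents_in G d) \<le> (2 * C * d + 1) ^ (dim (span ((\<lambda>j. real_point (a j)) ` G)) - 1)"
proof -
  obtain h :: "real ^ 'r \<Rightarrow> real" where h: "linear h" "\<And>j. h (real_point (a j)) = 1"
    using on_hyperplane by auto
  define W where "W = span ((\<lambda>j. real_point (a j)) ` G)"
  define U where "U = W \<inter> {x. h x = 0}"
  have sW: "subspace W" by (simp add: W_def)
  have sU: "subspace U"
    unfolding U_def using sW h(1)
    by (intro subspace_inter) (auto simp: subspace_def linear_0 linear_add linear_scale)
  have kW: "real_point (a k) \<in> W" unfolding W_def using assms by (intro span_base) auto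
  have "real_point (a k) \<notin> U" by (simp add: U_def h(2))
  then have "U \<subset> W" using kW unfolding U_def by blast
  then have lt: "dim U < dim W" using sU sW by (intro dim_psubset) (simp add: span_eq_iff[THEN iffD2])
  obtain I where I: "card I \<le> dim U" "\<And>x. x \<in> U \<Longrightarrow> (\<And>i. i \<in> I \<Longrightarrow> x $ i = 0) \<Longrightarrow> x = 0"
    using coordinates_separating_subspace[OF sU] by blast
  define C where "C = nat (Max ((\<lambda>(j, i). \<bar>a j $ i\<bar>) ` UNIV))"
  have C: "\<bar>a j $ i\<bar> \<le> int C" for j i
  proof -
    have "\<bar>a j $ i\<bar> \<le> Max ((\<lambda>(j, i). \<bar>a j $ i\<bar>) ` UNIV)"
      by (rule Max_ge) (auto intro!: image_eqI[of _ _ "(j, i)"])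
    then show ?thesis by (simp add: C_def)
  qed
  have "card (point_sum a ` exponents_in G d) \<le> (2 * C * d + 1) ^ (dim W - 1)" for d
  proof -
    have "card (point_sum a ` exponents_in G d) \<le> card {- int (C * d)..int (C * d)} ^ card I"
    proof (rule card_box_le)
      show "finite I" by simp
      fix z assume "z \<in> point_sum a ` exponents_in G d"
      then obtain m where m: "z = point_sum a m" "total_degree m = d" "supp m \<subseteq> G" by (auto simp: exponents_in_def)
      show "z $ i \<in> {- int (C * d)..int (C * d)}" for i
        using point_sum_bound[of a C m i] C m(1,2) by (simp add: abs_le_iff)
      have inW: "real_point (point_sum a m) \<in> W" if "supp m \<subseteq> G" for m
        unfolding real_point_point_sum
      proof (intro subspace_sum[OF sW])
        fix j
        show "real (coef m j) *\<^sub>R real_point (a j) \<in> W"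
        proof (cases "j \<in> G")
          case True
          then show ?thesis unfolding W_def by (intro span_scale span_base) auto
        next
          case False
          then have "coef m j = 0" using that by (auto simp: in_keys_iff)
          then show ?thesis using subspace_0[OF sW] by simp
        qed
      qed
      fix z' assume "z' \<in> point_sum a ` exponents_in G d" and eq: "\<And>i. i \<in> I \<Longrightarrow> z $ i = z' $ i"
      then obtain m' where m': "z' = point_sum a m'" "total_degree m' = d" "supp m' \<subseteq> G" by (auto simp: exponents_in_def)
      have "real_point z - real_point z' \<in> U"
        unfolding U_def m(1) m'(1) using inW m(2,3) m'(2,3) sW
        by (auto simp: subspace_diff linear_diff[OF h(1)] height_of_point_sum[OF h])
      moreover have "(real_point z - real_point z') $ i = 0" if "i \<in> I" for i
        using eq[OF that] by (simp add: real_point_def)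
      ultimately have "real_point z - real_point z' = 0" by (rule I(2))
      then show "z = z'" by (simp add: real_point_def vec_eq_iff)
    qed simp
    also have "card {- int (C * d)..int (C * d)} = 2 * C * d + 1"
    proof -
      have "card {- int (C * d)..int (C * d)} = nat (int (C * d) - - int (C * d) + 1)" by (rule card_atLeastAtMost_int)
      also have "\<dots> = 2 * (C * d) + 1" by arith
      finally show ?thesis by (simp only: mult.assoc)
    qed
    also have "(2 * C * d + 1) ^ card I \<le> (2 * C * d + 1) ^ (dim W - 1)"
      using I(1) lt by (intro power_increasing) auto
    finally show ?thesis .
  qed
  then show ?thesis unfolding W_def by blast
qed

lemma toric_kernel_binomial: "point_sum a u = point_sum a w \<Longrightarrow> mon u c - mon w c \<in> toric_kernel a"
  by (simp add: toric_kernel_def addhom_diff[OF addhom_toric_map] toric_map_single)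

text \<open>
  Suppose not, and take \<open>P \<supseteq> J\<close> and \<open>G\<close> as in \<open>ideal_avoiding_monomials\<close>. Choose \<open>T \<subseteq> G\<close> indexing a basis
  of the span of the points of \<open>G\<close>, and put \<open>D = G - T\<close>. The Euler forms express each \<open>y\<^sub>j\<close>, \<open>j \<in> T\<close>, through the
  \<open>y\<^sub>i\<close>, \<open>i \<in> D\<close>, modulo \<open>P\<close>. On the other hand \<open>\<xi>\<^sup>m\<close> depends only on the point \<open>\<Sum> m\<^sub>j a\<^sub>j\<close> modulo \<open>P\<close>. Let
  \<open>b\<^sub>0\<close> be a large exponent. Then the elements \<open>v\<^sup>m \<xi>\<^bsup>b\<^sub>0\<^esup> = \<xi>\<^bsup>b\<^sub>0 - m\<^esup> y\<^sup>m\<close> for \<open>m\<close> of degree \<open>d\<close> on \<open>G\<close> lie modulo \<open>P\<close> in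
  a complex vector space with one generator for each pair of a point \<open>\<Sum> m\<^sub>j a\<^sub>j\<close> and a monomial of degree
  \<open>d\<close> on \<open>D\<close>. Of the former there are \<open>O(d\<^bsup>|T| - 1\<^esup>)\<close>, of the latter \<open>O(d\<^bsup>|D| - 1\<^esup>)\<close>, but there are about
  \<open>d\<^bsup>|G| - 1\<^esup>\<close> exponents \<open>m\<close>. For large \<open>d\<close> a nontrivial complex combination \<open>s\<close> of the \<open>v\<^sup>m\<close> therefore satisfies
  \<open>s \<xi>\<^bsup>b\<^sub>0\<^esup> \<in> P\<close>. As \<open>s\<close> is a unit of \<open>K\<close>, this contradicts the choice of \<open>P\<close>.
\<close>

lemma (in homogeneous_points) power_of_xi_in_toric_euler_ideal:
  "\<exists>n. mon (mon k n) 1 \<in> toric_euler_ideal a ratfun_var"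
proof (rule ccontr)
  let ?J = "toric_euler_ideal a ratfun_var"
  assume "\<not> ?thesis"
  then have nn: "mon (mon k n) 1 \<notin> ?J" for n by blast
  from ideal_avoiding_monomials[OF ring_ideal_toric_euler_ideal nn]
  obtain P G where P: "ring_ideal P" and JP: "?J \<subseteq> P" and kG: "k \<in> G"
    and outside: "\<And>j. j \<notin> G \<Longrightarrow> xi j \<in> P" and inside: "\<And>u. supp u \<subseteq> G \<Longrightarrow> mon u 1 \<notin> P"
    by (elim exE conjE) auto
  note I = ring_idealD[OF P]
  have TP: "t \<in> P" if "t \<in> toric_kernel a" for t
    using JP toric_euler_idealI[OF that, where q = "\<lambda>_. 0"] by fastforce
  have EP: "euler_form a ratfun_var i \<in> P" for i
  proof -
    have "(\<Sum>l\<in>UNIV. (if l = i then 1 else 0) * euler_form a ratfun_var l) = (\<Sum>l\<in>UNIV. if l = i then euler_form a ratfun_var i else 0)"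
      by (intro sum.cong) auto
    then have "euler_form a ratfun_var i \<in> ?J"
      by (intro toric_euler_idealI[OF ring_idealD(1)[OF ring_ideal_toric_kernel], where q = "\<lambda>l. if l = i then 1 else 0"]) simp
    then show ?thesis using JP by blast
  qed
  let ?p = "\<lambda>j. real_point (a j)"
  obtain B where B: "B \<subseteq> ?p ` G" "independent B" "?p ` G \<subseteq> span B" "card B = dim (?p ` G)"
    using basis_exists by blast
  have finB: "finite B" using B(2) by (rule independent_imp_finite)
  have "\<forall>b\<in>B. \<exists>j\<in>G. ?p j = b" using B(1) by blast
  then obtain f where f: "\<And>b. b \<in> B \<Longrightarrow> f b \<in> G" "\<And>b. b \<in> B \<Longrightarrow> ?p (f b) = b" by metis
  define T where "T = f ` B"
  define D where "D = G - T"
  have TG: "T \<subseteq> G" using f(1) by (auto simp: T_def)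
  have "inj_on f B" using f(2) by (metis inj_onI)
  then have cardT: "card T = card B" by (simp add: T_def card_image)
  have "?p k \<noteq> 0"
  proof
    obtain h :: "real ^ 'r \<Rightarrow> real" where "linear h" "h (?p k) = 1" using on_hyperplane by auto
    moreover assume "?p k = 0"
    ultimately show False by (simp add: linear_0)
  qed
  then have "B \<noteq> {}" using B(3) kG by auto
  then have "card B \<noteq> 0" using finB by simp
  then have cardB: "card B \<ge> 1" by linarith
  have "\<exists>g. linear g \<and> (\<forall>x\<in>B. g x = (if x = b then 1 else 0 :: real))" for b
    using linear_independent_extend[OF B(2), of "\<lambda>x. if x = b then 1 else 0"] by blast
  then obtain g where g: "\<And>b. linear (g b)" "\<And>b x. x \<in> B \<Longrightarrow> g b x = (if x = b then 1 else 0 :: real)" by metis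
  define q where "q j i = complex_of_real (g (?p j) (?p i))" for j i
  let ?y = "\<lambda>j. twisted_monomial (mon j 1)"
  (* Combine the Euler forms with the functional dual to the basis vector a j as coefficients; the other members of T drop
     out, and the variables outside G lie in P. *)
  have rel: "?y j + (\<Sum>i\<in>D. cst (ratfun_const (q j i)) * ?y i) \<in> P" if j: "j \<in> G - D" for j
  proof -
    have jT: "j \<in> T" using j by (auto simp: D_def)
    let ?t = "\<lambda>i. cst (ratfun_const (q j i)) * ?y i"
    have "(\<Sum>i\<in>UNIV. ?t i) \<in> P"
      unfolding q_def linear_combination_of_euler_forms[OF g(1)]
      by (intro ring_ideal_sum[OF P] I(3) EP)
    moreover have "(\<Sum>i\<in>- G. ?t i) \<in> P"
    proof (intro ring_ideal_sum[OF P] I(3))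
      fix i assume "i \<in> - G"
      moreover have "?y i = cst (power_product (mon i 1)) * xi i"
        by (simp add: twisted_monomial_def xi_def cst_mon)
      ultimately show "?y i \<in> P" using outside I(3) by simp
    qed
    ultimately have "(\<Sum>i\<in>UNIV. ?t i) - (\<Sum>i\<in>- G. ?t i) \<in> P" by (rule I(6))
    also have "(\<Sum>i\<in>UNIV. ?t i) = (\<Sum>i\<in>D. ?t i) + (\<Sum>i\<in>T. ?t i) + (\<Sum>i\<in>- G. ?t i)"
    proof -
      have "UNIV = (D \<union> T) \<union> - G" using TG by (auto simp: D_def)
      then have "(\<Sum>i\<in>UNIV. ?t i) = (\<Sum>i\<in>(D \<union> T) \<union> - G. ?t i)" by simp
      also have "\<dots> = (\<Sum>i\<in>D \<union> T. ?t i) + (\<Sum>i\<in>- G. ?t i)" using TG by (intro sum.union_disjoint) (auto simp: D_def)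
      also have "(\<Sum>i\<in>D \<union> T. ?t i) = (\<Sum>i\<in>D. ?t i) + (\<Sum>i\<in>T. ?t i)" by (intro sum.union_disjoint) (auto simp: D_def)
      finally show ?thesis .
    qed
    also have "(\<Sum>i\<in>T. ?t i) = (\<Sum>i\<in>T. if i = j then ?y j else 0)"
    proof (intro sum.cong refl)
      fix i assume iT: "i \<in> T"
      obtain b b' where b: "b \<in> B" "b' \<in> B" "i = f b" "j = f b'" using iT jT by (auto simp: T_def)
      then have "q j i = (if b = b' then 1 else 0)" by (simp add: q_def f(2) g(2))
      moreover have "b = b' \<longleftrightarrow> i = j" using b f(2) by metis
      ultimately show "?t i = (if i = j then ?y j else 0)" by (auto simp: ratfun_const_1 ratfun_const_0)
    qed
    also have "\<dots> = ?y j" using jT by simp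
    finally show ?thesis by (simp add: add.commute)
  qed
  obtain C where C: "\<And>d. card (point_sum a ` exponents_in G d) \<le> (2 * C * d + 1) ^ (card B - 1)"
    using card_point_sums_le[OF kG] by (auto simp: B(4))
  (* For empty D there are no monomials of positive degree on D, and the exponent card D - 1 of the
     general estimate would be truncated. *)
  have "\<exists>d. card (point_sum a ` exponents_in G d) * card (exponents_in D d) < card (exponents_in G d)"
  proof (cases "D = {}")
    case True
    have "exponents_in D (card G * 1) = {}"
      using kG by (auto simp: exponents_in_def True card_eq_0_iff)
    moreover have "0 < card (exponents_in G (card G * 1))"
      using card_exponents_in_ge[OF kG, of 1] by (rule less_le_trans[rotated]) simp
    ultimately show ?thesis by (intro exI[of _ "card G * 1"]) simp
  next
    case False
    then obtain j where j: "j \<in> D" by blast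
    have "card D = card G - card B" using TG by (simp add: D_def card_Diff_subset cardT)
    moreover have "card D \<noteq> 0" using j by auto
    ultimately have cardG: "card G - 1 = (card D - 1) + (card B - 1) + 1" using cardB by linarith
    obtain M where M: "(card G * M + 1) ^ (card D - 1) * ((2 * C + 1) * (card G * M) + 1) ^ (card B - 1) < (M + 1) ^ (card G - 1)"
      using counting_inequality[of "2 * C + 1" "card G" "card D - 1" "card B - 1"] unfolding cardG by auto
    let ?d = "card G * M"
    have "card (point_sum a ` exponents_in G ?d) * card (exponents_in D ?d) \<le>
      ((2 * C + 1) * ?d + 1) ^ (card B - 1) * (?d + 1) ^ (card D - 1)"
    proof (rule mult_mono)
      have "(2 * C * ?d + 1) ^ (card B - 1) \<le> ((2 * C + 1) * ?d + 1) ^ (card B - 1)"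
        by (intro power_mono) (auto simp: algebra_simps)
      then show "card (point_sum a ` exponents_in G ?d) \<le> ((2 * C + 1) * ?d + 1) ^ (card B - 1)"
        using C[of ?d] by (rule le_trans[rotated])
      show "card (exponents_in D ?d) \<le> (?d + 1) ^ (card D - 1)" by (rule card_exponents_in_le[OF j])
    qed auto
    also have "\<dots> < (M + 1) ^ (card G - 1)" using M by (simp only: mult.commute)
    also have "\<dots> \<le> card (exponents_in G ?d)" by (rule card_exponents_in_ge[OF kG])
    finally show ?thesis by blast
  qed
  then obtain d where d: "card (point_sum a ` exponents_in G d) * card (exponents_in D d) < card (exponents_in G d)" by blast
  let ?M = "exponents_in G d" and ?E = "exponents_in D d"
  have "\<forall>m\<in>?M. \<exists>c. twisted_monomial m - (\<Sum>e\<in>?E. cst (ratfun_const (c e)) * twisted_monomial e) \<in> P"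
    using twisted_reduction[OF P rel] by blast
  from bchoice[OF this] obtain c where c: "\<And>m. m \<in> ?M \<Longrightarrow> twisted_monomial m - (\<Sum>e\<in>?E. cst (ratfun_const (c m e)) * twisted_monomial e) \<in> P"
    by blast
  let ?Y = "(point_sum a ` ?M) \<times> ?E"
  define l where "l m y = (if point_sum a m = fst y then c m (snd y) else 0)" for m y
  have fin: "finite ?Y" "finite ?M" by (simp_all add: finite_exponents_in)
  have "card ?Y < card ?M" using d by (simp add: card_cartesian_product)
  from underdetermined_system[OF fin this, of l] obtain b where b: "\<exists>m\<in>?M. b m \<noteq> 0" "\<And>y. y \<in> ?Y \<Longrightarrow> (\<Sum>m\<in>?M. b m * l m y) = 0"
    by blast
  have "\<forall>z\<in>point_sum a ` ?M. \<exists>m\<in>?M. point_sum a m = z" by blast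
  then obtain rep where rep: "\<And>z. z \<in> point_sum a ` ?M \<Longrightarrow> rep z \<in> ?M" "\<And>z. z \<in> point_sum a ` ?M \<Longrightarrow> point_sum a (rep z) = z"
    by metis
  define b0 where "b0 = exponent (\<lambda>j. if j \<in> G then d else 0)"
  have b0: "(b0 - m) + m = b0" if "m \<in> ?M" for m
  proof (rule poly_mapping_eqI)
    fix j
    have "coef m j \<le> (if j \<in> G then d else 0)"
      using that coef_le_total_degree[of m j] by (auto simp: exponents_in_def in_keys_iff subset_iff)
    then show "coef (b0 - m + m) j = coef b0 j" by (simp add: lookup_add lookup_minus b0_def coef_exponent)
  qed
  (* The generators: b0 - m is replaced by b0 - rep z for one representative of each point z. *)
  define w where "w y = mon (b0 - rep (fst y)) 1 * twisted_monomial (snd y)" for y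
  have x: "mon b0 (power_product m) - (\<Sum>y\<in>?Y. cst (ratfun_const (l m y)) * w y) \<in> P" if m: "m \<in> ?M" for m
  proof -
    let ?z = "point_sum a m"
    have z: "?z \<in> point_sum a ` ?M" using m by blast
    have "(\<Sum>y\<in>?Y. cst (ratfun_const (l m y)) * w y) =
      (\<Sum>z\<in>point_sum a ` ?M. \<Sum>e\<in>?E. cst (ratfun_const (l m (z, e))) * w (z, e))"
      by (simp add: sum.cartesian_product)
    also have "\<dots> = (\<Sum>z\<in>point_sum a ` ?M. if z = ?z then \<Sum>e\<in>?E. cst (ratfun_const (c m e)) * w (?z, e) else 0)"
      by (intro sum.cong refl) (auto simp: l_def ratfun_const_0)
    also have "\<dots> = (\<Sum>e\<in>?E. cst (ratfun_const (c m e)) * w (?z, e))"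
      using z by (simp add: finite_exponents_in)
    also have "\<dots> = mon (b0 - rep ?z) 1 * (\<Sum>e\<in>?E. cst (ratfun_const (c m e)) * twisted_monomial e)"
      by (simp add: w_def sum_distrib_left mult.left_commute)
    finally have sum: "(\<Sum>y\<in>?Y. cst (ratfun_const (l m y)) * w y) = mon (b0 - rep ?z) 1 * (\<Sum>e\<in>?E. cst (ratfun_const (c m e)) * twisted_monomial e)" .
    have "mon b0 (power_product m) = mon (b0 - m) 1 * twisted_monomial m"
      using b0[OF m] by (simp add: twisted_monomial_def mult_single)
    then have "mon b0 (power_product m) - (\<Sum>y\<in>?Y. cst (ratfun_const (l m y)) * w y) =
      mon (b0 - rep ?z) 1 * (twisted_monomial m - (\<Sum>e\<in>?E. cst (ratfun_const (c m e)) * twisted_monomial e)) +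
      (mon (b0 - m) 1 - mon (b0 - rep ?z) 1) * twisted_monomial m"
      unfolding sum by (simp add: algebra_simps)
    moreover have "point_sum a (b0 - m) = point_sum a (b0 - rep ?z)"
    proof -
      have "point_sum a (b0 - m) + ?z = point_sum a (b0 - rep ?z) + point_sum a (rep ?z)"
        using b0[OF m] b0[OF rep(1)[OF z]] by (simp flip: point_sum_add)
      then show ?thesis using rep(2)[OF z] by simp
    qed
    ultimately show ?thesis
      using I(2)[OF I(3)[OF c[OF m]] I(4)[OF TP[OF toric_kernel_binomial]]] by simp
  qed
  have "(\<Sum>m\<in>?M. cst (ratfun_const (b m)) * (mon b0 (power_product m) - (\<Sum>y\<in>?Y. cst (ratfun_const (l m y)) * w y))) \<in> P"
    by (intro ring_ideal_sum[OF P] I(3) x)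
  also have "(\<Sum>m\<in>?M. cst (ratfun_const (b m)) * (mon b0 (power_product m) - (\<Sum>y\<in>?Y. cst (ratfun_const (l m y)) * w y))) =
    (\<Sum>m\<in>?M. cst (ratfun_const (b m)) * mon b0 (power_product m)) - (\<Sum>m\<in>?M. \<Sum>y\<in>?Y. cst (ratfun_const (b m * l m y)) * w y)"
    by (simp add: right_diff_distrib sum_subtractf sum_distrib_left mult.assoc[symmetric] mult_single ratfun_const_mult)
  also have "(\<Sum>m\<in>?M. \<Sum>y\<in>?Y. cst (ratfun_const (b m * l m y)) * w y) =
     (\<Sum>y\<in>?Y. cst (ratfun_const (\<Sum>m\<in>?M. b m * l m y)) * w y)"
    by (subst sum.swap) (simp add: addhom_sum[OF addhom_ratfun_const] addhom_sum[OF addhom_mon] sum_distrib_right)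
  also have "\<dots> = 0" using b(2) by (intro sum.neutral) (simp add: ratfun_const_0)
  also have "(\<Sum>m\<in>?M. cst (ratfun_const (b m)) * mon b0 (power_product m)) - 0 =
     mon b0 (\<Sum>m\<in>?M. ratfun_const (b m) * power_product m)"
    by (simp add: cst_mon addhom_sum[OF addhom_mon])
  finally have in_P: "mon b0 (\<Sum>m\<in>?M. ratfun_const (b m) * power_product m) \<in> P" .
  define s where "s = (\<Sum>m\<in>?M. ratfun_const (b m) * power_product m)"
  have "s \<noteq> 0" using power_products_independent[OF finite_exponents_in] b(1) by (auto simp: s_def)
  then have "cst (inverse s) * mon b0 s = mon b0 1" by (simp add: cst_mon)
  then have "mon b0 1 \<in> P" using I(3)[OF in_P, of "cst (inverse s)"] by (simp add: s_def)
  moreover have "supp b0 \<subseteq> G" by (auto simp: b0_def in_keys_iff coef_exponent split: if_splits)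
  ultimately show False using inside by blast
qed

lemma (in homogeneous_points) large_monomials_in_toric_euler_ideal:
  "\<exists>n. \<forall>u. n \<le> total_degree u \<longrightarrow> mon u 1 \<in> toric_euler_ideal a ratfun_var"
proof -
  have "\<forall>k. \<exists>n. mon (mon k n) 1 \<in> toric_euler_ideal a ratfun_var"
    using power_of_xi_in_toric_euler_ideal by blast
  then obtain e where e: "\<And>k. mon (mon k (e k)) 1 \<in> toric_euler_ideal a ratfun_var" by metis
  have "mon u 1 \<in> toric_euler_ideal a ratfun_var" if "(\<Sum>k\<in>UNIV. e k) + 1 \<le> total_degree u" for u
  proof -
    have "\<exists>k. e k \<le> coef u k"
    proof (rule ccontr)
      assume "\<not> ?thesis"
      then have "total_degree u \<le> (\<Sum>k\<in>UNIV. e k)" unfolding total_degree_def by (intro sum_mono) (meson linear)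
      then show False using that by simp
    qed
    then obtain k where "e k \<le> coef u k" by blast
    then have "mon k (e k) + (u - mon k (e k)) = u"
      by (intro poly_mapping_eqI) (auto simp: lookup_add lookup_minus lookup_single when_def)
    then have "mon u 1 = mon (mon k (e k)) 1 * mon (u - mon k (e k)) (1 :: 'n ratfun)" by (simp add: mult_single)
    then show ?thesis using ring_idealD(4)[OF ring_ideal_toric_euler_ideal e] by metis
  qed
  then show ?thesis by blast
qed


section \<open>Differential operators and their symbols\<close>

definition iterated_deriv :: "('n::{finite,linorder} \<Rightarrow>\<^sub>0 nat) \<Rightarrow> 'n ratfun \<Rightarrow> 'n ratfun" where
  "iterated_deriv u = deriv_monomial (coef u)"

lemma poly_deriv_commute: "poly_deriv i (poly_deriv j p) = poly_deriv j (poly_deriv i p)"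
proof (induction p rule: cpoly_induct)
  case (single m c)
  have "m - mon j 1 - mon i 1 = m - mon i 1 - mon j 1"
    by (rule poly_mapping_eqI) (simp add: lookup_minus)
  then show ?case
    by (cases "i = j") (simp_all add: poly_deriv_single lookup_minus lookup_single when_def mult_ac)
qed (simp add: poly_deriv_add)

lemma partial_deriv_commute: "partial_deriv i (partial_deriv j f) = partial_deriv j (partial_deriv i f)"
proof (cases f)
  case (Fract p q)
  have d: "partial_deriv k (partial_deriv l f) * Fract q 1 =
     partial_deriv k (partial_deriv l (f * Fract q 1)) - partial_deriv k f * Fract (poly_deriv l q) 1
     - partial_deriv l f * Fract (poly_deriv k q) 1 - f * Fract (poly_deriv k (poly_deriv l q)) 1" for k l
    by (simp add: partial_deriv_mult partial_deriv_add partial_deriv_Fract_1 algebra_simps)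
  have "f * Fract q 1 = Fract p 1" using Fract by (simp add: eq_fract)
  then have "partial_deriv i (partial_deriv j f) * Fract q 1 = partial_deriv j (partial_deriv i f) * Fract q 1"
    unfolding d by (simp add: partial_deriv_Fract_1 poly_deriv_commute[of i j] algebra_simps)
  moreover have "Fract q 1 \<noteq> 0" using Fract by (simp add: Zero_fract_def eq_fract)
  ultimately show ?thesis by simp
qed

text \<open>
  A variant of \<open>deriv_monomial\<close> over an arbitrary list of variables, to allow induction on the list.
\<close>

definition derivs_along :: "('n::linorder \<Rightarrow> nat) \<Rightarrow> 'n list \<Rightarrow> 'n ratfun \<Rightarrow> 'n ratfun" where
  "derivs_along e js = foldr (\<lambda>k P. (partial_deriv k ^^ e k) \<circ> P) js id"

lemma derivs_along_simps:
  "derivs_along e [] f = f" "derivs_along e (k # js) f = (partial_deriv k ^^ e k) (derivs_along e js f)"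
  by (simp_all add: derivs_along_def)

lemma partial_deriv_funpow_commute: "partial_deriv j ((partial_deriv i ^^ n) f) = (partial_deriv i ^^ n) (partial_deriv j f)"
  by (induction n) (simp_all add: partial_deriv_commute[of j i])

lemma derivs_along_commute: "partial_deriv j (derivs_along e js f) = derivs_along e js (partial_deriv j f)"
  by (induction js) (simp_all add: derivs_along_simps partial_deriv_funpow_commute)

lemma derivs_along_cong: "(\<And>k. k \<in> set js \<Longrightarrow> e k = e' k) \<Longrightarrow> derivs_along e js f = derivs_along e' js f"
  by (induction js) (simp_all add: derivs_along_simps)

lemma derivs_along_step:
  assumes "distinct js" "j \<in> set js"
  shows "derivs_along e js (partial_deriv j f) = derivs_along (e(j := Suc (e j))) js f"
  using assms
proof (induction js)
  case (Cons i js)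
  show ?case
  proof (cases "i = j")
    case True
    have "derivs_along (e(j := Suc (e j))) js f = derivs_along e js f"
      using True Cons.prems by (intro derivs_along_cong) auto
    moreover have "(partial_deriv j ^^ Suc (e j)) (derivs_along e js f) =
        (partial_deriv j ^^ e j) (partial_deriv j (derivs_along e js f))"
      by (simp add: partial_deriv_funpow_commute)
    ultimately show ?thesis
      using True by (simp only: derivs_along_simps derivs_along_commute[symmetric] fun_upd_same partial_deriv_funpow_commute)
  next
    case False
    then show ?thesis using Cons by (auto simp: derivs_along_simps)
  qed
qed simp

lemma iterated_deriv_step: "iterated_deriv (mon j 1 + u) f = iterated_deriv u (partial_deriv j f)"
proof -
  have "coef (mon j 1 + u) = (coef u)(j := Suc (coef u j))"
    by (auto simp: lookup_add lookup_single when_def)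
  then show ?thesis
    unfolding iterated_deriv_def deriv_monomial_def derivs_along_def[symmetric]
    by (subst derivs_along_step) auto
qed

lemma iterated_deriv_zero: "iterated_deriv 0 f = f"
proof -
  have "derivs_along (\<lambda>_. 0) js f = f" for js
    by (induction js) (simp_all add: derivs_along_simps)
  then show ?thesis by (simp add: iterated_deriv_def deriv_monomial_def derivs_along_def zero_poly_mapping.rep_eq)
qed

lemma exponent_induct [case_names zero step]:
  fixes u :: "'n::finite \<Rightarrow>\<^sub>0 nat"
  assumes "P 0" "\<And>j u. P u \<Longrightarrow> P (mon j 1 + u)"
  shows "P u"
proof (induction "total_degree u" arbitrary: u)
  case 0
  then show ?case using assms(1) by (simp add: total_degree_0)
next
  case (Suc n)
  then have "u \<noteq> 0" by auto
  then obtain j where j: "coef u j \<noteq> 0" using nonzero_coef by blast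
  have u: "mon j 1 + (u - mon j 1) = u"
    using j by (intro poly_mapping_eqI) (auto simp: lookup_add lookup_minus lookup_single when_def)
  then have "Suc n = 1 + total_degree (u - mon j 1)"
    using Suc(2) by (metis total_degree_add total_degree_single)
  then have "P (u - mon j 1)" using Suc by simp
  then show ?case using assms(2)[of "u - mon j 1" j] u by simp
qed

lemma iterated_deriv_add: "iterated_deriv (u + w) f = iterated_deriv u (iterated_deriv w f)"
proof (induction w arbitrary: f rule: exponent_induct)
  case zero
  then show ?case by (simp add: iterated_deriv_zero)
next
  case (step j w)
  have "iterated_deriv (u + (mon j 1 + w)) f = iterated_deriv (mon j 1 + (u + w)) f" by (simp add: add_ac)
  then show ?case using step by (simp add: iterated_deriv_step)
qed

lemma iterated_deriv_plus: "iterated_deriv u (f + g) = iterated_deriv u f + iterated_deriv u g"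
  by (induction u arbitrary: f g rule: exponent_induct)
    (simp_all add: iterated_deriv_zero iterated_deriv_step partial_deriv_add)

lemma iterated_deriv_partial_deriv: "partial_deriv j (iterated_deriv u f) = iterated_deriv u (partial_deriv j f)"
  by (induction u arbitrary: f rule: exponent_induct)
    (simp_all add: iterated_deriv_zero iterated_deriv_step partial_deriv_commute)

text \<open>
  Coefficients stand to the left of derivatives.
\<close>

definition operator :: "(('n::{finite,linorder} \<Rightarrow>\<^sub>0 nat) \<Rightarrow>\<^sub>0 'n ratfun) \<Rightarrow> 'n ratfun \<Rightarrow> 'n ratfun" where
  "operator p f = ext (\<lambda>u g. g * iterated_deriv u f) p"

lemma addhom_operator: "addhom (\<lambda>p. operator p f)"
  unfolding operator_def by (intro addhom_ext addhom_times_right addhom_id)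

lemma operator_add: "operator (p + q) f = operator p f + operator q f"
  by (rule addhom_add[OF addhom_operator])

lemma operator_single: "operator (mon u g) f = g * iterated_deriv u f"
  unfolding operator_def by (rule ext_single) simp

lemma operator_apply_add: "operator p (f + g) = operator p f + operator p g"
  by (induction p rule: pm_induct)
     (simp_all add: operator_single operator_add iterated_deriv_plus algebra_simps)

lemma operator_cst: "operator (cst g * p) f = g * operator p f"
  by (induction p rule: pm_induct)
     (simp_all add: operator_single operator_add cst_mon distrib_left mult.assoc)

lemma operator_deriv_symbol: "operator (deriv_symbol k p) f = partial_deriv k (operator p f)"
proof (induction p rule: pm_induct)
  case (single u c)
  show ?case
    unfolding deriv_symbol_def operator_add operator_single xi_mon coef_deriv_single partial_deriv_mult
        iterated_deriv_step iterated_deriv_partial_deriv by simp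
next
  case (add p q)
  then show ?case by (simp add: operator_add addhom_add[OF addhom_deriv_symbol] partial_deriv_add)
qed

lemma operator_mon: "operator (p * mon u 1) f = operator p (iterated_deriv u f)"
  by (induction p rule: pm_induct)
     (simp_all add: operator_single operator_add mult_single iterated_deriv_add distrib_right)

lemma iterated_deriv_var_mult:
  "iterated_deriv u (ratfun_var k * f) =
     ratfun_var k * iterated_deriv u f + of_nat (coef u k) * iterated_deriv (u - mon k 1) f"
proof (induction u arbitrary: f rule: exponent_induct)
  case zero
  then show ?case by (simp add: iterated_deriv_zero)
next
  case (step j u)
  show ?case
  proof (cases "j = k")
    case False
    have "coef u k \<noteq> 0 \<Longrightarrow> mon j 1 + (u - mon k 1) = mon j 1 + u - mon k 1"
      using False by (intro poly_mapping_eqI) (auto simp: lookup_add lookup_minus lookup_single when_def)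
    then have "of_nat (coef u k) * iterated_deriv (u - mon k 1) (partial_deriv j f) =
        of_nat (coef u k) * iterated_deriv (mon j 1 + u - mon k 1) f"
      by (cases "coef u k = 0") (simp_all flip: iterated_deriv_step)
    then show ?thesis
      using False step by (simp add: iterated_deriv_step partial_deriv_mult partial_deriv_var lookup_add lookup_single)
  next
    case True
    have "coef u k \<noteq> 0 \<Longrightarrow> mon k 1 + (u - mon k 1) = u"
      by (intro poly_mapping_eqI) (auto simp: lookup_add lookup_minus lookup_single when_def)
    then have "of_nat (coef u k) * iterated_deriv (u - mon k 1) (partial_deriv k f) =
        of_nat (coef u k) * iterated_deriv u f"
      by (cases "coef u k = 0") (simp_all flip: iterated_deriv_step)
    then show ?thesis
      using True step[of "partial_deriv k f"]
      by (simp only: iterated_deriv_step partial_deriv_mult partial_deriv_var lookup_add lookup_single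
         iterated_deriv_plus) (simp add: algebra_simps)
  qed
qed

text \<open>
  This is what \<open>euler_mult\<close> was made for: on operators it is right multiplication by \<open>Z\<^sub>i - c\<^sub>i\<close>.
\<close>

lemma operator_euler_mult:
  fixes a :: "'n::{finite,linorder} \<Rightarrow> int ^ 'r"
  shows "operator (euler_mult a ratfun_var (\<lambda>i. ratfun_const (\<alpha> $ i)) i p) f =
    operator p (euler_op a i f - ratfun_const (\<alpha> $ i) * f)"
proof (induction p rule: pm_induct)
  case (single u c)
  have const: "iterated_deriv u (ratfun_const z * f) = ratfun_const z * iterated_deriv u f" for z f
    by (induction u arbitrary: f rule: exponent_induct)
       (simp_all add: iterated_deriv_zero iterated_deriv_step partial_deriv_mult partial_deriv_const)
  have ah: "addhom (iterated_deriv u)" by (rule addhomI) (rule iterated_deriv_plus)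
  have step: "of_int (a j $ i) * c * (ratfun_var j * iterated_deriv (mon j 1 + u) f + of_nat (coef u j) * iterated_deriv u f) =
      c * iterated_deriv u (of_int (a j $ i) * ratfun_var j * partial_deriv j f)" for j
  proof -
    have *: "of_nat (coef u j) * iterated_deriv (u - mon j 1) (partial_deriv j f) = of_nat (coef u j) * iterated_deriv u f"
    proof (cases "coef u j = 0")
      case False
      then have "mon j 1 + (u - mon j 1) = u"
        by (intro poly_mapping_eqI) (auto simp: lookup_add lookup_minus lookup_single when_def)
      then show ?thesis by (simp flip: iterated_deriv_step)
    qed simp
    show ?thesis
      by (simp only: mult.assoc const[of "of_int (a j $ i)", unfolded ratfun_const_of_int] iterated_deriv_var_mult *
         iterated_deriv_step mult.left_commute[of c])
  qed
  have "operator (euler_mult a ratfun_var (\<lambda>i. ratfun_const (\<alpha> $ i)) i (mon u c)) f =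
     (\<Sum>j\<in>UNIV. of_int (a j $ i) * ratfun_var j * c * iterated_deriv (mon j 1 + u) f) +
     of_int (point_sum a u $ i) * c * iterated_deriv u f - ratfun_const (\<alpha> $ i) * c * iterated_deriv u f"
    unfolding euler_mult_def euler_form_single euler_weight_single cst_mon addhom_add[OF addhom_operator]
      addhom_diff[OF addhom_operator] addhom_sum[OF addhom_operator] operator_single ..
  also have "of_int (point_sum a u $ i) * c * iterated_deriv u f =
     (\<Sum>j\<in>UNIV. of_int (a j $ i) * c * (of_nat (coef u j) * iterated_deriv u f))"
    by (simp add: point_sum_def sum_distrib_right sum_distrib_left mult_ac)
  also have "(\<Sum>j\<in>UNIV. of_int (a j $ i) * ratfun_var j * c * iterated_deriv (mon j 1 + u) f) + \<dots> =
     (\<Sum>j\<in>UNIV. c * iterated_deriv u (of_int (a j $ i) * ratfun_var j * partial_deriv j f))"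
    unfolding sum.distrib[symmetric] step[symmetric] by (intro sum.cong refl) (simp add: algebra_simps)
  finally show ?case
    unfolding operator_single euler_op_def addhom_diff[OF ah] addhom_sum[OF ah] const
    by (simp add: sum_distrib_left right_diff_distrib mult_ac)
next
  case (add p q)
  then show ?case by (simp add: operator_add addhom_add[OF addhom_euler_mult])
qed

lemma iterated_deriv_monomial:
  "\<exists>c'. iterated_deriv w (Fract (mon u c) 1) = Fract (mon (u - w) c') 1 \<and>
     (c' = 0 \<longleftrightarrow> c = 0 \<or> (\<exists>j. coef u j < coef w j))"
proof (induction w arbitrary: u c rule: exponent_induct)
  case zero
  show ?case by (intro exI[of _ c]) (simp add: iterated_deriv_zero)
next
  case (step j w)
  obtain c' where c': "iterated_deriv w (Fract (mon (u - mon j 1) (of_nat (coef u j) * c)) 1) = Fract (mon (u - mon j 1 - w) c') 1"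
    "c' = 0 \<longleftrightarrow> of_nat (coef u j) * c = 0 \<or> (\<exists>i. coef (u - mon j 1) i < coef w i)"
    using step by blast
  have "u - mon j 1 - w = u - (mon j 1 + w)"
    by (rule poly_mapping_eqI) (simp add: lookup_minus lookup_add)
  then have "iterated_deriv (mon j 1 + w) (Fract (mon u c) 1) = Fract (mon (u - (mon j 1 + w)) c') 1"
    using c'(1) by (simp add: iterated_deriv_step partial_deriv_Fract_1 poly_deriv_single)
  moreover have "(coef u j = 0 \<or> (\<exists>i. coef (u - mon j 1) i < coef w i)) \<longleftrightarrow> (\<exists>i. coef u i < coef (mon j 1 + w) i)"
  proof (cases "coef u j = 0")
    case True
    then show ?thesis by (auto intro!: exI[of _ j] simp: lookup_add lookup_single)
  next
    case False
    have "coef (u - mon j 1) i < coef w i \<longleftrightarrow> coef u i < coef (mon j 1 + w) i" for i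
      using False by (auto simp: lookup_add lookup_minus lookup_single when_def)
    then show ?thesis using False by simp
  qed
  ultimately show ?case using c'(2) by (intro exI[of _ c']) auto
qed

text \<open>
  Let \<open>u\<close> be of least degree in the symbol. All other \<open>\<partial>\<^sup>w\<close> that occur annihilate \<open>v\<^sup>u\<close>.
\<close>

lemma operator_eq_zero:
  assumes "\<And>f. operator p f = 0"
  shows "p = 0"
proof (rule ccontr)
  assume "p \<noteq> 0"
  then have "supp p \<noteq> {}" by simp
  then obtain u where u: "u \<in> supp p" "\<And>w. w \<in> supp p \<Longrightarrow> total_degree u \<le> total_degree w"
    using ex_min_if_finite[of "total_degree ` supp p"] by (metis (no_types, lifting) arg_min_least finite_keys arg_min_if_finite(1))
  have other: "iterated_deriv w (Fract (mon u 1) 1) = 0" if w: "w \<in> supp p" "w \<noteq> u" for w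
  proof -
    have "\<exists>j. coef u j < coef w j"
    proof (rule ccontr)
      assume "\<not> (\<exists>j. coef u j < coef w j)"
      then have le: "coef w j \<le> coef u j" for j by (simp add: not_less)
      obtain j where "coef w j \<noteq> coef u j" using w(2) by (metis poly_mapping_eqI)
      then have "coef w j < coef u j" using le[of j] by simp
      then have "total_degree w < total_degree u"
        unfolding total_degree_def using le by (intro sum_strict_mono_ex1) (auto intro!: bexI[of _ j])
      then show False using u(2)[OF w(1)] by simp
    qed
    then show ?thesis using iterated_deriv_monomial[of w u 1] by (auto simp: Zero_fract_def)
  qed
  obtain c where c: "iterated_deriv u (Fract (mon u 1) 1) = Fract (cst c) 1" "c \<noteq> 0"
    using iterated_deriv_monomial[of u u 1] by auto
  have "operator p (Fract (mon u 1) 1) = (\<Sum>w\<in>supp p. if w = u then coef p u * Fract (cst c) 1 else 0)"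
    unfolding operator_def ext_def using other c by (intro sum.cong refl) auto
  also have "\<dots> = coef p u * Fract (cst c) 1" using u(1) by simp
  also have "\<dots> \<noteq> 0"
  proof -
    have "Fract (cst c :: 'a cpoly) 1 \<noteq> 0" using c(2) by (simp add: Zero_fract_def eq_fract) (metis lookup_single_eq lookup_zero)
    then show ?thesis using u(1) by (simp add: in_keys_iff)
  qed
  finally show False using assms by blast
qed

lemma inj_operator: "inj operator"
proof (rule injI)
  fix p q :: "('n::{finite,linorder} \<Rightarrow>\<^sub>0 nat) \<Rightarrow>\<^sub>0 'n ratfun"
  assume "operator p = operator q"
  then have "operator (p - q) f = 0" for f by (simp add: addhom_diff[OF addhom_operator])
  then show "p = q" using operator_eq_zero[of "p - q"] by simp
qed

lemma operator_in_diff_ops: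
  fixes p :: "('n::{finite,linorder} \<Rightarrow>\<^sub>0 nat) \<Rightarrow>\<^sub>0 'n ratfun"
  shows "operator p \<in> diff_ops"
proof (induction p rule: pm_induct)
  case (single u c)
  have zero: "id \<in> (diff_ops :: ('n ratfun \<Rightarrow> 'n ratfun) set)"
  proof -
    have "id = (*) (1 :: 'n ratfun)" by (simp add: fun_eq_iff)
    then show ?thesis using diff_ops.coeff by metis
  qed
  have "iterated_deriv u \<in> diff_ops"
  proof (induction u rule: exponent_induct)
    case zero
    have "iterated_deriv 0 = id" by (simp add: fun_eq_iff iterated_deriv_zero)
    with \<open>id \<in> diff_ops\<close> show ?case by metis
  next
    case (step j u)
    have "iterated_deriv (mon j 1 + u) = iterated_deriv u \<circ> partial_deriv j"
      by (simp add: fun_eq_iff iterated_deriv_step)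
    then show ?case using diff_ops.comp[OF step diff_ops.deriv] by metis
  qed
  moreover have "operator (mon u c) = (*) c \<circ> iterated_deriv u"
    by (simp add: fun_eq_iff operator_single)
  ultimately show ?case using diff_ops.comp[OF diff_ops.coeff] by metis
next
  case (add p q)
  have "operator (p + q) = (\<lambda>f. operator p f + operator q f)"
    by (simp add: fun_eq_iff operator_add)
  then show ?case using diff_ops.add[OF add] by metis
qed

text \<open>
  Every composition with a differential operator stays within a left stable set of symbols, by
  induction on the construction of the operator.
\<close>

lemma left_stable_diff_ops:
  assumes "P \<in> diff_ops" "left_stable N" "n \<in> N"
  shows "\<exists>n'\<in>N. P \<circ> operator n = operator n'"
  using assms(1,3)
proof (induction arbitrary: n)
  case (coeff g)
  have "(*) g \<circ> operator n = operator (cst g * n)" by (simp add: fun_eq_iff operator_cst)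
  then show ?case using left_stableD(2)[OF assms(2) coeff] by blast
next
  case (deriv j)
  have "partial_deriv j \<circ> operator n = operator (deriv_symbol j n)" by (simp add: fun_eq_iff operator_deriv_symbol)
  then show ?case using left_stableD(3)[OF assms(2) deriv] by blast
next
  case (add P Q)
  then obtain p q where pq: "p \<in> N" "P \<circ> operator n = operator p" "q \<in> N" "Q \<circ> operator n = operator q" by blast
  have "(\<lambda>f. P f + Q f) \<circ> operator n = operator (p + q)"
    using pq(2,4) by (simp add: fun_eq_iff operator_add)
  then show ?case using left_stableD(1)[OF assms(2) pq(1,3)] by blast
next
  case (comp P Q)
  obtain q where q: "q \<in> N" "Q \<circ> operator n = operator q" using comp.IH(2) comp.prems by blast
  obtain p where p: "p \<in> N" "P \<circ> operator q = operator p" using comp.IH(1) q(1) by blast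
  have "P \<circ> Q \<circ> operator n = operator p" using p(2) q(2) by (simp add: comp_assoc)
  then show ?case using p(1) by blast
qed

lemma operator_1: "operator 1 = id"
proof
  fix f :: "'a ratfun"
  show "operator 1 f = id f" using operator_single[of 0 1 f] by (simp add: iterated_deriv_zero)
qed

text \<open>
  The toric kernel is the additive span of the monomial multiples of box binomials. Two monomials of a
  kernel element must have the same image, and the corresponding binomial removes one of them.
  The set \<open>V\<close> is additive rather than an ideal so that it can be the set of symbols of a left ideal of
  operators.
\<close>

lemma toric_kernel_generated:
  fixes V :: "(('n::finite \<Rightarrow>\<^sub>0 nat) \<Rightarrow>\<^sub>0 'k::comm_ring_1) set"
  assumes "0 \<in> V" "\<And>p q. p \<in> V \<Longrightarrow> q \<in> V \<Longrightarrow> p + q \<in> V"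
    and box: "\<And>u c l. l \<in> relation_lattice a \<Longrightarrow>
      mon u c * (mon (exponent (\<lambda>j. nat (l j))) 1 - mon (exponent (\<lambda>j. nat (- l j))) 1) \<in> V"
    and "p \<in> toric_kernel a"
  shows "p \<in> V"
  using assms(4)
proof (induction "card (supp p)" arbitrary: p rule: less_induct)
  case less
  show ?case
  proof (cases "p = 0")
    case True
    then show ?thesis using assms(1) by simp
  next
    case False
    then obtain u where u: "u \<in> supp p" by fastforce
    have "\<exists>w\<in>supp p. w \<noteq> u \<and> point_sum a w = point_sum a u"
    proof (rule ccontr)
      assume no: "\<not> ?thesis"
      have "0 = coef (toric_map a p) (point_sum a u)" using less.prems by (simp add: toric_kernel_def)
      also have "\<dots> = (\<Sum>w\<in>supp p. if w = u then coef p u else 0)"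
        unfolding toric_map_def ext_def lookup_sum lookup_single when_def
        using no by (intro sum.cong refl) auto
      also have "\<dots> = coef p u" using u by simp
      finally show False using u by (simp add: in_keys_iff)
    qed
    then obtain w where w: "w \<in> supp p" "w \<noteq> u" "point_sum a w = point_sum a u" by blast
    define c where "c = coef p u"
    define p' where "p' = p - (mon u c - mon w c)"
    have "supp p' \<subseteq> supp p - {u}"
      using w u by (auto simp: p'_def c_def in_keys_iff lookup_minus lookup_single when_def split: if_splits)
    then have "card (supp p') < card (supp p)"
      using u by (intro psubset_card_mono) auto
    moreover have "p' \<in> toric_kernel a"
      using less.prems w(3) by (simp add: p'_def toric_kernel_def addhom_diff[OF addhom_toric_map] toric_map_single)
    ultimately have p': "p' \<in> V" by (rule less.hyps)
    define l where "l j = int (coef u j) - int (coef w j)" for j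
    have "l \<in> relation_lattice a"
      using w(3) by (simp add: relation_lattice_def l_def point_sum_def vector_sub_rdistrib sum_subtractf)
    define m where "m = exponent (\<lambda>j. min (coef u j) (coef w j))"
    have "m + exponent (\<lambda>j. nat (l j)) = u" "m + exponent (\<lambda>j. nat (- l j)) = w"
      by (rule poly_mapping_eqI; simp add: lookup_add coef_exponent m_def l_def)+
    then have "mon m c * (mon (exponent (\<lambda>j. nat (l j))) 1 - mon (exponent (\<lambda>j. nat (- l j))) 1) = mon u c - mon w c"
      by (simp add: right_diff_distrib mult_single)
    then have "mon u c - mon w c \<in> V" using box[OF \<open>l \<in> relation_lattice a\<close>, of m c] by simp
    from assms(2)[OF p' this] show ?thesis by (simp add: p'_def)
  qed
qed

lemma box_in_toric_kernel:
  assumes "l \<in> relation_lattice a"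
  shows "mon (exponent (\<lambda>j. nat (l j))) 1 - mon (exponent (\<lambda>j. nat (- l j))) 1 \<in> toric_kernel a"
proof -
  have "point_sum a (exponent (\<lambda>j. nat (l j))) - point_sum a (exponent (\<lambda>j. nat (- l j))) =
     (\<Sum>j\<in>UNIV. (int (nat (l j)) - int (nat (- l j))) *s a j)"
    by (simp add: point_sum_def coef_exponent vector_sub_rdistrib sum_subtractf)
  also have "\<dots> = (\<Sum>j\<in>UNIV. l j *s a j)" by (intro sum.cong refl arg_cong2[where f="(*s)"]) auto
  also have "\<dots> = 0" using assms by (simp add: relation_lattice_def)
  finally show ?thesis
    by (simp add: toric_kernel_def addhom_diff[OF addhom_toric_map] toric_map_single)
qed

lemma left_ideal_operator_image:
  fixes N :: "(('n::{finite,linorder} \<Rightarrow>\<^sub>0 nat) \<Rightarrow>\<^sub>0 'n ratfun) set"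
  assumes "left_stable N" "0 \<in> N"
  shows "left_ideal (operator ` N) diff_op_ring"
proof -
  interpret R: ring "diff_op_ring :: ('n ratfun \<Rightarrow> 'n ratfun) ring"
    by (rule ring_diff_op_ring)
  note N = left_stableD[OF assms(1)]
  have car: "carrier (diff_op_ring :: ('n ratfun \<Rightarrow> 'n ratfun) ring) = diff_ops" by (simp add: diff_op_ring_def)
  have zero: "operator 0 = (\<zero>\<^bsub>diff_op_ring\<^esub> :: 'n ratfun \<Rightarrow> 'n ratfun)"
    by (simp add: diff_op_ring_def fun_eq_iff addhom_zero[OF addhom_operator])
  have plus: "operator (p + q) = operator p \<oplus>\<^bsub>diff_op_ring\<^esub> operator q" for p q :: "('n \<Rightarrow>\<^sub>0 nat) \<Rightarrow>\<^sub>0 'n ratfun"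
    by (simp add: diff_op_ring_def fun_eq_iff operator_add)
  have minus: "\<ominus>\<^bsub>diff_op_ring\<^esub> operator p = operator (- p)" for p :: "('n \<Rightarrow>\<^sub>0 nat) \<Rightarrow>\<^sub>0 'n ratfun"
    by (rule R.minus_equality) (simp_all add: car operator_in_diff_ops plus[symmetric] zero)
  have "subgroup (operator ` N) (add_monoid diff_op_ring)"
  proof (rule group.subgroupI)
    show "Group.group (add_monoid (diff_op_ring :: ('n ratfun \<Rightarrow> 'n ratfun) ring))"
      by (rule R.add.is_group)
    show "operator ` N \<subseteq> carrier (add_monoid diff_op_ring)" using operator_in_diff_ops by (auto simp: car)
    show "operator ` N \<noteq> {}" using assms(2) by blast
    show "inv\<^bsub>add_monoid diff_op_ring\<^esub> x \<in> operator ` N" if "x \<in> operator ` N" for x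
      using that N(4) minus by (auto simp: a_inv_def)
    show "x \<otimes>\<^bsub>add_monoid diff_op_ring\<^esub> y \<in> operator ` N" if "x \<in> operator ` N" "y \<in> operator ` N" for x y
      using that N(1) by (auto simp: plus[symmetric])
  qed
  moreover have "x \<otimes>\<^bsub>diff_op_ring\<^esub> y \<in> operator ` N" if "x \<in> diff_ops" "y \<in> operator ` N" for x y
    using that left_stable_diff_ops[OF _ assms(1)] by (auto simp: diff_op_ring_def)
  ultimately show ?thesis by (simp add: left_ideal_def additive_subgroup_def car)
qed

lemma deriv_monomial_exponent: "deriv_monomial e = iterated_deriv (exponent e)"
proof -
  have "coef (exponent e) = e" by (rule ext) (rule coef_exponent)
  then show ?thesis by (simp add: iterated_deriv_def)
qed

text \<open>
  The left ideal generated by operators corresponds to a set of symbols in explicit form. The product of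
  a monomial and a box binomial is the symbol of a left multiple of the box operator, because box
  operators commute with the \<open>\<partial>\<^sub>j\<close>. The Euler operators are multiplied from the left by the definition of
  \<open>euler_mult\<close>.
\<close>

lemma hypergeom_ideal_eq:
  fixes a :: "'n::{finite,linorder} \<Rightarrow> int ^ 'r"
  shows "hypergeom_ideal a \<alpha> = operator ` hypergeom_symbols a \<alpha>"
proof
  let ?G = "range (\<lambda>i f. euler_op a i f - ratfun_const (\<alpha> $ i) * f) \<union> box_op ` relation_lattice a"
  let ?H = "hypergeom_symbols a \<alpha>"
  let ?E = "euler_mult a ratfun_var (\<lambda>i. ratfun_const (\<alpha> $ i))"
  have euler: "(\<lambda>f. euler_op a i f - ratfun_const (\<alpha> $ i) * f) \<in> operator ` ?H" for i
  proof (rule image_eqI[of _ _ "?E i 1"])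
    show "(\<lambda>f. euler_op a i f - ratfun_const (\<alpha> $ i) * f) = operator (?E i 1)"
      by (simp add: fun_eq_iff operator_euler_mult operator_1)
    have "(\<Sum>k\<in>UNIV. ?E k (if k = i then 1 else 0)) = (\<Sum>k\<in>UNIV. if k = i then ?E k 1 else 0)"
      by (intro sum.cong refl) (simp add: addhom_zero[OF addhom_euler_mult])
    then show "?E i 1 \<in> ?H"
      unfolding hypergeom_symbols_def
      by (intro euler_idealI[OF ring_idealD(1)[OF ring_ideal_toric_kernel], where q = "\<lambda>k. if k = i then 1 else 0"]) simp
  qed
  have toric: "t \<in> toric_kernel a \<Longrightarrow> t \<in> ?H" for t
    unfolding hypergeom_symbols_def
    by (rule euler_idealI[where q = "\<lambda>_. 0"]) (simp_all add: addhom_zero[OF addhom_euler_mult])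
  let ?b = "\<lambda>l. mon (exponent (\<lambda>j. nat (l j))) 1 - mon (exponent (\<lambda>j. nat (- l j))) 1"
  have box: "box_op l = operator (?b l)" for l :: "'n \<Rightarrow> int"
    by (simp add: fun_eq_iff box_op_def deriv_monomial_exponent addhom_diff[OF addhom_operator] operator_single)
  have "?G \<subseteq> operator ` ?H"
    using euler toric box_in_toric_kernel[of _ a] by (auto simp: box)
  then show "hypergeom_ideal a \<alpha> \<subseteq> operator ` ?H"
    using left_ideal_operator_image[OF left_stable_hypergeom_symbols zero_in_hypergeom_symbols]
    unfolding hypergeom_ideal_def gen_left_ideal_def by blast
  show "operator ` ?H \<subseteq> hypergeom_ideal a \<alpha>"
    unfolding hypergeom_ideal_def gen_left_ideal_def
  proof (rule Inter_greatest)
    fix I assume "I \<in> {I. left_ideal I diff_op_ring \<and> ?G \<subseteq> I}"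
    then have I: "left_ideal I diff_op_ring" "?G \<subseteq> I" by auto
    interpret I: additive_subgroup I diff_op_ring using I(1) by (simp add: left_ideal_def)
    have mult: "operator p \<circ> Q \<in> I" if "Q \<in> I" for p Q
      using I(1) that operator_in_diff_ops[of p] by (auto simp: left_ideal_def diff_op_ring_def)
    define V where "V = {p. operator p \<in> I}"
    have V0: "0 \<in> V"
    proof -
      have "operator (0 :: ('n \<Rightarrow>\<^sub>0 nat) \<Rightarrow>\<^sub>0 'n ratfun) = \<zero>\<^bsub>diff_op_ring\<^esub>" by (simp add: diff_op_ring_def fun_eq_iff addhom_zero[OF addhom_operator])
      then show ?thesis using I.zero_closed by (simp add: V_def)
    qed
    have Vadd: "p + q \<in> V" if "p \<in> V" "q \<in> V" for p q
    proof -
      have "operator (p + q) = operator p \<oplus>\<^bsub>diff_op_ring\<^esub> operator q"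
        by (simp add: diff_op_ring_def fun_eq_iff operator_add)
      then show ?thesis using I.a_closed that by (simp add: V_def)
    qed
    have "t \<in> V" if "t \<in> toric_kernel a" for t
      using V0 Vadd _ that
    proof (rule toric_kernel_generated)
      fix u c l assume "l \<in> relation_lattice a"
      have "operator (mon u c * ?b l) = operator (mon u c) \<circ> box_op l"
      proof
        fix f
        have ah: "addhom (operator (mon u c))" by (rule addhomI) (rule operator_apply_add)
        show "operator (mon u c * ?b l) f = (operator (mon u c) \<circ> box_op l) f"
          by (simp add: right_diff_distrib addhom_diff[OF addhom_operator] operator_mon box_op_def
              deriv_monomial_exponent addhom_diff[OF ah])
      qed
      then show "mon u c * ?b l \<in> V"
        using mult[of "box_op l" "mon u c"] I(2) \<open>l \<in> relation_lattice a\<close> by (auto simp: V_def)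
    qed
    moreover have "?E i q \<in> V" for i q
    proof -
      have "operator (?E i q) = operator q \<circ> (\<lambda>f. euler_op a i f - ratfun_const (\<alpha> $ i) * f)"
        by (simp add: fun_eq_iff operator_euler_mult)
      then show ?thesis
        using mult[of "\<lambda>f. euler_op a i f - ratfun_const (\<alpha> $ i) * f" q] I(2) by (auto simp: V_def)
    qed
    moreover have "(\<Sum>i\<in>A. ?E i (q i)) \<in> V" if "\<And>i. ?E i (q i) \<in> V" for A q
      using that by (induction A rule: infinite_finite_induct) (auto intro: V0 Vadd)
    ultimately have "?H \<subseteq> V"
      unfolding hypergeom_symbols_def euler_ideal_def using Vadd by auto
    then show "operator ` ?H \<subseteq> I" by (auto simp: V_def)
  qed
qed

text \<open>
  A left stable set between \<open>hypergeom_symbols a \<alpha>\<close> and the whole ring gives a submodule of the quotient.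
\<close>

lemma irreducible_symbols_if_irreducible:
  fixes a :: "'n::{finite,linorder} \<Rightarrow> int ^ 'r"
  assumes "hypergeom_irreducible a \<alpha>"
  shows "irreducible_symbols a \<alpha>"
  unfolding irreducible_symbols_def
proof (intro allI impI)
  let ?R = "diff_op_ring :: ('n ratfun \<Rightarrow> 'n ratfun) ring"
  let ?H = "hypergeom_symbols a \<alpha>" and ?I = "hypergeom_ideal a \<alpha>" and ?M = "hypergeom_module a \<alpha>"
  fix N assume N: "left_stable N" "?H \<subseteq> N"
  have N0: "0 \<in> N" using N(2) zero_in_hypergeom_symbols by blast
  interpret R: ring ?R by (rule ring_diff_op_ring)
  have idl: "left_ideal ?I ?R" "left_ideal (operator ` N) ?R"
    unfolding hypergeom_ideal_eq
    by (intro left_ideal_operator_image left_stable_hypergeom_symbols zero_in_hypergeom_symbols N N0)+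
  interpret I: abelian_subgroup ?I ?R
    using idl(1) by (intro abelian_subgroupI3) (auto simp: left_ideal_def R.abelian_group_axioms)
  have car: "carrier ?R = diff_ops" and add: "x \<oplus>\<^bsub>?R\<^esub> y = (\<lambda>f. x f + y f)" and mul: "x \<otimes>\<^bsub>?R\<^esub> y = x \<circ> y" for x y
    by (simp_all add: diff_op_ring_def)
  define S where "S = (\<lambda>x. ?I +>\<^bsub>?R\<^esub> x) ` (operator ` N)"
  have M: "carrier (add_monoid ?M) = carrier (?R A_Mod ?I)" "mult (add_monoid ?M) = mult (?R A_Mod ?I)"
    "one (add_monoid ?M) = one (?R A_Mod ?I)"
    by (simp_all add: hypergeom_module_def left_quotient_def A_FactGroup_def FactGroup_def A_RCOSETS_def set_add_def)
  have grpR: "Group.group (add_monoid ?R)" by (rule R.add.is_group)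
  have grpM: "Group.group (add_monoid ?M)"
    using I.a_factorgroup_is_group
    unfolding Group.group_def Group.monoid_def Group.group_axioms_def Units_def M .
  have hom: "(\<lambda>x. ?I +>\<^bsub>?R\<^esub> x) \<in> hom (add_monoid ?R) (add_monoid ?M)"
    unfolding hom_def M using I.a_rcos_sum
    by (auto simp: A_FactGroup_def FactGroup_def A_RCOSETS_def RCOSETS_def a_r_coset_def set_add_def)
  have "subgroup S (add_monoid ?M)"
    unfolding S_def
    by (rule group_hom.subgroup_img_is_subgroup[OF group_hom.intro[OF grpR grpM group_hom_axioms.intro[OF hom]]])
      (use idl(2) in \<open>auto simp: left_ideal_def additive_subgroup_def\<close>)
  moreover have "x \<odot>\<^bsub>?M\<^esub> C \<in> S" if x: "x \<in> carrier ?R" and C: "C \<in> S" for x C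
  proof -
    obtain n where n: "n \<in> N" "C = ?I +>\<^bsub>?R\<^esub> operator n" using C by (auto simp: S_def)
    have cos: "?I +>\<^bsub>?R\<^esub> (x \<circ> y) = ?I +>\<^bsub>?R\<^esub> (x \<circ> operator n)" if yC: "y \<in> C" for y
    proof -
      obtain i where i: "i \<in> ?I" "y = (\<lambda>f. i f + operator n f)"
        using yC unfolding n(2) a_r_coset_def' by (auto simp: add)
      have "x \<circ> y = (x \<circ> i) \<oplus>\<^bsub>?R\<^esub> (x \<circ> operator n)"
        using x unfolding car by (simp add: i(2) add fun_eq_iff diff_ops_add)
      moreover have "x \<circ> i \<in> ?I" using idl(1) x i(1) by (auto simp: left_ideal_def mul)
      ultimately have "x \<circ> y \<in> ?I +>\<^bsub>?R\<^esub> (x \<circ> operator n)"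
        unfolding a_r_coset_def' by blast
      moreover have "x \<circ> operator n \<in> carrier ?R"
        using x operator_in_diff_ops[of n] unfolding car by (intro diff_ops.comp)
      ultimately show ?thesis using I.a_repr_independence' by metis
    qed
    have "operator n \<in> C" unfolding n(2) a_r_coset_def'
      using I.zero_closed by (auto simp: add diff_op_ring_def intro!: bexI[of _ "\<lambda>_. 0"])
    have "x \<odot>\<^bsub>?M\<^esub> C = (\<Union>y\<in>C. ?I +>\<^bsub>?R\<^esub> (x \<circ> y))"
      by (simp add: hypergeom_module_def left_quotient_def mul)
    also have "\<dots> = (\<Union>y\<in>C. ?I +>\<^bsub>?R\<^esub> (x \<circ> operator n))"
      by (intro SUP_cong refl cos)
    also have "\<dots> = ?I +>\<^bsub>?R\<^esub> (x \<circ> operator n)"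
      using \<open>operator n \<in> C\<close> by blast
    finally have "x \<odot>\<^bsub>?M\<^esub> C = ?I +>\<^bsub>?R\<^esub> (x \<circ> operator n)" .
    moreover obtain n' where "n' \<in> N" "x \<circ> operator n = operator n'"
      using left_stable_diff_ops[OF _ N(1) n(1)] x car by blast
    ultimately show ?thesis by (auto simp: S_def)
  qed
  ultimately have "submodule S ?R ?M"
    by (simp add: submodule_def submodule_axioms_def)
  then consider "S = {?I}" | "S = a_rcosets\<^bsub>?R\<^esub> ?I"
    using assms by (auto simp: hypergeom_irreducible_def hypergeom_module_def left_quotient_def)
  then show "N = ?H \<or> N = UNIV"
  proof cases
    case 1
    have "n \<in> ?H" if "n \<in> N" for n
    proof -
      have "?I +>\<^bsub>?R\<^esub> operator n = ?I" using 1 that by (auto simp: S_def)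
      moreover have "operator n \<in> ?I +>\<^bsub>?R\<^esub> operator n" unfolding a_r_coset_def'
        using I.zero_closed by (auto simp: add diff_op_ring_def intro!: bexI[of _ "\<lambda>_. 0"])
      ultimately have "operator n \<in> operator ` ?H" using hypergeom_ideal_eq by blast
      then show ?thesis by (simp add: inj_image_mem_iff[OF inj_operator])
    qed
    then show ?thesis using N(2) by blast
  next
    case 2
    have "p \<in> N" for p
    proof -
      have "operator p \<in> carrier ?R" using operator_in_diff_ops car by blast
      then have "?I +>\<^bsub>?R\<^esub> operator p \<in> S"
        unfolding 2 A_RCOSETS_def RCOSETS_def a_r_coset_def by auto
      then obtain n where n: "n \<in> N" "?I +>\<^bsub>?R\<^esub> operator p = ?I +>\<^bsub>?R\<^esub> operator n" by (auto simp: S_def)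
      have "operator p \<in> ?I +>\<^bsub>?R\<^esub> operator p" unfolding a_r_coset_def'
        using I.zero_closed by (auto simp: add diff_op_ring_def intro!: bexI[of _ "\<lambda>_. 0"])
      then have "operator p \<in> ?I +>\<^bsub>?R\<^esub> operator n" by (simp only: n(2))
      then obtain i where i: "i \<in> ?I" "operator p = (\<lambda>f. i f + operator n f)"
        unfolding a_r_coset_def' by (auto simp: add)
      then obtain h where h: "h \<in> ?H" "i = operator h" unfolding hypergeom_ideal_eq by blast
      have "operator p = operator (h + n)" using i(2) h(2) by (simp add: fun_eq_iff operator_add)
      then have "p = h + n" by (rule injD[OF inj_operator])
      then show ?thesis using left_stableD(1)[OF N(1)] h(1) N(2) n(1) by blast
    qed
    then show ?thesis by blast
  qed
qed


section \<open>Gamma series supported on a face\<close>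

text \<open>
  Passage from \<open>\<complex>[v][\<xi>]\<close> to \<open>K[\<xi>]\<close>.
\<close>

definition fract_poly :: "('x \<Rightarrow>\<^sub>0 'c::idom) \<Rightarrow> ('x \<Rightarrow>\<^sub>0 'c fract)" where
  "fract_poly = ext (\<lambda>m g. mon m (Fract g 1))"

lemma addhom_Fract_1: "addhom (\<lambda>g. Fract g 1)"
  by (rule addhomI) simp

lemma addhom_fract_poly: "addhom fract_poly"
  unfolding fract_poly_def by (intro addhom_ext addhom_comp[OF addhom_mon addhom_Fract_1])

lemma fract_poly_single: "fract_poly (mon m g) = mon m (Fract g 1)"
  unfolding fract_poly_def by (rule ext_single) (simp add: Zero_fract_def[symmetric])

lemma coef_fract_poly: "coef (fract_poly p) m = Fract (coef p m) 1"
proof -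
  have "(\<lambda>p. coef (fract_poly p) m) = (\<lambda>p. Fract (coef p m) 1)"
    by (rule addhom_eqI)
       (simp_all add: addhom_comp[OF addhom_coef addhom_fract_poly] addhom_comp[OF addhom_Fract_1 addhom_coef]
         fract_poly_single lookup_single when_def Zero_fract_def)
  from fun_cong[OF this] show ?thesis .
qed

lemma fract_poly_eq_0: "fract_poly p = 0 \<Longrightarrow> p = 0"
proof (rule poly_mapping_eqI)
  fix m assume "fract_poly p = 0"
  then have "coef (fract_poly p) m = 0" by simp
  then show "coef p m = coef 0 m" unfolding coef_fract_poly by (simp add: Zero_fract_def eq_fract)
qed

lemma fract_poly_mult:
  fixes p q :: "('n \<Rightarrow>\<^sub>0 nat) \<Rightarrow>\<^sub>0 'c::idom"
  shows "fract_poly (p * q) = fract_poly p * fract_poly q"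
proof (induction p rule: pm_induct)
  case (single u c)
  show ?case
    by (induction q rule: pm_induct)
       (simp_all add: mult_single fract_poly_single distrib_left addhom_add[OF addhom_fract_poly])
qed (simp add: distrib_right addhom_add[OF addhom_fract_poly])

lemma common_denominator:
  fixes p :: "('n \<Rightarrow>\<^sub>0 nat) \<Rightarrow>\<^sub>0 'c::idom fract"
  shows "\<exists>D p'. D \<noteq> 0 \<and> cst (Fract D 1) * p = fract_poly p'"
proof (induction p rule: pm_induct)
  case (single m c)
  obtain n d where c: "c = Fract n d" "d \<noteq> 0" by (cases c) auto
  have "cst (Fract d 1) * mon m c = fract_poly (mon m n)"
  proof -
    have "Fract (d * n) d = Fract n 1" using c(2) by (simp add: eq_fract)
    then show ?thesis using c by (simp add: cst_mon fract_poly_single)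
  qed
  then show ?case using c(2) by blast
next
  case (add p q)
  then obtain D p' E q' where *: "D \<noteq> 0" "cst (Fract D 1) * p = fract_poly p'"
    "E \<noteq> 0" "cst (Fract E 1) * q = fract_poly q'" by blast
  have "cst (Fract (D * E) 1) * (p + q) = cst (Fract E 1) * (cst (Fract D 1) * p) + cst (Fract D 1) * (cst (Fract E 1) * q)"
  proof -
    have eq: "cst (Fract (D * E) 1) = cst (Fract E 1) * cst (Fract D 1)" by (simp add: mult_single mult.commute)
    show ?thesis unfolding eq by (simp only: distrib_left mult.assoc mult.left_commute)
  qed
  also have "\<dots> = fract_poly (cst E * p' + cst D * q')"
    by (simp add: *(2,4) fract_poly_mult fract_poly_single addhom_add[OF addhom_fract_poly])
  finally show ?case using *(1,3) by (intro exI[of _ "D * E"]) auto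
qed

lemma common_denominator_family:
  fixes p :: "'i \<Rightarrow> (('n \<Rightarrow>\<^sub>0 nat) \<Rightarrow>\<^sub>0 'c::idom fract)"
  assumes "finite I"
  shows "\<exists>D. D \<noteq> 0 \<and> (\<forall>i\<in>I. \<exists>p'. cst (Fract D 1) * p i = fract_poly p')"
  using assms
proof (induction I)
  case empty
  show ?case by (intro exI[of _ 1]) simp
next
  case (insert i I)
  obtain D where D: "D \<noteq> 0" "\<And>k. k \<in> I \<Longrightarrow> \<exists>p'. cst (Fract D 1) * p k = fract_poly p'" using insert.IH by blast
  obtain E p' where E: "E \<noteq> 0" "cst (Fract E 1) * p i = fract_poly p'" using common_denominator[of "p i"] by blast
  have DE: "cst (Fract (D * E) 1) * x = cst (Fract E 1) * (cst (Fract D 1) * x)"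
    "cst (Fract (D * E) 1) * x = cst (Fract D 1) * (cst (Fract E 1) * x)" for x :: "('n \<Rightarrow>\<^sub>0 nat) \<Rightarrow>\<^sub>0 'c fract"
  proof -
    have eq: "cst (Fract (D * E) 1) = cst (Fract E 1) * cst (Fract D 1)"
      "cst (Fract (D * E) 1) = cst (Fract D 1) * cst (Fract E 1)"
      by (simp_all add: mult_single mult.commute)
    show "cst (Fract (D * E) 1) * x = cst (Fract E 1) * (cst (Fract D 1) * x)" by (simp only: eq(1) mult.assoc)
    show "cst (Fract (D * E) 1) * x = cst (Fract D 1) * (cst (Fract E 1) * x)" by (simp only: eq(2) mult.assoc)
  qed
  have "\<exists>p'. cst (Fract (D * E) 1) * p k = fract_poly p'" if "k \<in> insert i I" for k
  proof (cases "k = i")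
    case True
    then have "cst (Fract (D * E) 1) * p k = fract_poly (cst D * p')"
      by (simp add: DE(2) E(2) fract_poly_mult fract_poly_single)
    then show ?thesis by blast
  next
    case False
    then obtain p'' where "cst (Fract D 1) * p k = fract_poly p''" using D(2) \<open>k \<in> insert i I\<close> by blast
    then have "cst (Fract (D * E) 1) * p k = fract_poly (cst E * p'')"
      by (simp add: DE(1) fract_poly_mult fract_poly_single)
    then show ?thesis by blast
  qed
  then show ?case using D(1) E(1) by (intro exI[of _ "D * E"]) auto
qed

lemma fract_poly_toric_kernel:
  assumes "fract_poly t \<in> toric_kernel a"
  shows "t \<in> toric_kernel a"
proof -
  have "(\<lambda>t. toric_map a (fract_poly t)) = (\<lambda>t. fract_poly (toric_map a t))"
    by (rule addhom_eqI)
       (simp_all add: addhom_comp[OF addhom_toric_map addhom_fract_poly] addhom_comp[OF addhom_fract_poly addhom_toric_map]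
         fract_poly_single toric_map_single)
  from fun_cong[OF this, of t] have "fract_poly (toric_map a t) = 0" using assms by (simp add: toric_kernel_def)
  then show ?thesis using fract_poly_eq_0 by (simp add: toric_kernel_def)
qed

lemma fract_poly_euler_mult:
  fixes a :: "'n::{finite,linorder} \<Rightarrow> int ^ 'r" and p :: "('n \<Rightarrow>\<^sub>0 nat) \<Rightarrow>\<^sub>0 'n cpoly"
  shows "fract_poly (euler_mult a poly_var (\<lambda>i. mon 0 (c i)) i p) =
     euler_mult a ratfun_var (\<lambda>i. ratfun_const (c i)) i (fract_poly p)"
proof -
  have of_int: "Fract (of_int n * x) 1 = of_int n * Fract x 1" for n and x :: "'n cpoly"
    using addhom_of_int[OF addhom_Fract_1] .
  have form: "fract_poly (euler_form a poly_var i) = euler_form a ratfun_var i"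
    by (simp add: euler_form_def addhom_sum[OF addhom_fract_poly] fract_poly_single of_int ratfun_var_def)
  have "(\<lambda>p :: ('n \<Rightarrow>\<^sub>0 nat) \<Rightarrow>\<^sub>0 'n cpoly. fract_poly (euler_weight a i p)) = (\<lambda>p. euler_weight a i (fract_poly p))"
    by (rule addhom_eqI)
       (simp_all add: addhom_comp[OF addhom_euler_weight addhom_fract_poly] addhom_comp[OF addhom_fract_poly addhom_euler_weight]
         fract_poly_single euler_weight_single of_int)
  from fun_cong[OF this, of p] show ?thesis
    by (simp add: euler_mult_def addhom_add[OF addhom_fract_poly] addhom_diff[OF addhom_fract_poly] fract_poly_mult form
      fract_poly_single ratfun_const_def)
qed

text \<open>
  The data of a series \<open>\<Phi> = \<Sum>\<^sub>l \<Prod>\<^sub>j v\<^sub>j\<^bsup>\<gamma>\<^sub>j + l\<^sub>j\<^esup> / \<Gamma>(\<gamma>\<^sub>j + l\<^sub>j + 1)\<close> over \<open>l \<in> L\<close>. The points indexed by \<open>\<sigma>\<close> are independent.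
  In the application they lie on a face of the cone, and \<open>a\<^sub>k\<close> lies off the face. As \<open>\<gamma>\<^sub>j = 0\<close> outside \<open>\<sigma>\<close>, only terms with \<open>l\<^sub>j \<ge> 0\<close>
  there have nonzero coefficients. The assumption on \<open>l k\<close> is what the face provides: it says that
  then \<open>l\<^sub>k = 0\<close>.
\<close>

locale gamma_series =
  fixes a :: "'n::{finite,linorder} \<Rightarrow> int ^ 'r" and \<gamma> :: "'n \<Rightarrow> complex" and \<beta> :: "complex ^ 'r" and \<sigma> :: "'n set" and k :: 'n
  assumes weight: "\<And>i. (\<Sum>j\<in>UNIV. of_int (a j $ i) * \<gamma> j) = \<beta> $ i"
    and zero_outside: "\<And>j. j \<notin> \<sigma> \<Longrightarrow> \<gamma> j = 0"
    and no_pole: "\<And>j n. \<gamma> j \<noteq> - of_nat (Suc n)"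
    and independent: "\<And>l. l \<in> relation_lattice a \<Longrightarrow> (\<And>j. j \<notin> \<sigma> \<Longrightarrow> l j = 0) \<Longrightarrow> l = (\<lambda>_. 0)"
    and outside_face: "k \<notin> \<sigma>" "\<And>l. l \<in> relation_lattice a \<Longrightarrow> (\<And>j. j \<notin> \<sigma> \<Longrightarrow> l j \<ge> 0) \<Longrightarrow> l k \<le> 0"
begin

text \<open>
  The coefficient of \<open>v\<^bsup>\<gamma> + u\<^esup>\<close> in \<open>\<partial>\<^sup>m \<Phi>\<close>, which depends on \<open>m\<close> only through the point \<open>z = \<Sum> m\<^sub>j a\<^sub>j\<close>. The
  reciprocal Gamma function takes care of vanishing terms.
\<close>

definition gamma_coef :: "int ^ 'r \<Rightarrow> ('n \<Rightarrow> int) \<Rightarrow> complex" where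
  "gamma_coef z u = (if (\<Sum>j\<in>UNIV. u j *s a j) + z = 0 then \<Prod>j\<in>UNIV. rGamma (\<gamma> j + of_int (u j) + 1) else 0)"

lemma gamma_coef_nonzero:
  assumes "gamma_coef z u \<noteq> 0"
  shows "(\<Sum>j\<in>UNIV. u j *s a j) + z = 0" "\<And>j. j \<notin> \<sigma> \<Longrightarrow> u j \<ge> 0"
proof -
  show "(\<Sum>j\<in>UNIV. u j *s a j) + z = 0" using assms by (auto simp: gamma_coef_def split: if_splits)
  fix j assume j: "j \<notin> \<sigma>"
  have "rGamma (\<gamma> j + of_int (u j) + 1) \<noteq> 0" using assms by (auto simp: gamma_coef_def split: if_splits)
  then have nz: "rGamma (of_int (u j + 1) :: complex) \<noteq> 0" using zero_outside[OF j] by simp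
  show "u j \<ge> 0"
  proof (rule ccontr)
    assume "\<not> 0 \<le> u j"
    then have "(of_int (u j + 1) :: complex) = - of_nat (nat (- (u j + 1)))" by simp
    then show False using nz by (metis rGamma_eq_zero_iff minus_of_nat_in_nonpos_Ints)
  qed
qed

lemma gamma_coef_step:
  "gamma_coef (z + a j) (u(j := u j - 1)) = (\<gamma> j + of_int (u j)) * gamma_coef z u"
proof -
  have "(\<Sum>i\<in>UNIV. (u(j := u j - 1)) i *s a i) = (\<Sum>i\<in>UNIV. u i *s a i - (if i = j then a j else 0))"
    by (intro sum.cong refl) (auto simp: vector_sub_rdistrib)
  then have cond: "(\<Sum>i\<in>UNIV. (u(j := u j - 1)) i *s a i) + (z + a j) = (\<Sum>i\<in>UNIV. u i *s a i) + z"
    by (simp add: sum_subtractf)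
  have "(\<Prod>i\<in>UNIV. rGamma (\<gamma> i + of_int ((u(j := u j - 1)) i) + 1)) =
     rGamma (\<gamma> j + of_int (u j)) * (\<Prod>i\<in>UNIV - {j}. rGamma (\<gamma> i + of_int (u i) + 1))"
    by (subst prod.remove[of _ j]) auto
  also have "rGamma (\<gamma> j + of_int (u j)) = (\<gamma> j + of_int (u j)) * rGamma (\<gamma> j + of_int (u j) + 1)"
    by (simp add: rGamma_plus1)
  also have "\<dots> * (\<Prod>i\<in>UNIV - {j}. rGamma (\<gamma> i + of_int (u i) + 1)) =
      (\<gamma> j + of_int (u j)) * (\<Prod>i\<in>UNIV. rGamma (\<gamma> i + of_int (u i) + 1))"
    by (subst (2) prod.remove[of _ j]) auto
  finally show ?thesis unfolding gamma_coef_def cond by (simp del: fun_upd_apply)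
qed

text \<open>
  The coefficient of \<open>v\<^bsup>\<gamma> + u\<^esup>\<close> in \<open>P \<Phi>\<close>, for an operator \<open>P\<close> with polynomial coefficients given by its
  symbol. Working with coefficients avoids a module of formal series with complex exponents.
\<close>

definition coefficient_of_action :: "('n \<Rightarrow> int) \<Rightarrow> (('n \<Rightarrow>\<^sub>0 nat) \<Rightarrow>\<^sub>0 'n cpoly) \<Rightarrow> complex" where
  "coefficient_of_action u = ext (\<lambda>m. ext (\<lambda>e d. d * gamma_coef (point_sum a m) (\<lambda>j. u j - int (coef e j))))"

lemma addhom_coefficient_of_action: "addhom (coefficient_of_action u)"
  unfolding coefficient_of_action_def by (intro addhom_ext addhom_times_right addhom_id)

lemma coefficient_of_action_single:
  "coefficient_of_action u (mon m (mon e d)) = d * gamma_coef (point_sum a m) (\<lambda>j. u j - int (coef e j))"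
  unfolding coefficient_of_action_def by (simp add: ext_single ext_def[of _ 0])

lemma coefficient_of_action_mon:
  "coefficient_of_action u (mon m g) = ext (\<lambda>e d. d * gamma_coef (point_sum a m) (\<lambda>j. u j - int (coef e j))) g"
  unfolding coefficient_of_action_def by (simp add: ext_single ext_def[of _ 0])

lemma vanishes_on_monomials:
  fixes f :: "(('n \<Rightarrow>\<^sub>0 nat) \<Rightarrow>\<^sub>0 'n cpoly) \<Rightarrow> complex"
  assumes "addhom f" "\<And>m e d. f (mon m (mon e d)) = 0"
  shows "f p = 0"
proof (induction p rule: pm_induct)
  case (single m g)
  show ?case
    by (induction g rule: pm_induct) (simp_all add: assms single_add addhom_add[OF assms(1)])
qed (simp add: addhom_add[OF assms(1)])

text \<open>
  The action factors through the toric map, because \<open>gamma_coef\<close> depends on the point only.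
\<close>

lemma coefficient_of_action_toric_kernel:
  assumes "t \<in> toric_kernel a"
  shows "coefficient_of_action u t = 0"
proof -
  let ?F = "ext (\<lambda>z. ext (\<lambda>e d. d * gamma_coef z (\<lambda>j. u j - int (coef e j))))"
  have ah: "addhom ?F" by (intro addhom_ext addhom_times_right addhom_id)
  have "(\<lambda>t. coefficient_of_action u t) = (\<lambda>t. ?F (toric_map a t))"
    by (rule addhom_eqI) (simp_all add: addhom_coefficient_of_action addhom_comp[OF ah addhom_toric_map]
      coefficient_of_action_mon toric_map_single ext_single ext_def[of _ 0])
  from fun_cong[OF this, of t] show ?thesis using assms by (simp add: toric_kernel_def ext_def[of _ 0])
qed

lemma coefficient_of_action_euler_mult:
  "coefficient_of_action u (euler_mult a poly_var (\<lambda>i. mon 0 (\<beta> $ i)) i p) = 0"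
proof (rule vanishes_on_monomials[where f = "\<lambda>p. coefficient_of_action u (euler_mult a poly_var (\<lambda>i. mon 0 (\<beta> $ i)) i p)"])
  show "addhom (\<lambda>p. coefficient_of_action u (euler_mult a poly_var (\<lambda>i. mon 0 (\<beta> $ i)) i p))"
    by (intro addhom_comp[OF addhom_coefficient_of_action addhom_euler_mult])
  fix m e d
  define w where "w j = u j - int (coef e j)" for j
  let ?z = "point_sum a m"
  have 1: "of_int (a j $ i) * poly_var j * mon e d = mon (mon j 1 + e) (of_int (a j $ i) * d)" for j
    by (simp add: poly_var_def mult.assoc mult_single of_int_mon)
  have 2: "coefficient_of_action u (mon (mon j 1 + m) (mon (mon j 1 + e) (of_int (a j $ i) * d))) =
      d * (of_int (a j $ i) * (\<gamma> j + of_int (w j)) * gamma_coef ?z w)" for j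
  proof -
    have "(\<lambda>i. u i - int (coef (mon j 1 + e) i)) = w(j := w j - 1)"
      by (auto simp: w_def lookup_add lookup_single when_def)
    moreover have "point_sum a (mon j 1 + m) = ?z + a j" by (simp add: point_sum_add point_sum_single add.commute)
    ultimately show ?thesis
      by (simp add: coefficient_of_action_single gamma_coef_step del: fun_upd_apply)
  qed
  have "coefficient_of_action u (euler_mult a poly_var (\<lambda>i. mon 0 (\<beta> $ i)) i (mon m (mon e d))) =
     (\<Sum>j\<in>UNIV. d * (of_int (a j $ i) * (\<gamma> j + of_int (w j)) * gamma_coef ?z w)) +
     of_int (?z $ i) * d * gamma_coef ?z w - \<beta> $ i * d * gamma_coef ?z w"
    unfolding euler_mult_def euler_form_single euler_weight_single cst_mon
      addhom_add[OF addhom_coefficient_of_action] addhom_diff[OF addhom_coefficient_of_action]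
      addhom_sum[OF addhom_coefficient_of_action] 1
    unfolding 2 of_int_mon cst_mon
    unfolding coefficient_of_action_single w_def[symmetric] ..
  also have "\<dots> = d * gamma_coef ?z w * ((\<Sum>j\<in>UNIV. of_int (a j $ i) * (\<gamma> j + of_int (w j))) + of_int (?z $ i) - \<beta> $ i)"
    by (simp add: algebra_simps sum_distrib_left)
  also have "\<dots> = 0"
  proof (cases "gamma_coef ?z w = 0")
    case False
    have "((\<Sum>j\<in>UNIV. w j *s a j) + ?z) $ i = 0" using gamma_coef_nonzero(1)[OF False] by simp
    then have "(\<Sum>j\<in>UNIV. w j * a j $ i) + ?z $ i = 0" by simp
    then have "of_int ((\<Sum>j\<in>UNIV. w j * a j $ i) + ?z $ i) = (0 :: complex)" by simp
    then have "(\<Sum>j\<in>UNIV. of_int (a j $ i) * of_int (w j)) + of_int (?z $ i) = (0 :: complex)"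
      by (simp add: mult.commute)
    then show ?thesis using weight[of i] by (simp add: distrib_left sum.distrib algebra_simps)
  qed simp
  finally show "coefficient_of_action u (euler_mult a poly_var (\<lambda>i. mon 0 (\<beta> $ i)) i (mon m (mon e d))) = 0" .
qed

text \<open>
  A term of \<open>\<partial>\<^sub>k \<Phi>\<close> comes from some \<open>l \<in> L\<close> with \<open>l\<^sub>k > 0\<close> and \<open>l\<^sub>j \<ge> 0\<close> outside \<open>\<sigma>\<close>, and the face excludes this.
\<close>

lemma coefficient_of_action_xi: "coefficient_of_action u (xi k * p) = 0"
proof (rule vanishes_on_monomials[where f = "\<lambda>p. coefficient_of_action u (xi k * p)"])
  show "addhom (\<lambda>p. coefficient_of_action u (xi k * p))"
    by (intro addhom_comp[OF addhom_coefficient_of_action] addhom_times addhom_id)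
  fix m e d
  define w where "w j = u j - int (coef e j)" for j
  have "gamma_coef (point_sum a (mon k 1 + m)) w = 0"
  proof (rule ccontr)
    assume nz: "gamma_coef (point_sum a (mon k 1 + m)) w \<noteq> 0"
    define l where "l j = w j + int (coef (mon k 1 + m) j)" for j
    have "l \<in> relation_lattice a"
      using gamma_coef_nonzero(1)[OF nz]
      by (simp add: relation_lattice_def l_def point_sum_def vector_sadd_rdistrib sum.distrib)
    moreover have "l j \<ge> 0" if "j \<notin> \<sigma>" for j using gamma_coef_nonzero(2)[OF nz that] by (simp add: l_def)
    ultimately have "l k \<le> 0" by (rule outside_face(2))
    moreover have "w k \<ge> 0" using gamma_coef_nonzero(2)[OF nz] outside_face(1) by blast
    ultimately show False by (simp add: l_def lookup_add)
  qed
  then show "coefficient_of_action u (xi k * mon m (mon e d)) = 0"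
    by (simp add: xi_mon coefficient_of_action_single w_def[abs_def])
qed

text \<open>
  No nonzero polynomial \<open>D\<close> annihilates \<open>\<Phi>\<close>. Take an exponent \<open>e\<^sub>0\<close> of \<open>D\<close> that is least outside \<open>\<sigma>\<close>. The term
  \<open>v\<^bsup>\<gamma> + e\<^sub>0\<^esup>\<close> could also come from an exponent \<open>e\<close> with \<open>e\<^sub>0 - e \<in> L\<close>, but then \<open>e\<close> and \<open>e\<^sub>0\<close> agree outside \<open>\<sigma>\<close>, and
  independence gives \<open>e = e\<^sub>0\<close>.
\<close>

lemma coefficient_of_action_nonzero:
  assumes "D \<noteq> 0"
  shows "\<exists>u. coefficient_of_action u (cst D) \<noteq> 0"
proof -
  define \<omega> where "\<omega> e = (\<Sum>j\<in>- \<sigma>. coef e j)" for e :: "'n \<Rightarrow>\<^sub>0 nat"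
  have "supp D \<noteq> {}" using assms by simp
  then obtain e0 where e0: "e0 \<in> supp D" "\<And>e. e \<in> supp D \<Longrightarrow> \<omega> e0 \<le> \<omega> e"
    by (metis arg_min_least finite_keys arg_min_if_finite(1))
  define u where "u j = int (coef e0 j)" for j
  have "gamma_coef 0 (\<lambda>j. u j - int (coef e j)) = 0" if e: "e \<in> supp D" "e \<noteq> e0" for e
  proof (rule ccontr)
    assume nz: "gamma_coef 0 (\<lambda>j. u j - int (coef e j)) \<noteq> 0"
    define l where "l j = u j - int (coef e j)" for j
    have l: "l \<in> relation_lattice a" using gamma_coef_nonzero(1)[OF nz] by (simp add: relation_lattice_def l_def)
    have le: "coef e j \<le> coef e0 j" if "j \<notin> \<sigma>" for j
      using gamma_coef_nonzero(2)[OF nz that] by (simp add: u_def)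
    have "coef e j = coef e0 j" if j: "j \<notin> \<sigma>" for j
    proof (rule ccontr)
      assume "coef e j \<noteq> coef e0 j"
      then have "coef e j < coef e0 j" using le[OF j] by simp
      then have "\<omega> e < \<omega> e0"
        unfolding \<omega>_def using le j by (intro sum_strict_mono_ex1) auto
      then show False using e0(2)[OF e(1)] by simp
    qed
    then have "l j = 0" if "j \<notin> \<sigma>" for j using that by (simp add: l_def u_def)
    then have "l = (\<lambda>_. 0)" using independent[OF l] by blast
    then have "coef e j = coef e0 j" for j by (simp add: l_def u_def fun_eq_iff)
    then show False using e(2) by (metis poly_mapping_eqI)
  qed
  then have "coefficient_of_action u (cst D) = (\<Sum>e\<in>supp D. if e = e0 then coef D e0 * gamma_coef 0 (\<lambda>_. 0) else 0)"
    unfolding coefficient_of_action_mon ext_def by (intro sum.cong refl) (auto simp: u_def)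
  also have "\<dots> = coef D e0 * gamma_coef 0 (\<lambda>_. 0)" using e0(1) by simp
  also have "\<dots> \<noteq> 0"
  proof -
    have "rGamma (\<gamma> j + 1) \<noteq> 0" for j
    proof
      assume "rGamma (\<gamma> j + 1) = 0"
      then have "\<gamma> j + 1 \<in> \<int>\<^sub>\<le>\<^sub>0" by (simp add: rGamma_eq_zero_iff)
      then obtain n where "\<gamma> j + 1 = - of_nat n" by (auto elim: nonpos_Ints_cases')
      then have "\<gamma> j = - of_nat (Suc n)" by (simp add: eq_diff_eq[symmetric])
      then show False using no_pole by blast
    qed
    then show ?thesis using e0(1) by (simp add: gamma_coef_def in_keys_iff)
  qed
  finally show ?thesis by blast
qed

text \<open>
  Otherwise \<open>1\<close> is a sum of \<open>\<xi>\<^sub>k q\<close> and an element of \<open>hypergeom_symbols a \<beta>\<close>. Multiply this equation by a common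
  denominator \<open>D\<close> and apply both sides to \<open>\<Phi>\<close>: the sum annihilates \<open>\<Phi>\<close>, but \<open>D \<Phi> \<noteq> 0\<close>.
\<close>

lemma one_notin_hypergeom_symbols_plus_xi: "1 - xi k * q \<notin> hypergeom_symbols a \<beta>"
proof
  assume "1 - xi k * q \<in> hypergeom_symbols a \<beta>"
  then obtain t p where tp: "t \<in> toric_kernel a"
    "1 - xi k * q = t + (\<Sum>i\<in>UNIV. euler_mult a ratfun_var (\<lambda>i. ratfun_const (\<beta> $ i)) i (p i))"
    by (auto simp: hypergeom_symbols_def euler_ideal_def)
  define fam where "fam x = (case x of Inl i \<Rightarrow> p i | Inr b \<Rightarrow> if b then t else q)" for x
  obtain D where D: "D \<noteq> 0" "\<And>x. \<exists>p'. cst (Fract D 1) * fam x = fract_poly p'"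
    using common_denominator_family[of "UNIV :: ('r + bool) set" fam] by auto
  have "\<forall>x. \<exists>p'. cst (Fract D 1) * fam x = fract_poly p'" using D(2) by blast
  then obtain f where f: "\<And>x. cst (Fract D 1) * fam x = fract_poly (f x)" by metis
  have p: "cst (Fract D 1) * p i = fract_poly (f (Inl i))" for i using f[of "Inl i"] by (simp add: fam_def)
  have t: "cst (Fract D 1) * t = fract_poly (f (Inr True))" using f[of "Inr True"] by (simp add: fam_def)
  have q: "cst (Fract D 1) * q = fract_poly (f (Inr False))" using f[of "Inr False"] by (simp add: fam_def)
  let ?E = "euler_mult a poly_var (\<lambda>i. mon 0 (\<beta> $ i))"
  have "fract_poly (cst D - xi k * f (Inr False) - (f (Inr True) + (\<Sum>i\<in>UNIV. ?E i (f (Inl i))))) =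
    cst (Fract D 1) * (1 - xi k * q - (t + (\<Sum>i\<in>UNIV. euler_mult a ratfun_var (\<lambda>i. ratfun_const (\<beta> $ i)) i (p i))))"
  proof -
    have xi: "fract_poly (xi k :: ('n \<Rightarrow>\<^sub>0 nat) \<Rightarrow>\<^sub>0 'n cpoly) = xi k"
      by (simp add: xi_def fract_poly_single One_fract_def)
    show ?thesis
      by (simp add: addhom_add[OF addhom_fract_poly] addhom_diff[OF addhom_fract_poly] addhom_sum[OF addhom_fract_poly]
        fract_poly_euler_mult fract_poly_mult fract_poly_single xi p[symmetric] t[symmetric] q[symmetric]
        euler_mult_cst right_diff_distrib distrib_left sum_distrib_left mult.left_commute)
  qed
  then have "fract_poly (cst D - xi k * f (Inr False) - (f (Inr True) + (\<Sum>i\<in>UNIV. ?E i (f (Inl i))))) = 0"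
    by (simp add: tp(2))
  from fract_poly_eq_0[OF this]
  have D_eq: "cst D = xi k * f (Inr False) + (f (Inr True) + (\<Sum>i\<in>UNIV. ?E i (f (Inl i))))"
    by (simp add: algebra_simps)
  have "f (Inr True) \<in> toric_kernel a"
    using ring_idealD(3)[OF ring_ideal_toric_kernel tp(1), of "cst (Fract D 1)"] unfolding t by (rule fract_poly_toric_kernel)
  then have "coefficient_of_action u (cst D) = 0" for u
    unfolding D_eq addhom_add[OF addhom_coefficient_of_action] addhom_sum[OF addhom_coefficient_of_action]
    by (simp add: coefficient_of_action_xi coefficient_of_action_toric_kernel coefficient_of_action_euler_mult)
  then show False using coefficient_of_action_nonzero[OF D(1)] by blast
qed

end


section \<open>Regular sequences in Cohen-Macaulay quotients\<close>

lemma cpoly_ring_simps [simp]: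
  "carrier cpoly_ring = UNIV" "x \<otimes>\<^bsub>cpoly_ring\<^esub> y = x * y" "x \<oplus>\<^bsub>cpoly_ring\<^esub> y = x + y"
  "\<one>\<^bsub>cpoly_ring\<^esub> = 1" "\<zero>\<^bsub>cpoly_ring\<^esub> = 0"
  by (simp_all add: cpoly_ring_def)

lemma cring_cpoly_ring: "cring (cpoly_ring :: 'n cpoly ring)"
proof (rule cringI)
  show "abelian_group (cpoly_ring :: 'n cpoly ring)"
  proof (rule abelian_groupI)
    show "\<exists>y\<in>carrier cpoly_ring. y \<oplus>\<^bsub>cpoly_ring\<^esub> x = \<zero>\<^bsub>cpoly_ring\<^esub>" for x :: "'n cpoly"
      by (rule bexI[of _ "- x"]) simp_all
  qed (simp_all add: algebra_simps)
  show "Group.comm_monoid (cpoly_ring :: 'n cpoly ring)"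
    by (rule comm_monoidI) (simp_all add: algebra_simps)
qed (simp add: algebra_simps)

lemma ideal_cpoly_ring_iff: "ideal M cpoly_ring \<longleftrightarrow> ring_ideal M"
proof
  assume "ideal M cpoly_ring"
  then interpret M: ideal M cpoly_ring .
  show "ring_ideal M"
    unfolding ring_ideal_def
    using additive_subgroup.zero_closed[OF M.is_additive_subgroup] additive_subgroup.a_closed[OF M.is_additive_subgroup]
      M.I_l_closed by simp
next
  interpret cring cpoly_ring by (rule cring_cpoly_ring)
  assume M: "ring_ideal M"
  note I = ring_idealD[OF M]
  have minus: "\<ominus>\<^bsub>cpoly_ring\<^esub> x = - x" for x :: "'a cpoly"
    by (rule minus_equality) simp_all
  show "ideal M cpoly_ring"
  proof (rule idealI)
    show "ring cpoly_ring" by (rule ring_axioms)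
    show "subgroup M (add_monoid cpoly_ring)"
      by (rule add.subgroupI) (use I minus in \<open>auto simp: a_inv_def[symmetric]\<close>)
  qed (use I in auto)
qed

text \<open>
  The dictionary between \<open>\<complex>[\<xi>] / I\<close> as a ring of cosets and ideals of \<open>\<complex>[\<xi>]\<close> that contain \<open>I\<close>.
\<close>

locale cpoly_quotient =
  fixes I :: "'n::linorder cpoly set"
  assumes ring_ideal_I: "ring_ideal I"
begin

sublocale R: cring "cpoly_ring :: 'n cpoly ring"
  by (rule cring_cpoly_ring)

sublocale I: ideal I cpoly_ring
  using ring_ideal_I by (simp add: ideal_cpoly_ring_iff)

abbreviation "Q \<equiv> cpoly_ring Quot I"
abbreviation residue :: "'n cpoly \<Rightarrow> 'n cpoly set" where "residue x \<equiv> I +>\<^bsub>cpoly_ring\<^esub> x"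

sublocale Q: cring Q
  by (rule I.quotient_is_cring) (rule R.cring_axioms)

lemma residue_eq_iff: "residue x = residue y \<longleftrightarrow> x - y \<in> I"
proof -
  note I = ring_idealD[OF ring_ideal_I]
  have res: "residue z = {i + z | i. i \<in> I}" for z
    by (auto simp: a_r_coset_def')
  show ?thesis
  proof
    assume "residue x = residue y"
    moreover have "x \<in> residue x" unfolding res using I(1) by force
    ultimately obtain i where "x = i + y" "i \<in> I" unfolding res by blast
    then show "x - y \<in> I" by simp
  next
    assume d: "x - y \<in> I"
    have "i + x \<in> residue y" if "i \<in> I" for i
    proof -
      have "i + x = (i + (x - y)) + y" by simp
      then show ?thesis unfolding res using I(2)[OF that d] by blast
    qed
    moreover have "i + y \<in> residue x" if "i \<in> I" for i
    proof -
      have "i + y = (i - (x - y)) + x" by simp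
      then show ?thesis unfolding res using I(6)[OF that d] by blast
    qed
    ultimately show "residue x = residue y" by (auto simp: res)
  qed
qed

lemma residue_hom: "residue (x + y) = residue x \<oplus>\<^bsub>Q\<^esub> residue y" "residue (x * y) = residue x \<otimes>\<^bsub>Q\<^esub> residue y"
  using ring_hom_add[OF I.rcos_ring_hom, of x y] ring_hom_mult[OF I.rcos_ring_hom, of x y] by simp_all

lemma carrier_Q: "carrier Q = range residue"
  by (auto simp: FactRing_def A_RCOSETS_def')

lemma residue_image_iff:
  assumes "ring_ideal M" "I \<subseteq> M"
  shows "residue x \<in> residue ` M \<longleftrightarrow> x \<in> M"
proof
  assume "residue x \<in> residue ` M"
  then obtain y where y: "y \<in> M" "x - y \<in> I" by (auto simp: residue_eq_iff)
  have "(x - y) + y \<in> M" using ring_idealD(2)[OF assms(1)] assms(2) y by blast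
  then show "x \<in> M" by simp
qed simp

lemma ideal_residue_image: "ring_ideal M \<Longrightarrow> ideal (residue ` M) Q"
  using R.ring_ideal_imp_quot_ideal[OF I.ideal_axioms, of M] by (simp add: ideal_cpoly_ring_iff)

lemma ring_ideal_residue_vimage:
  assumes "ideal J Q"
  shows "ring_ideal {x. residue x \<in> J}" "I \<subseteq> {x. residue x \<in> J}"
proof -
  interpret J: ideal J Q by (rule assms)
  have zero: "residue i = \<zero>\<^bsub>Q\<^esub>" if "i \<in> I" for i
  proof -
    have "residue i = residue 0" using that by (simp add: residue_eq_iff)
    also have "\<dots> = \<zero>\<^bsub>Q\<^esub>" by (auto simp: FactRing_def a_r_coset_def')
    finally show ?thesis .
  qed
  note J0 = additive_subgroup.zero_closed[OF J.is_additive_subgroup] and Ja = additive_subgroup.a_closed[OF J.is_additive_subgroup]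
  show "I \<subseteq> {x. residue x \<in> J}" using zero J0 by auto
  show "ring_ideal {x. residue x \<in> J}"
    unfolding ring_ideal_def
    using zero[OF ring_idealD(1)[OF ring_ideal_I]] J0 Ja J.I_l_closed
    by (auto simp: residue_hom carrier_Q)
qed

lemma primeideal_residue_image:
  assumes M: "ring_ideal M" "I \<subseteq> M" "1 \<notin> M" and prime: "\<And>x y. x * y \<in> M \<Longrightarrow> x \<in> M \<or> y \<in> M"
  shows "primeideal (residue ` M) Q"
proof (rule primeidealI)
  show "ideal (residue ` M) Q" by (rule ideal_residue_image[OF M(1)])
  show "cring Q" by (rule Q.cring_axioms)
  show "carrier Q \<noteq> residue ` M"
    using residue_image_iff[OF M(1,2), of 1] M(3) by (auto simp: carrier_Q)
  fix x y assume xy: "x \<in> carrier Q" "y \<in> carrier Q" "x \<otimes>\<^bsub>Q\<^esub> y \<in> residue ` M"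
  then obtain p q where pq: "x = residue p" "y = residue q" by (auto simp: carrier_Q)
  then have "p * q \<in> M" using xy(3) residue_image_iff[OF M(1,2)] by (simp add: residue_hom[symmetric])
  then show "x \<in> residue ` M \<or> y \<in> residue ` M" using prime pq by blast
qed

lemma maximalideal_residue_image:
  assumes M: "M = {p. coef p 0 = 0}" "ring_ideal M" "I \<subseteq> M"
  shows "maximalideal (residue ` M) Q"
proof (rule maximalidealI)
  have "1 \<notin> M" by (simp add: M(1) lookup_one)
  then show "carrier Q \<noteq> residue ` M"
    using residue_image_iff[OF M(2,3), of 1] by (auto simp: carrier_Q)
  show "ideal (residue ` M) Q" by (rule ideal_residue_image[OF M(2)])
  fix J assume J: "ideal J Q" "residue ` M \<subseteq> J" "J \<subseteq> carrier Q"
  define V where "V = {x. residue x \<in> J}"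
  have V: "ring_ideal V" unfolding V_def by (rule ring_ideal_residue_vimage[OF J(1)])
  have MV: "M \<subseteq> V" using J(2) by (auto simp: V_def)
  have JV: "J = residue ` V" using J(3) by (auto simp: V_def carrier_Q)
  show "J = residue ` M \<or> J = carrier Q"
  proof (cases "V \<subseteq> M")
    case True
    then show ?thesis using MV JV by auto
  next
    case False
    then obtain x where x: "x \<in> V" "coef x 0 \<noteq> 0" by (auto simp: M(1))
    have "x - cst (coef x 0) \<in> M" by (simp add: M(1) lookup_minus)
    then have "x - (x - cst (coef x 0)) \<in> V" using ring_idealD(6)[OF V x(1)] MV by blast
    then have "cst (inverse (coef x 0)) * cst (coef x 0) \<in> V" using ring_idealD(3)[OF V] by simp
    then have "1 \<in> V" using x(2) by (simp add: mult_single)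
    then have "V = UNIV" using ring_idealD(4)[OF V, of 1] by auto
    then show ?thesis using JV by (simp add: carrier_Q)
  qed
qed

text \<open>
  The preimage in \<open>\<complex>[\<xi>]\<close> of the ideal generated by the first \<open>k\<close> members of a sequence.
\<close>

definition sequence_ideal :: "(nat \<Rightarrow> 'n cpoly) \<Rightarrow> nat \<Rightarrow> 'n cpoly set" where
  "sequence_ideal f k = {t + (\<Sum>i<k. f i * q i) | t q. t \<in> I}"

lemma sequence_idealI: "t \<in> I \<Longrightarrow> p = t + (\<Sum>i<k. f i * q i) \<Longrightarrow> p \<in> sequence_ideal f k"
  by (auto simp: sequence_ideal_def)

lemma ring_ideal_sequence_ideal: "ring_ideal (sequence_ideal f k)"
  unfolding ring_ideal_def
proof (intro conjI ballI allI)
  note T = ring_idealD[OF ring_ideal_I]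
  show "0 \<in> sequence_ideal f k" by (rule sequence_idealI[OF T(1), where q = "\<lambda>_. 0"]) simp
  fix x assume "x \<in> sequence_ideal f k"
  then obtain t q where x: "x = t + (\<Sum>i<k. f i * q i)" "t \<in> I" by (auto simp: sequence_ideal_def)
  show "b * x \<in> sequence_ideal f k" for b
    by (rule sequence_idealI[OF T(3)[OF x(2), of b], where q = "\<lambda>i. b * q i"])
       (simp add: x distrib_left sum_distrib_left mult_ac)
  fix y assume "y \<in> sequence_ideal f k"
  then obtain t' q' where y: "y = t' + (\<Sum>i<k. f i * q' i)" "t' \<in> I" by (auto simp: sequence_ideal_def)
  show "x + y \<in> sequence_ideal f k"
    by (rule sequence_idealI[OF T(2)[OF x(2) y(2)], where q = "\<lambda>i. q i + q' i"])
       (simp add: x y distrib_left sum.distrib)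
qed

lemma genideal_take_eq:
  assumes "k \<le> length xs" "\<And>i. i < length xs \<Longrightarrow> xs ! i = residue (f i)"
  shows "genideal Q (set (take k xs)) = residue ` sequence_ideal f k"
proof
  have take: "set (take k xs) = (\<lambda>i. residue (f i)) ` {..<k}"
  proof -
    have "take k xs = map (\<lambda>i. residue (f i)) [0..<k]"
      using assms by (intro nth_equalityI) auto
    then show ?thesis by (simp add: atLeast0LessThan)
  qed
  have f: "f i \<in> sequence_ideal f k" if "i < k" for i
  proof (rule sequence_idealI[OF ring_idealD(1)[OF ring_ideal_I], where q = "\<lambda>l. if l = i then 1 else 0"])
    have "(\<Sum>l<k. f l * (if l = i then 1 else 0)) = (\<Sum>l<k. if l = i then f i else 0)" by (intro sum.cong) auto
    then show "f i = 0 + (\<Sum>l<k. f l * (if l = i then 1 else 0))" using that by simp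
  qed
  then show "genideal Q (set (take k xs)) \<subseteq> residue ` sequence_ideal f k"
    unfolding take by (intro Q.genideal_minimal ideal_residue_image ring_ideal_sequence_ideal) auto
  show "residue ` sequence_ideal f k \<subseteq> genideal Q (set (take k xs))"
    unfolding genideal_def
  proof (rule Inter_greatest)
    fix J assume "J \<in> {J. ideal J Q \<and> set (take k xs) \<subseteq> J}"
    then have J: "ideal J Q" "set (take k xs) \<subseteq> J" by auto
    define V where "V = {x. residue x \<in> J}"
    note V = ring_idealD[OF ring_ideal_residue_vimage(1)[OF J(1), folded V_def]]
    have "I \<subseteq> V" unfolding V_def by (rule ring_ideal_residue_vimage(2)[OF J(1)])
    moreover have "f i \<in> V" if "i < k" for i using J(2) that unfolding take V_def by blast
    ultimately have "sequence_ideal f k \<subseteq> V"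
      unfolding sequence_ideal_def
      by (auto intro!: V(2,4) ring_ideal_sum[OF ring_ideal_residue_vimage(1)[OF J(1), folded V_def]])
    then show "residue ` sequence_ideal f k \<subseteq> J" by (auto simp: V_def)
  qed
qed

lemma regular_sequence_lift:
  assumes "regular_sequence Q xs" "set xs \<subseteq> residue ` M"
  shows "\<exists>f. \<forall>i<length xs. f i \<in> M \<and> (\<forall>y. f i * y \<in> sequence_ideal f i \<longrightarrow> y \<in> sequence_ideal f i)"
proof -
  have "\<forall>i. \<exists>p. i < length xs \<longrightarrow> p \<in> M \<and> xs ! i = residue p" using assms(2) nth_mem by blast
  then obtain f where f: "\<And>i. i < length xs \<Longrightarrow> f i \<in> M \<and> xs ! i = residue (f i)" by metis
  have sub: "I \<subseteq> sequence_ideal f k" for k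
    using sequence_idealI[where q = "\<lambda>_. 0"] by fastforce
  have "y \<in> sequence_ideal f i" if i: "i < length xs" and y: "f i * y \<in> sequence_ideal f i" for i y
  proof -
    have gen: "genideal Q (set (take i xs)) = residue ` sequence_ideal f i"
      by (rule genideal_take_eq) (use i f in auto)
    have "xs ! i \<otimes>\<^bsub>Q\<^esub> residue y \<in> genideal Q (set (take i xs))"
      using y f[OF i] by (simp add: gen residue_hom[symmetric])
    moreover have "residue y \<in> carrier Q" by (simp add: carrier_Q)
    ultimately have "residue y \<in> residue ` sequence_ideal f i"
      using assms(1) i unfolding regular_sequence_def gen[symmetric] by blast
    then show ?thesis using residue_image_iff[OF ring_ideal_sequence_ideal sub] by blast
  qed
  with f show ?thesis by blast
qed

end

lemma enat_le_SupD: "enat n \<le> Sup S \<Longrightarrow> 0 < n \<Longrightarrow> \<exists>x\<in>S. enat n \<le> x"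
proof -
  assume "enat n \<le> Sup S" "0 < n"
  then have "enat (n - 1) < Sup S" by (metis diff_less enat_ord_simps(2) less_le_trans zero_less_one)
  then obtain x where "x \<in> S" "enat (n - 1) < x" by (auto simp: less_Sup_iff)
  moreover have "enat n \<le> x" using \<open>enat (n - 1) < x\<close> \<open>0 < n\<close> by (cases x) auto
  ultimately show ?thesis by blast
qed

text \<open>
  The chain of primes bounds the height of the maximal ideal from below, and by the Cohen-Macaulay
  property the height equals the depth.
\<close>

lemma (in cpoly_quotient) Cohen_Macaulay_regular_sequence:
  assumes CM: "Cohen_Macaulay Q" and M: "M = {p. coef p 0 = 0}" "ring_ideal M" "I \<subseteq> M"
    and chain: "\<And>i. i \<le> r \<Longrightarrow> ring_ideal (c i) \<and> I \<subseteq> c i \<and> 1 \<notin> c i \<and> (\<forall>x y. x * y \<in> c i \<longrightarrow> x \<in> c i \<or> y \<in> c i)"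
      "\<And>i. i < r \<Longrightarrow> c i \<subset> c (Suc i)" "c r = M" and r: "0 < r"
  shows "\<exists>f. \<forall>i<r. f i \<in> M \<and> (\<forall>y. f i * y \<in> sequence_ideal f i \<longrightarrow> y \<in> sequence_ideal f i)"
proof -
  have "enat r \<le> prime_height Q (residue ` M)"
    unfolding prime_height_def
  proof (rule Sup_upper, intro CollectI exI conjI)
    show "enat r = enat r" by (rule refl)
    show "\<forall>i\<le>r. primeideal (residue ` c i) Q" using chain(1) primeideal_residue_image by blast
    show "\<forall>i<r. residue ` c i \<subset> residue ` c (Suc i)"
    proof (intro allI impI)
      fix i assume i: "i < r"
      then obtain x where x: "x \<in> c (Suc i)" "x \<notin> c i" using chain(2) by blast
      have "residue x \<notin> residue ` c i" using residue_image_iff[of "c i"] chain(1)[of i] x i by auto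
      then show "residue ` c i \<subset> residue ` c (Suc i)" using x(1) chain(2)[OF i] by blast
    qed
    show "residue ` c r = residue ` M" by (simp add: chain(3))
  qed
  also have "prime_height Q (residue ` M) = ideal_depth Q (residue ` M)"
    using CM maximalideal_residue_image[OF M] by (simp add: Cohen_Macaulay_def)
  finally obtain xs where xs: "regular_sequence Q xs" "set xs \<subseteq> residue ` M" "r \<le> length xs"
    using enat_le_SupD[OF _ r] unfolding ideal_depth_def by fastforce
  from regular_sequence_lift[OF xs(1,2)] xs(3) show ?thesis by (meson less_le_trans)
qed


section \<open>A chain of primes over the toric ideal\<close>

lemma prod_poly_var_powers: "(\<Prod>j\<in>A. poly_var j ^ e j) = mon (\<Sum>j\<in>A. mon j (e j)) 1" if "finite A"
  using that
proof (induction A)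
  case empty
  show ?case by simp
next
  case (insert j A)
  have "poly_var j ^ n = mon (mon j n) 1" for n
  proof -
    have "(\<Sum>_<n. mon j 1) = (mon j n :: 'a \<Rightarrow>\<^sub>0 nat)"
      by (rule poly_mapping_eqI) (simp add: lookup_sum lookup_single when_def)
    then show ?thesis by (simp add: poly_var_def mon_power)
  qed
  then show ?case using insert by (simp add: mult_single)
qed

lemma box_poly_eq:
  "box_poly l = mon (exponent (\<lambda>j. nat (l j))) 1 - mon (exponent (\<lambda>j. nat (- l j))) 1"
proof -
  have 1: "(\<Sum>j | 0 < l j. mon j (nat (l j))) = exponent (\<lambda>j. nat (l j))"
    unfolding exponent_def by (intro sum.mono_neutral_left) auto
  have 2: "(\<Sum>j | l j < 0. mon j (nat (- l j))) = exponent (\<lambda>j. nat (- l j))"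
    unfolding exponent_def by (intro sum.mono_neutral_left) auto
  show ?thesis by (simp add: box_poly_def prod_poly_var_powers 1 2)
qed

lemma toric_ideal_eq:
  fixes a :: "'n::{finite,linorder} \<Rightarrow> int ^ 'r"
  shows "toric_ideal a = toric_kernel a"
proof
  show "toric_ideal a \<subseteq> toric_kernel a"
    unfolding toric_ideal_def genideal_def
    by (rule Inter_lower)
       (auto simp: ideal_cpoly_ring_iff ring_ideal_toric_kernel box_poly_eq box_in_toric_kernel)
  show "toric_kernel a \<subseteq> toric_ideal a"
    unfolding toric_ideal_def genideal_def
  proof (rule Inter_greatest, rule subsetI)
    fix M and p :: "'n cpoly" assume "M \<in> {I. ideal I cpoly_ring \<and> box_poly ` relation_lattice a \<subseteq> I}" and p: "p \<in> toric_kernel a"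
    then have M: "ring_ideal M" "box_poly ` relation_lattice a \<subseteq> M" by (auto simp: ideal_cpoly_ring_iff)
    note I = ring_idealD[OF M(1)]
    show "p \<in> M"
      using I(1,2) _ p
    proof (rule toric_kernel_generated)
      fix u c l assume "l \<in> relation_lattice a"
      then have "box_poly l \<in> M" using M(2) by blast
      then show "mon u c * (mon (exponent (\<lambda>j. nat (l j))) 1 - mon (exponent (\<lambda>j. nat (- l j))) 1) \<in> M"
        unfolding box_poly_eq by (rule I(3))
    qed
  qed
qed

text \<open>
  The first \<open>s\<close> coordinates of a point with respect to the linear forms \<open>g 0, g 1, \<dots>\<close>. The homomorphism
  that forgets the other coordinates takes values in a monoid algebra without zero divisors, so its
  kernel \<open>weight_prime\<close> is a prime ideal over the toric kernel. Real exponents avoid the choice of an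
  integral basis.
\<close>

definition truncated_weight :: "(nat \<Rightarrow> real ^ 'r \<Rightarrow> real) \<Rightarrow> nat \<Rightarrow> int ^ 'r \<Rightarrow> (nat \<Rightarrow>\<^sub>0 real)" where
  "truncated_weight g s z = (\<Sum>i<s. mon i (g i (real_point z)))"

lemma coef_truncated_weight: "coef (truncated_weight g s z) i = (if i < s then g i (real_point z) else 0)"
  by (simp add: truncated_weight_def lookup_sum lookup_single when_def)

definition weight_map :: "(nat \<Rightarrow> real ^ 'r \<Rightarrow> real) \<Rightarrow> nat \<Rightarrow> (int ^ 'r \<Rightarrow>\<^sub>0 complex) \<Rightarrow> ((nat \<Rightarrow>\<^sub>0 real) \<Rightarrow>\<^sub>0 complex)" where
  "weight_map g s = ext (\<lambda>z. mon (truncated_weight g s z))"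

lemma addhom_weight_map: "addhom (weight_map g s)"
  unfolding weight_map_def by (intro addhom_ext addhom_mon)

lemma weight_map_single: "weight_map g s (mon z c) = mon (truncated_weight g s z) c"
  unfolding weight_map_def by (rule ext_single) simp

lemma real_point_add: "real_point (x + y) = real_point x + real_point y"
  by (simp add: real_point_def vec_eq_iff)

lemma weight_map_mult:
  assumes "\<And>i. linear (g i)"
  shows "weight_map g s (p * q) = weight_map g s p * weight_map g s q"
proof (induction p rule: pm_induct)
  case (single u c)
  have t: "truncated_weight g s (x + y) = truncated_weight g s x + truncated_weight g s y" for x y
    by (rule poly_mapping_eqI) (simp add: coef_truncated_weight lookup_add real_point_add linear_add[OF assms])
  show ?case
    by (induction q rule: pm_induct)
       (simp_all add: mult_single weight_map_single t distrib_left addhom_add[OF addhom_weight_map])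
qed (simp add: distrib_right addhom_add[OF addhom_weight_map])

definition weight_prime :: "('n::finite \<Rightarrow> int ^ 'r) \<Rightarrow> (nat \<Rightarrow> real ^ 'r \<Rightarrow> real) \<Rightarrow> nat \<Rightarrow> 'n cpoly set" where
  "weight_prime a g s = {p. weight_map g s (toric_map a p) = 0}"

lemma weight_prime:
  assumes "\<And>i. linear (g i)"
  shows "ring_ideal (weight_prime a g s)" "toric_kernel a \<subseteq> weight_prime a g s" "1 \<notin> weight_prime a g s"
    "p * q \<in> weight_prime a g s \<Longrightarrow> p \<in> weight_prime a g s \<or> q \<in> weight_prime a g s"
proof -
  have add: "addhom (\<lambda>p. weight_map g s (toric_map a p))" by (rule addhom_comp[OF addhom_weight_map addhom_toric_map])
  show "ring_ideal (weight_prime a g s)"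
    unfolding ring_ideal_def weight_prime_def
    by (auto simp: toric_map_mult weight_map_mult[OF assms] addhom_add[OF add] addhom_zero[OF add])
  show "toric_kernel a \<subseteq> weight_prime a g s"
    by (auto simp: weight_prime_def toric_kernel_def addhom_zero[OF addhom_weight_map])
  have "weight_map g s (toric_map a (mon 0 1)) \<noteq> 0"
    by (simp only: toric_map_single weight_map_single) (metis lookup_single_eq lookup_zero one_neq_zero)
  then show "1 \<notin> weight_prime a g s" by (simp add: weight_prime_def)
  show "p * q \<in> weight_prime a g s \<Longrightarrow> p \<in> weight_prime a g s \<or> q \<in> weight_prime a g s"
    by (simp add: weight_prime_def toric_map_mult weight_map_mult[OF assms])
qed

lemma weight_prime_mono: "weight_prime a g (Suc s) \<subseteq> weight_prime a g s"
proof
  fix p assume p: "p \<in> weight_prime a g (Suc s)"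
  define F where "F = ext (\<lambda>x. mon (\<Sum>i<s. mon i (coef x i)) :: complex \<Rightarrow> ((nat \<Rightarrow>\<^sub>0 real) \<Rightarrow>\<^sub>0 complex))"
  have ahF: "addhom F" unfolding F_def by (intro addhom_ext addhom_mon)
  have F: "F (mon x c) = mon (\<Sum>i<s. mon i (coef x i)) c" for x c unfolding F_def by (rule ext_single) simp
  have t: "(\<Sum>i<s. mon i (coef (truncated_weight g (Suc s) z) i)) = truncated_weight g s z" for z
    unfolding truncated_weight_def[of g s] by (intro sum.cong) (auto simp: coef_truncated_weight)
  have "(\<lambda>q. F (weight_map g (Suc s) q)) = (\<lambda>q. weight_map g s q)"
    by (rule addhom_eqI) (simp_all add: addhom_comp[OF ahF addhom_weight_map] addhom_weight_map F weight_map_single t)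
  from fun_cong[OF this, of "toric_map a p"] show "p \<in> weight_prime a g s"
    using p by (simp add: weight_prime_def addhom_zero[OF ahF])
qed

lemma integral_span_imp_real_span:
  fixes a :: "'n::finite \<Rightarrow> int ^ 'r"
  assumes "\<forall>z :: int ^ 'r. \<exists>c :: 'n \<Rightarrow> int. z = (\<Sum>j\<in>UNIV. c j *s a j)"
  shows "span (range (\<lambda>j. real_point (a j))) = UNIV"
proof -
  let ?S = "span (range (\<lambda>j. real_point (a j)))"
  have ax: "axis i 1 \<in> ?S" for i :: 'r
  proof -
    obtain c :: "'n \<Rightarrow> int" where c: "axis i 1 = (\<Sum>j\<in>UNIV. c j *s a j)" using assms by blast
    have "axis i 1 = real_point (axis i 1)" by (simp add: real_point_def vec_eq_iff axis_def)
    also have "\<dots> = (\<Sum>j\<in>UNIV. real_of_int (c j) *\<^sub>R real_point (a j))"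
      unfolding c by (simp add: real_point_def vec_eq_iff)
    also have "\<dots> \<in> ?S" by (intro span_sum span_scale span_base) auto
    finally show ?thesis .
  qed
  have "x \<in> ?S" for x
  proof -
    have "x = (\<Sum>i\<in>UNIV. x $ i *\<^sub>R axis i 1)" using basis_expansion[of x] by (simp add: scalar_mult_eq_scaleR)
    also have "\<dots> \<in> ?S" by (intro span_sum span_scale ax)
    finally show ?thesis .
  qed
  then show ?thesis by auto
qed

text \<open>
  Linear forms \<open>g 0 = h, g 1, \<dots>\<close> such that for each \<open>s > 0\<close> some difference \<open>a\<^bsub>js s\<^esub> - a\<^bsub>j0\<^esub>\<close> is seen by \<open>g s\<close> but
  by no earlier form. They are dual to a basis that consists of \<open>a\<^bsub>j0\<^esub>\<close> and such differences.
\<close>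

lemma (in homogeneous_points) dual_basis_of_differences:
  assumes "\<forall>z :: int ^ 'r. \<exists>c :: 'n \<Rightarrow> int. z = (\<Sum>j\<in>UNIV. c j *s a j)"
  shows "\<exists>(g :: nat \<Rightarrow> real ^ 'r \<Rightarrow> real) j0 js. (\<forall>i. linear (g i)) \<and> (\<forall>j. g 0 (real_point (a j)) = 1) \<and>
    (\<forall>s. 0 < s \<and> s < CARD('r) \<longrightarrow> g s (real_point (a (js s))) = g s (real_point (a j0)) + 1 \<and>
       (\<forall>i<s. g i (real_point (a (js s))) = g i (real_point (a j0))))"
proof -
  obtain h :: "real ^ 'r \<Rightarrow> real" where h: "linear h" "\<And>j. h (real_point (a j)) = 1"
    using on_hyperplane by auto
  let ?p = "\<lambda>j. real_point (a j)"
  define j0 :: 'n where "j0 = undefined"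
  define S where "S = range (\<lambda>j. ?p j - ?p j0)"
  have p0: "?p j0 \<noteq> 0" using h linear_0[OF h(1)] by (metis zero_neq_one)
  obtain B where B: "{?p j0} \<subseteq> B" "B \<subseteq> insert (?p j0) S" "independent B" "insert (?p j0) S \<subseteq> span B"
    using maximal_independent_subset_extend[of "{?p j0}" "insert (?p j0) S"] p0 by (auto simp: dependent_single)
  have "?p j \<in> span B" for j
  proof -
    have "?p j0 \<in> span B" "?p j - ?p j0 \<in> span B" using B(4) by (auto simp: S_def)
    then have "?p j0 + (?p j - ?p j0) \<in> span B" by (rule span_add)
    then show ?thesis by simp
  qed
  then have "span B = UNIV" using integral_span_imp_real_span[OF assms] span_minimal[of "range ?p" "span B"] by auto
  then have cardB: "card B = CARD('r)" using basis_card_eq_dim[of B UNIV] B(3) by (simp add: dim_UNIV)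
  have finB: "finite B" using B(3) by (rule independent_imp_finite)
  obtain xs where xs: "set xs = B - {?p j0}" "distinct xs" using finite_distinct_list[of "B - {?p j0}"] finB by auto
  define ys where "ys = ?p j0 # xs"
  have ys: "distinct ys" "set ys = B" using xs B(1) by (auto simp: ys_def)
  then have len: "length ys = CARD('r)" using cardB distinct_card by fastforce
  have "\<exists>f. linear f \<and> (\<forall>x\<in>B. f x = (if x = b then 1 else 0 :: real))" for b
    using linear_independent_extend[OF B(3), of "\<lambda>x. if x = b then 1 else 0"] by blast
  then obtain f where f: "\<And>b. linear (f b)" "\<And>b x. x \<in> B \<Longrightarrow> f b x = (if x = b then 1 else 0 :: real)" by metis
  define g where "g i = (if i = 0 then h else f (ys ! i))" for i
  have "\<exists>j. ys ! s = ?p j - ?p j0" if "0 < s" "s < CARD('r)" for s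
  proof -
    have "ys ! s \<in> set xs" using that len by (cases s) (auto simp: ys_def)
    then have "ys ! s \<in> S" using xs B(2) by blast
    then show ?thesis by (auto simp: S_def)
  qed
  then obtain js where js: "\<And>s. 0 < s \<Longrightarrow> s < CARD('r) \<Longrightarrow> ys ! s = ?p (js s) - ?p j0" by metis
  have lin: "linear (g i)" for i by (simp add: g_def h(1) f(1))
  have val: "g i (?p (js s)) = g i (?p j0) + g i (ys ! s)" if "0 < s" "s < CARD('r)" for i s
    using js[OF that] by (simp add: linear_diff[OF lin])
  have g0: "g 0 = h" by (simp add: g_def)
  have dual: "g i (ys ! s) = (if i = s then 1 else 0)" if "0 < s" "s < CARD('r)" "i \<le> s" for i s
  proof (cases "i = 0")
    case True
    then show ?thesis using that js[of s] by (simp add: g_def linear_diff[OF h(1)] h(2))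
  next
    case False
    have "ys ! s \<in> B" using that len ys(2) nth_mem by metis
    then show ?thesis using False that f(2) ys(1) len by (simp add: g_def nth_eq_iff_index_eq)
  qed
  show ?thesis
  proof (intro exI[of _ g] exI[of _ j0] exI[of _ js] conjI allI impI lin)
    show "g 0 (?p j) = 1" for j by (simp add: g0 h(2))
    fix s assume s: "0 < s \<and> s < CARD('r)"
    show "g s (?p (js s)) = g s (?p j0) + 1" using val[of s s] dual[of s s] s by simp
    show "g i (?p (js s)) = g i (?p j0)" if "i < s" for i using val[of s i] dual[of s i] s that by simp
  qed
qed

text \<open>
  The binomial \<open>\<xi>\<^bsub>js s\<^esub> - \<xi>\<^bsub>j0\<^esub>\<close> shows that the step from \<open>s\<close> to \<open>s + 1\<close> coordinates is strict. With the
  single coordinate \<open>h\<close> only the degree is left, which still detects constant terms.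
\<close>

lemma (in homogeneous_points) weight_prime_chain:
  assumes "\<forall>z :: int ^ 'r. \<exists>c :: 'n \<Rightarrow> int. z = (\<Sum>j\<in>UNIV. c j *s a j)"
  shows "\<exists>g. (\<forall>i. linear (g i)) \<and> (\<forall>s. 0 < s \<longrightarrow> s < CARD('r) \<longrightarrow> weight_prime a g (Suc s) \<subset> weight_prime a g s) \<and>
     weight_prime a g 1 \<subset> {p. coef p 0 = 0}"
proof -
  obtain g :: "nat \<Rightarrow> real ^ 'r \<Rightarrow> real" and j0 js where g': "\<forall>i. linear (g i)" "\<forall>j. g 0 (real_point (a j)) = 1"
    "\<forall>s. 0 < s \<and> s < CARD('r) \<longrightarrow> g s (real_point (a (js s))) = g s (real_point (a j0)) + 1 \<and>
       (\<forall>i<s. g i (real_point (a (js s))) = g i (real_point (a j0)))"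
    using dual_basis_of_differences[OF assms] by blast
  have g: "\<And>i. linear (g i)" "\<And>j. g 0 (real_point (a j)) = 1"
    "\<And>s. 0 < s \<Longrightarrow> s < CARD('r) \<Longrightarrow> g s (real_point (a (js s))) = g s (real_point (a j0)) + 1"
    "\<And>s i. 0 < s \<Longrightarrow> s < CARD('r) \<Longrightarrow> i < s \<Longrightarrow> g i (real_point (a (js s))) = g i (real_point (a j0))"
    using g' by blast+
  have xi: "weight_map g s (toric_map a (xi j)) = mon (truncated_weight g s (a j)) 1" for s j
    by (simp add: xi_def toric_map_single point_sum_single weight_map_single)
  have "weight_prime a g (Suc s) \<subset> weight_prime a g s" if s: "0 < s" "s < CARD('r)" for s
  proof -
    let ?d = "xi (js s) - xi j0"
    have val: "weight_map g s' (toric_map a ?d) = mon (truncated_weight g s' (a (js s))) 1 - mon (truncated_weight g s' (a j0)) 1" for s'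
      by (simp add: addhom_diff[OF addhom_toric_map] addhom_diff[OF addhom_weight_map] xi)
    have "truncated_weight g s (a (js s)) = truncated_weight g s (a j0)"
      unfolding truncated_weight_def using g(4)[OF s] by (intro sum.cong) auto
    then have in_s: "?d \<in> weight_prime a g s" by (simp add: weight_prime_def val)
    have "truncated_weight g (Suc s) (a (js s)) \<noteq> truncated_weight g (Suc s) (a j0)"
    proof
      assume "truncated_weight g (Suc s) (a (js s)) = truncated_weight g (Suc s) (a j0)"
      from arg_cong[OF this, of "\<lambda>x. coef x s"] show False using g(3)[OF s] by (simp add: coef_truncated_weight)
    qed
    then have "coef (mon (truncated_weight g (Suc s) (a (js s))) 1 - mon (truncated_weight g (Suc s) (a j0)) (1 :: complex))
        (truncated_weight g (Suc s) (a j0)) \<noteq> 0"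
      by (simp add: lookup_minus lookup_single when_def)
    then have "?d \<notin> weight_prime a g (Suc s)" unfolding weight_prime_def mem_Collect_eq val by auto
    then show ?thesis using weight_prime_mono[of a g s] in_s by blast
  qed
  moreover have "weight_prime a g 1 \<subset> {p. coef p 0 = 0}"
  proof
    show "weight_prime a g 1 \<subseteq> {p. coef p 0 = 0}"
    proof
      fix p assume p: "p \<in> weight_prime a g 1"
      have tw: "truncated_weight g 1 (point_sum a u) = 0 \<longleftrightarrow> u = 0" for u
      proof -
        have "truncated_weight g 1 (point_sum a u) = mon 0 (real (total_degree u))"
          using height_of_point_sum[OF g(1)[of 0], of a, OF g(2)] by (simp add: truncated_weight_def lessThan_Suc One_nat_def)
        then show ?thesis by (metis lookup_single_eq lookup_zero of_nat_eq_0_iff single_zero total_degree_0)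
      qed
      have "(\<lambda>p. coef (weight_map g 1 (toric_map a p)) 0) = (\<lambda>p. coef p 0)"
      proof (rule addhom_eqI)
        show "addhom (\<lambda>p. coef (weight_map g 1 (toric_map a p)) 0)"
          by (rule addhom_comp[OF addhom_coef addhom_comp[OF addhom_weight_map addhom_toric_map]])
        show "addhom (\<lambda>p. coef p 0)" by (rule addhom_coef)
        show "coef (weight_map g 1 (toric_map a (mon u c))) 0 = coef (mon u c) 0" for u c
          using tw[of u] by (simp add: toric_map_single weight_map_single lookup_single when_def)
      qed
      from fun_cong[OF this, of p] show "p \<in> {p. coef p 0 = 0}" using p by (simp add: weight_prime_def)
    qed
    have "xi j0 \<in> {p. coef p 0 = (0::complex)}"
    proof -
      have "mon j0 (1::nat) \<noteq> 0" by (metis lookup_single_eq lookup_zero one_neq_zero)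
      then show ?thesis by (simp add: xi_def lookup_single when_def)
    qed
    moreover have "xi j0 \<notin> weight_prime a g 1"
      unfolding weight_prime_def mem_Collect_eq xi by (metis lookup_single_eq lookup_zero one_neq_zero)
    ultimately show "weight_prime a g 1 \<noteq> {p. coef p 0 = 0}" by blast
  qed
  ultimately show ?thesis using g(1) by blast
qed

text \<open>
  The primes for \<open>s = r, \<dots>, 1\<close> followed by the ideal of polynomials without constant term form a chain
  of length \<open>r\<close>.
\<close>

lemma (in homogeneous_points) regular_sequence_modulo_toric_kernel:
  assumes span: "\<forall>z :: int ^ 'r. \<exists>c :: 'n \<Rightarrow> int. z = (\<Sum>j\<in>UNIV. c j *s a j)"
    and CM: "toric_Cohen_Macaulay a"
  shows "\<exists>f. \<forall>i<CARD('r). coef (f i) 0 = 0 \<and>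
    (\<forall>y. f i * y \<in> cpoly_quotient.sequence_ideal (toric_kernel a) f i \<longrightarrow>
       y \<in> cpoly_quotient.sequence_ideal (toric_kernel a) f i)"
proof -
  interpret C: cpoly_quotient "toric_kernel a :: 'n cpoly set"
    by unfold_locales (rule ring_ideal_toric_kernel)
  obtain g where g: "\<And>i. linear (g i)"
    "\<And>s. 0 < s \<Longrightarrow> s < CARD('r) \<Longrightarrow> weight_prime a g (Suc s) \<subset> weight_prime a g s"
    "weight_prime a g 1 \<subset> {p. coef p 0 = 0}"
    using weight_prime_chain[OF span] by auto
  let ?r = "CARD('r)"
  let ?M = "{p :: 'n cpoly. coef p 0 = 0}"
  have r: "0 < ?r" by simp
  have coef0: "coef (p * q) 0 = coef p 0 * coef q 0" for p q :: "'n cpoly"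
  proof (induction p rule: pm_induct)
    case (single u c)
    show ?case
    proof (induction q rule: pm_induct)
      case (single w d)
      have "u + w = 0 \<longleftrightarrow> u = 0 \<and> w = 0" by (metis add_is_0 total_degree_0 total_degree_add)
      then show ?case by (auto simp: mult_single lookup_single when_def)
    qed (simp add: distrib_left lookup_add)
  qed (simp add: distrib_right lookup_add)
  have M: "ring_ideal ?M" "1 \<notin> ?M" "\<And>p q. p * q \<in> ?M \<Longrightarrow> p \<in> ?M \<or> q \<in> ?M"
    by (auto simp: ring_ideal_def coef0 lookup_add lookup_one)
  have TM: "toric_kernel a \<subseteq> ?M" by (rule subset_trans[OF weight_prime(2)[where g = g, OF g(1)] psubset_imp_subset[OF g(3)]])
  define c where "c i = (if i < ?r then weight_prime a g (?r - i) else ?M)" for i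
  have chain: "c i \<subset> c (Suc i)" if i: "i < ?r" for i
  proof (cases "Suc i < ?r")
    case True
    then have "?r - i = Suc (?r - Suc i)" by simp
    then show ?thesis using g(2)[of "?r - Suc i"] True i by (simp add: c_def)
  next
    case False
    then have "?r - i = 1" using i by simp
    then show ?thesis using g(3) False i by (simp add: c_def)
  qed
  have "\<exists>f. \<forall>i<?r. f i \<in> ?M \<and> (\<forall>y. f i * y \<in> C.sequence_ideal f i \<longrightarrow> y \<in> C.sequence_ideal f i)"
  proof (rule C.Cohen_Macaulay_regular_sequence)
    show "Cohen_Macaulay (cpoly_ring Quot toric_kernel a)"
      using CM by (simp add: toric_Cohen_Macaulay_def toric_ideal_eq)
    show "ring_ideal (c i) \<and> toric_kernel a \<subseteq> c i \<and> 1 \<notin> c i \<and> (\<forall>x y. x * y \<in> c i \<longrightarrow> x \<in> c i \<or> y \<in> c i)" for i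
    proof (cases "i < ?r")
      case True
      then have c: "c i = weight_prime a g (?r - i)" by (simp add: c_def)
      show ?thesis unfolding c by (intro conjI allI impI weight_prime[where g = g, OF g(1)])
    next
      case False
      then have c: "c i = ?M" by (simp add: c_def)
      show ?thesis unfolding c by (intro conjI allI impI M TM)
    qed
    show "c ?r = ?M" by (simp add: c_def)
  qed (use M TM chain r in auto)
  then show ?thesis by simp
qed


section \<open>Syzygies of the Euler forms\<close>

text \<open>
  The scalar extension \<open>\<complex>[\<xi>] \<rightarrow> K[\<xi>]\<close> passes through \<open>\<complex>[v][\<xi>]\<close>, which is free over \<open>\<complex>[\<xi>]\<close> with the monomials
  \<open>v\<^sup>e\<close> as a basis. The coordinate at \<open>v\<^sup>e\<close> is \<open>monomial_slice e\<close>.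
\<close>

definition constant_extension :: "(('n \<Rightarrow>\<^sub>0 nat) \<Rightarrow>\<^sub>0 complex) \<Rightarrow> (('n \<Rightarrow>\<^sub>0 nat) \<Rightarrow>\<^sub>0 'n cpoly)" where
  "constant_extension = ext (\<lambda>u c. mon u (mon 0 c))"

definition monomial_slice :: "('n \<Rightarrow>\<^sub>0 nat) \<Rightarrow> (('n \<Rightarrow>\<^sub>0 nat) \<Rightarrow>\<^sub>0 'n cpoly) \<Rightarrow> (('n \<Rightarrow>\<^sub>0 nat) \<Rightarrow>\<^sub>0 complex)" where
  "monomial_slice e = ext (\<lambda>u g. mon u (coef g e))"

abbreviation scalar_extension :: "(('n::linorder \<Rightarrow>\<^sub>0 nat) \<Rightarrow>\<^sub>0 complex) \<Rightarrow> (('n \<Rightarrow>\<^sub>0 nat) \<Rightarrow>\<^sub>0 'n ratfun)" where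
  "scalar_extension p \<equiv> fract_poly (constant_extension p)"

lemma addhom_constant_extension: "addhom constant_extension"
  unfolding constant_extension_def by (intro addhom_ext addhom_comp[OF addhom_mon addhom_mon])

lemma constant_extension_single: "constant_extension (mon u c) = mon u (mon 0 c)"
  unfolding constant_extension_def by (rule ext_single) simp

lemma addhom_monomial_slice: "addhom (monomial_slice e)"
  unfolding monomial_slice_def by (intro addhom_ext addhom_comp[OF addhom_mon addhom_coef])

lemma monomial_slice_single: "monomial_slice e (mon u g) = mon u (coef g e)"
  unfolding monomial_slice_def by (rule ext_single) simp

lemma constant_extension_mult: "constant_extension (p * q) = constant_extension p * constant_extension q"
proof (induction p rule: pm_induct)
  case (single u c)
  show ?case
    by (induction q rule: pm_induct)
       (simp_all add: mult_single constant_extension_single distrib_left addhom_add[OF addhom_constant_extension])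
qed (simp add: distrib_right addhom_add[OF addhom_constant_extension])

lemma monomial_slice_mult: "monomial_slice e (constant_extension f * p) = f * monomial_slice e p"
proof (induction f rule: pm_induct)
  case (single u c)
  show ?case
    by (induction p rule: pm_induct)
       (simp_all add: mult_single constant_extension_single distrib_left addhom_add[OF addhom_monomial_slice]
         monomial_slice_single cst_coef)
qed (simp add: distrib_right addhom_add[OF addhom_monomial_slice] addhom_add[OF addhom_constant_extension])

lemma coef_constant_extension: "coef (constant_extension p) u = mon 0 (coef p u)"
proof -
  have "(\<lambda>p. coef (constant_extension p) u) = (\<lambda>p. mon 0 (coef p u))"
    by (rule addhom_eqI)
       (simp_all add: addhom_comp[OF addhom_coef addhom_constant_extension] addhom_comp[OF addhom_mon addhom_coef]
         constant_extension_single lookup_single when_def)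
  from fun_cong[OF this] show ?thesis .
qed

lemma coef_monomial_slice: "coef (monomial_slice e p) u = coef (coef p u) e"
proof -
  have "(\<lambda>p. coef (monomial_slice e p) u) = (\<lambda>p. coef (coef p u) e)"
    by (rule addhom_eqI)
       (simp_all add: addhom_comp[OF addhom_coef addhom_monomial_slice] addhom_comp[OF addhom_coef addhom_coef]
         monomial_slice_single lookup_single when_def)
  from fun_cong[OF this] show ?thesis .
qed

lemma coef_scalar_extension: "coef (scalar_extension p) u = ratfun_const (coef p u)"
  by (simp add: coef_fract_poly coef_constant_extension ratfun_const_def)

lemma toric_kernel_constant_extension:
  assumes "t \<in> toric_kernel a"
  shows "scalar_extension t \<in> toric_kernel a"
proof -
  let ?F = "ext (\<lambda>z c. mon z (ratfun_const c))"
  have ah: "addhom ?F" by (intro addhom_ext addhom_comp[OF addhom_mon addhom_ratfun_const])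
  have "(\<lambda>t. toric_map a (scalar_extension t)) = (\<lambda>t. ?F (toric_map a t))"
    by (rule addhom_eqI)
       (simp_all add: addhom_comp[OF addhom_toric_map addhom_comp[OF addhom_fract_poly addhom_constant_extension]]
         addhom_comp[OF ah addhom_toric_map] constant_extension_single fract_poly_single toric_map_single ext_single
         ratfun_const_0 ratfun_const_def[symmetric])
  from fun_cong[OF this, of t] show ?thesis using assms by (simp add: toric_kernel_def ext_def[of _ 0])
qed

lemma toric_kernel_monomial_slice:
  assumes "t \<in> toric_kernel a"
  shows "monomial_slice e t \<in> toric_kernel a"
proof -
  let ?F = "ext (\<lambda>z g. mon z (coef g e))"
  have ah: "addhom ?F" by (intro addhom_ext addhom_comp[OF addhom_mon addhom_coef])
  have "(\<lambda>t. toric_map a (monomial_slice e t)) = (\<lambda>t. ?F (toric_map a t))"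
    by (rule addhom_eqI)
       (simp_all add: addhom_comp[OF addhom_toric_map addhom_monomial_slice]
         addhom_comp[OF ah addhom_toric_map] monomial_slice_single toric_map_single ext_single)
  from fun_cong[OF this, of t] show ?thesis using assms by (simp add: toric_kernel_def ext_def[of _ 0])
qed

lemma in_ideal_if_slices_in_ideal:
  assumes V: "ring_ideal V" and slices: "\<And>e. scalar_extension (monomial_slice e p) \<in> V"
  shows "fract_poly p \<in> V"
proof -
  define E where "E = (\<Union>u\<in>supp p. supp (coef p u))"
  have fin: "finite E" by (simp add: E_def)
  have "fract_poly p = (\<Sum>e\<in>E. cst (power_product e) * scalar_extension (monomial_slice e p))"
  proof (rule poly_mapping_eqI)
    fix u
    have sub: "supp (coef p u) \<subseteq> E"
    proof (cases "u \<in> supp p")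
      case False
      then have "coef p u = 0" by (simp add: in_keys_iff)
      then show ?thesis by simp
    qed (auto simp: E_def)
    have "coef p u = (\<Sum>e\<in>supp (coef p u). mon e (coef (coef p u) e))" by (rule sum_single[symmetric])
    also have "\<dots> = (\<Sum>e\<in>E. mon e (coef (coef p u) e))"
      using fin sub by (intro sum.mono_neutral_left) (auto simp: in_keys_iff)
    finally have "Fract (coef p u) 1 = (\<Sum>e\<in>E. Fract (mon e (coef (coef p u) e)) 1)"
      using addhom_sum[OF addhom_Fract_1] by metis
    also have "\<dots> = (\<Sum>e\<in>E. power_product e * ratfun_const (coef (coef p u) e))"
      by (simp add: power_product_def ratfun_const_def mult_single)
    finally show "coef (fract_poly p) u = coef (\<Sum>e\<in>E. cst (power_product e) * scalar_extension (monomial_slice e p)) u"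
      by (simp add: coef_fract_poly[of p] lookup_sum cst_coef coef_scalar_extension coef_monomial_slice)
  qed
  also have "\<dots> \<in> V" by (intro ring_ideal_sum[OF V] ring_idealD(3)[OF V] slices)
  finally show ?thesis .
qed

definition extended_sequence_ideal :: "('n::{finite,linorder} \<Rightarrow> int ^ 'r) \<Rightarrow> (nat \<Rightarrow> 'n cpoly) \<Rightarrow> nat \<Rightarrow> (('n \<Rightarrow>\<^sub>0 nat) \<Rightarrow>\<^sub>0 'n ratfun) set" where
  "extended_sequence_ideal a f k = {t + (\<Sum>i<k. scalar_extension (f i) * q i) | t q. t \<in> toric_kernel a}"

lemma extended_sequence_idealI:
  "t \<in> toric_kernel a \<Longrightarrow> p = t + (\<Sum>i<k. scalar_extension (f i) * q i) \<Longrightarrow> p \<in> extended_sequence_ideal a f k"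
  by (auto simp: extended_sequence_ideal_def)

lemma ring_ideal_extended_sequence_ideal: "ring_ideal (extended_sequence_ideal a f k)"
  unfolding ring_ideal_def
proof (intro conjI ballI allI)
  note T = ring_idealD[OF ring_ideal_toric_kernel]
  show "0 \<in> extended_sequence_ideal a f k" by (rule extended_sequence_idealI[OF T(1), where q = "\<lambda>_. 0"]) simp
  fix x assume "x \<in> extended_sequence_ideal a f k"
  then obtain t q where x: "x = t + (\<Sum>i<k. scalar_extension (f i) * q i)" "t \<in> toric_kernel a"
    by (auto simp: extended_sequence_ideal_def)
  show "b * x \<in> extended_sequence_ideal a f k" for b
    by (rule extended_sequence_idealI[OF T(3)[OF x(2), of b], where q = "\<lambda>i. b * q i"])
       (simp add: x distrib_left sum_distrib_left mult_ac)
  fix y assume "y \<in> extended_sequence_ideal a f k"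
  then obtain t' q' where y: "y = t' + (\<Sum>i<k. scalar_extension (f i) * q' i)" "t' \<in> toric_kernel a"
    by (auto simp: extended_sequence_ideal_def)
  show "x + y \<in> extended_sequence_ideal a f k"
    by (rule extended_sequence_idealI[OF T(2)[OF x(2) y(2)], where q = "\<lambda>i. q i + q' i"])
       (simp add: x y distrib_left sum.distrib)
qed

text \<open>
  Flat base change by hand. Clear denominators in the relation over \<open>K\<close>, compare the coefficients of each
  monomial \<open>v\<^sup>e\<close>, apply regularity over \<open>\<complex>\<close> to each slice, and put the slices together again.
\<close>

lemma extended_sequence_regular:
  fixes a :: "'n::{finite,linorder} \<Rightarrow> int ^ 'r"
  assumes reg: "\<And>y. f k * y \<in> cpoly_quotient.sequence_ideal (toric_kernel a) f k \<Longrightarrow>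
      y \<in> cpoly_quotient.sequence_ideal (toric_kernel a) f k"
    and y: "scalar_extension (f k) * y \<in> extended_sequence_ideal a f k"
  shows "y \<in> extended_sequence_ideal a f k"
proof -
  interpret C: cpoly_quotient "toric_kernel a :: 'n cpoly set"
    by unfold_locales (rule ring_ideal_toric_kernel)
  note V = ring_ideal_extended_sequence_ideal[of a f k]
  obtain t q where tq: "t \<in> toric_kernel a" "scalar_extension (f k) * y = t + (\<Sum>i<k. scalar_extension (f i) * q i)"
    using y by (auto simp: extended_sequence_ideal_def)
  define fam where "fam i = (if i < k then q i else if i = k then y else t)" for i
  obtain D where D: "D \<noteq> 0" "\<And>i. i \<in> {..k + 1} \<Longrightarrow> \<exists>p. cst (Fract D 1) * fam i = fract_poly p"
    using common_denominator_family[of "{..k + 1}" fam] by auto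
  then have "\<forall>i. \<exists>p. i \<in> {..k + 1} \<longrightarrow> cst (Fract D 1) * fam i = fract_poly p" by blast
  then obtain F where F: "\<And>i. i \<in> {..k + 1} \<Longrightarrow> cst (Fract D 1) * fam i = fract_poly (F i)" by metis
  have q: "cst (Fract D 1) * q i = fract_poly (F i)" if "i < k" for i using F[of i] that by (simp add: fam_def)
  have y': "cst (Fract D 1) * y = fract_poly (F k)" using F[of k] by (simp add: fam_def)
  have t: "cst (Fract D 1) * t = fract_poly (F (k + 1))" using F[of "k + 1"] by (simp add: fam_def)
  have tF: "F (k + 1) \<in> toric_kernel a"
    using ring_idealD(3)[OF ring_ideal_toric_kernel tq(1), of "cst (Fract D 1)"] unfolding t by (rule fract_poly_toric_kernel)
  have "fract_poly (constant_extension (f k) * F k) = cst (Fract D 1) * (scalar_extension (f k) * y)"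
    by (simp add: fract_poly_mult y'[symmetric] mult.left_commute)
  also have "\<dots> = cst (Fract D 1) * t + (\<Sum>i<k. scalar_extension (f i) * (cst (Fract D 1) * q i))"
    by (simp add: tq(2) distrib_left sum_distrib_left mult.left_commute)
  also have "\<dots> = fract_poly (F (k + 1) + (\<Sum>i<k. constant_extension (f i) * F i))"
    by (simp add: t q addhom_add[OF addhom_fract_poly] addhom_sum[OF addhom_fract_poly] fract_poly_mult)
  finally have "fract_poly (constant_extension (f k) * F k - (F (k + 1) + (\<Sum>i<k. constant_extension (f i) * F i))) = 0"
    by (simp add: addhom_diff[OF addhom_fract_poly])
  from fract_poly_eq_0[OF this]
  have eq: "constant_extension (f k) * F k = F (k + 1) + (\<Sum>i<k. constant_extension (f i) * F i)" by simp
  have "scalar_extension (monomial_slice e (F k)) \<in> extended_sequence_ideal a f k" for e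
  proof -
    have "f k * monomial_slice e (F k) = monomial_slice e (F (k + 1)) + (\<Sum>i<k. f i * monomial_slice e (F i))"
      using arg_cong[OF eq, of "monomial_slice e"]
      by (simp add: monomial_slice_mult addhom_add[OF addhom_monomial_slice] addhom_sum[OF addhom_monomial_slice])
    then have "f k * monomial_slice e (F k) \<in> C.sequence_ideal f k"
      by (rule C.sequence_idealI[OF toric_kernel_monomial_slice[OF tF]])
    then have "monomial_slice e (F k) \<in> C.sequence_ideal f k" by (rule reg)
    then obtain t' q' where tq': "t' \<in> toric_kernel a" "monomial_slice e (F k) = t' + (\<Sum>i<k. f i * q' i)"
      by (auto simp: C.sequence_ideal_def)
    show ?thesis
      by (rule extended_sequence_idealI[OF toric_kernel_constant_extension[OF tq'(1)], where q = "\<lambda>i. scalar_extension (q' i)"])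
         (simp add: tq'(2) addhom_add[OF addhom_constant_extension] addhom_sum[OF addhom_constant_extension]
           addhom_add[OF addhom_fract_poly] addhom_sum[OF addhom_fract_poly] constant_extension_mult fract_poly_mult)
  qed
  from in_ideal_if_slices_in_ideal[OF V this] have in_V: "cst (Fract D 1) * y \<in> extended_sequence_ideal a f k"
    unfolding y' .
  have inv: "cst (inverse c) * (cst c * y) = y" if "c \<noteq> 0" for c
    using that by (simp add: mult.assoc[symmetric] mult_single)
  have "Fract D 1 \<noteq> 0" using D(1) by (simp add: Zero_fract_def eq_fract)
  then have "cst (inverse (Fract D 1)) * (cst (Fract D 1) * y) = y" by (rule inv)
  then show ?thesis using ring_idealD(3)[OF V in_V] by metis
qed

text \<open>
  A polynomial without constant term has powers with monomials of large degree only.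
\<close>

lemma power_total_degree_ge:
  fixes p :: "('n::finite \<Rightarrow>\<^sub>0 nat) \<Rightarrow>\<^sub>0 'k::comm_ring_1"
  assumes "coef p 0 = 0" "u \<in> supp (p ^ m)"
  shows "m \<le> total_degree u"
  using assms(2)
proof (induction m arbitrary: u)
  case (Suc m)
  have "u \<in> {x + y | x y. x \<in> supp p \<and> y \<in> supp (p ^ m)}"
    using Suc.prems keys_mult[of p "p ^ m"] by auto
  then obtain x y where xy: "u = x + y" "x \<in> supp p" "y \<in> supp (p ^ m)" by blast
  have "x \<noteq> 0" using assms(1) xy(2) by (auto simp: in_keys_iff)
  then have "1 \<le> total_degree x" using total_degree_0[of x] by linarith
  then show ?case using Suc.IH[OF xy(3)] by (simp add: xy(1) total_degree_add)
qed simp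

text \<open>
  The index type of the coordinates is identified with \<open>{..<r}\<close> to apply \<open>koszul_first_syzygies\<close>. The regular
  sequence consists of polynomials without constant term, so high powers consist of monomials
  of large degree, which lie in \<open>toric_euler_ideal\<close>.
\<close>

lemma (in homogeneous_points) syzygies_of_euler_forms:
  assumes span: "\<forall>z :: int ^ 'r. \<exists>c :: 'n \<Rightarrow> int. z = (\<Sum>j\<in>UNIV. c j *s a j)"
    and CM: "toric_Cohen_Macaulay a"
  shows "regular_euler_forms a ratfun_var"
proof unfold_locales
  fix p :: "'r \<Rightarrow> (('n \<Rightarrow>\<^sub>0 nat) \<Rightarrow>\<^sub>0 'n ratfun)"
  assume p: "(\<Sum>i\<in>UNIV. p i * euler_form a ratfun_var i) \<in> toric_kernel a"
  obtain f where f: "\<And>i. i < CARD('r) \<Longrightarrow> coef (f i) 0 = 0"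
    "\<And>i y. i < CARD('r) \<Longrightarrow> f i * y \<in> cpoly_quotient.sequence_ideal (toric_kernel a) f i \<Longrightarrow>
       y \<in> cpoly_quotient.sequence_ideal (toric_kernel a) f i"
    using regular_sequence_modulo_toric_kernel[OF span CM] by blast
  obtain n where n: "\<And>u. n \<le> total_degree u \<Longrightarrow> mon u 1 \<in> toric_euler_ideal a ratfun_var"
    using large_monomials_in_toric_euler_ideal by blast
  obtain \<iota> where \<iota>: "bij_betw \<iota> {..<CARD('r)} (UNIV :: 'r set)"
    using ex_bij_betw_nat_finite[of "UNIV :: 'r set"] by (auto simp: atLeast0LessThan)
  let ?J = "extended_sequence_ideal a f"
  let ?\<theta> = "\<lambda>k. euler_form a ratfun_var (\<iota> k)"
  have J0: "?J 0 = toric_kernel a" by (auto simp: extended_sequence_ideal_def)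
  have reindex: "(\<Sum>i\<in>UNIV. F i) = (\<Sum>k<CARD('r). F (\<iota> k))" for F :: "'r \<Rightarrow> (('n \<Rightarrow>\<^sub>0 nat) \<Rightarrow>\<^sub>0 'n ratfun)"
    using sum.reindex_bij_betw[OF \<iota>, of F] by simp
  have "\<exists>c. (\<forall>i<CARD('r). \<forall>j<CARD('r). c i j = - c j i) \<and>
     (\<forall>i<CARD('r). p (\<iota> i) - (\<Sum>j<CARD('r). c i j * ?\<theta> j) \<in> ?J 0)"
  proof (rule koszul_first_syzygies)
    show "ring_ideal (?J k)" for k by (rule ring_ideal_extended_sequence_ideal)
    show "y \<in> ?J k" if "k < CARD('r)" "scalar_extension (f k) * y \<in> ?J k" for k y
      using extended_sequence_regular[OF f(2)[OF that(1)] that(2)] .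
    show "?J (Suc k) = {b + scalar_extension (f k) * c | b c. b \<in> ?J k}" for k
    proof (intro equalityI subsetI)
      fix x assume "x \<in> ?J (Suc k)"
      then obtain t q where "t \<in> toric_kernel a" "x = t + (\<Sum>i<Suc k. scalar_extension (f i) * q i)"
        by (auto simp: extended_sequence_ideal_def)
      then have "x = (t + (\<Sum>i<k. scalar_extension (f i) * q i)) + scalar_extension (f k) * q k"
        "t + (\<Sum>i<k. scalar_extension (f i) * q i) \<in> ?J k"
        by (simp add: add.assoc) (rule extended_sequence_idealI[OF \<open>t \<in> toric_kernel a\<close> refl])
      then show "x \<in> {b + scalar_extension (f k) * c | b c. b \<in> ?J k}" by blast
    next
      fix x assume "x \<in> {b + scalar_extension (f k) * c | b c. b \<in> ?J k}"
      then obtain t q c where *: "t \<in> toric_kernel a" "x = t + (\<Sum>i<k. scalar_extension (f i) * q i) + scalar_extension (f k) * c"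
        by (auto simp: extended_sequence_ideal_def)
      have "(\<Sum>i<k. scalar_extension (f i) * (q(k := c)) i) = (\<Sum>i<k. scalar_extension (f i) * q i)"
        by (intro sum.cong) auto
      then have "x = t + (\<Sum>i<Suc k. scalar_extension (f i) * (q(k := c)) i)" using *(2) by (simp add: add.assoc)
      then show "x \<in> ?J (Suc k)" by (rule extended_sequence_idealI[OF *(1)])
    qed
    show "\<exists>n g b. scalar_extension (f k) ^ n = (\<Sum>i<CARD('r). g i * ?\<theta> i) + b \<and> b \<in> ?J 0" if k: "k < CARD('r)" for k
    proof -
      let ?s = "scalar_extension (f k) ^ n"
      have "coef (scalar_extension (f k)) 0 = 0" using f(1)[OF k] by (simp add: coef_scalar_extension ratfun_const_0)
      then have "mon u (coef ?s u) \<in> toric_euler_ideal a ratfun_var" if "u \<in> supp ?s" for u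
        using ring_idealD(3)[OF ring_ideal_toric_euler_ideal n[OF power_total_degree_ge[OF _ that]], of "cst (coef ?s u)"]
        by (simp add: cst_mon)
      then have "(\<Sum>u\<in>supp ?s. mon u (coef ?s u)) \<in> toric_euler_ideal a ratfun_var"
        by (intro ring_ideal_sum[OF ring_ideal_toric_euler_ideal])
      then have "?s \<in> toric_euler_ideal a ratfun_var" by (simp only: sum_single)
      then obtain t q where "t \<in> toric_kernel a" "?s = t + (\<Sum>i\<in>UNIV. q i * euler_form a ratfun_var i)"
        by (auto simp: toric_euler_ideal_def)
      then have "?s = (\<Sum>i<CARD('r). q (\<iota> i) * ?\<theta> i) + t" "t \<in> ?J 0" by (simp_all add: reindex J0 add.commute)
      then show ?thesis by (intro exI[of _ n] exI[of _ "\<lambda>i. q (\<iota> i)"] exI[of _ t]) (rule conjI)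
    qed
    show "(\<Sum>i<CARD('r). p (\<iota> i) * ?\<theta> i) \<in> ?J 0" using p unfolding J0 reindex .
  qed
  then obtain c where c: "\<And>i j. i < CARD('r) \<Longrightarrow> j < CARD('r) \<Longrightarrow> c i j = - c j i"
    "\<And>i. i < CARD('r) \<Longrightarrow> p (\<iota> i) - (\<Sum>j<CARD('r). c i j * ?\<theta> j) \<in> toric_kernel a"
    unfolding J0 by blast
  define \<kappa> where "\<kappa> = the_inv_into {..<CARD('r)} \<iota>"
  have \<kappa>: "\<kappa> i < CARD('r)" "\<iota> (\<kappa> i) = i" for i
  proof -
    have "i \<in> \<iota> ` {..<CARD('r)}" using \<iota> by (simp add: bij_betw_def)
    then show "\<kappa> i < CARD('r)" "\<iota> (\<kappa> i) = i"
      using \<iota> the_inv_into_into[of \<iota> "{..<CARD('r)}" i "{..<CARD('r)}"] f_the_inv_into_f[of \<iota> "{..<CARD('r)}" i]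
      by (auto simp: \<kappa>_def bij_betw_def)
  qed
  have \<kappa>\<iota>: "\<kappa> (\<iota> k) = k" if "k < CARD('r)" for k
    using that \<iota> by (simp add: \<kappa>_def bij_betw_def the_inv_into_f_f)
  show "\<exists>c. (\<forall>i k. c i k = - c k i) \<and> (\<forall>i. p i - (\<Sum>k\<in>UNIV. c i k * euler_form a ratfun_var k) \<in> toric_kernel a)"
  proof (intro exI[of _ "\<lambda>i k. c (\<kappa> i) (\<kappa> k)"] conjI allI)
    show "c (\<kappa> i) (\<kappa> k) = - c (\<kappa> k) (\<kappa> i)" for i k by (rule c(1)[OF \<kappa>(1) \<kappa>(1)])
    show "p i - (\<Sum>k\<in>UNIV. c (\<kappa> i) (\<kappa> k) * euler_form a ratfun_var k) \<in> toric_kernel a" for i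
    proof -
      have "(\<Sum>k\<in>UNIV. c (\<kappa> i) (\<kappa> k) * euler_form a ratfun_var k) = (\<Sum>j<CARD('r). c (\<kappa> i) j * ?\<theta> j)"
        unfolding reindex by (intro sum.cong refl) (simp add: \<kappa>\<iota>)
      then show ?thesis using c(2)[OF \<kappa>(1)[of i]] by (simp add: \<kappa>(2))
    qed
  qed
qed


section \<open>Pyramids, faces and the theorem\<close>

text \<open>
  The base of the pyramid is the affine hull of the other points. It has dimension \<open>r - 2\<close> because it lies
  on the hyperplane \<open>h = 1\<close>, which does not contain the origin.
\<close>

lemma (in homogeneous_points) pyramid_if_separated:
  assumes span: "span (range (\<lambda>j. real_point (a j))) = UNIV"
    and sep: "real_point (a j) \<notin> span ((\<lambda>k. real_point (a k)) ` (- {j}))"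
  shows "pyramid a"
proof -
  obtain h :: "real ^ 'r \<Rightarrow> real" where h: "linear h" "\<And>j. h (real_point (a j)) = 1"
    using on_hyperplane by auto
  define V where "V = (\<lambda>k. real_point (a k)) ` (- {j})"
  have "affine {x. h x = 1}"
    unfolding affine_def by (auto simp: linear_add[OF h(1)] linear_scale[OF h(1)])
  then have hull: "affine hull V \<subseteq> {x. h x = 1}" using h(2) by (intro hull_minimal) (auto simp: V_def)
  then have "0 \<notin> affine hull V" using linear_0[OF h(1)] by auto
  then have "aff_dim V + 1 = aff_dim (insert 0 V)" by (simp add: aff_dim_insert)
  also have "\<dots> = int (dim (insert 0 V))" by (rule aff_dim_zero) (simp add: hull_inc)
  also have "dim (insert 0 V) = dim V" by (simp add: dim_insert span_zero)
  finally have aff: "aff_dim V = int (dim V) - 1" by simp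
  have "range (\<lambda>j. real_point (a j)) = insert (real_point (a j)) V" by (auto simp: V_def)
  then have "dim (insert (real_point (a j)) V) = CARD('r)"
    using span dim_span[of "insert (real_point (a j)) V"] by (simp add: dim_UNIV)
  then have "dim V + 1 = CARD('r)" using sep by (simp add: dim_insert V_def)
  then have "aff_dim (affine hull V) = int CARD('r) - 2" using aff by simp
  moreover have "real_point (a j) \<notin> affine hull V" using sep affine_hull_subset_span[of V] by (auto simp: V_def)
  moreover have "real_point (a k) \<in> affine hull V" if "k \<noteq> j" for k using that by (intro hull_inc) (auto simp: V_def)
  ultimately show ?thesis unfolding pyramid_def by (intro exI[of _ "affine hull V"] exI[of _ j]) auto
qed

text \<open>
  The coefficients of \<open>\<xi>\<^sub>j\<close> in terms of the Euler forms define a functional that vanishes at all points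
  except \<open>a\<^sub>j\<close>. Its values are in \<open>K\<close>; the embedding \<open>\<phi>\<close> of the real numbers makes it real linear, which is
  enough to compare spans.
\<close>

lemma (in regular_euler_forms) separated_if_xi_in_euler_ideal:
  fixes \<phi> :: "real \<Rightarrow> 'k"
  assumes "inj a" "\<And>k. v k \<noteq> 0" "xi j \<in> euler_ideal a v c"
    and \<phi>: "\<And>x y. \<phi> (x + y) = \<phi> x + \<phi> y" "\<And>x y. \<phi> (x * y) = \<phi> x * \<phi> y" "\<And>n. \<phi> (of_int n) = of_int n"
  shows "real_point (a j) \<notin> span ((\<lambda>k. real_point (a k)) ` (- {j}))"
proof
  obtain b where b: "\<And>k. (\<Sum>i\<in>UNIV. b i * of_int (a k $ i)) * v k = (if k = j then 1 else 0)"
    using xi_in_euler_ideal[OF assms(1,3)] by blast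
  define \<psi> where "\<psi> x = (\<Sum>i\<in>UNIV. b i * \<phi> (x $ i))" for x :: "real ^ 'r"
  have \<psi>: "\<psi> (real_point (a k)) = (\<Sum>i\<in>UNIV. b i * of_int (a k $ i))" for k
    by (simp add: \<psi>_def real_point_def \<phi>(3))
  have "subspace {x. \<psi> x = 0}"
    unfolding subspace_def
  proof (intro conjI ballI allI)
    show "0 \<in> {x. \<psi> x = 0}" using \<phi>(3)[of 0] by (simp add: \<psi>_def)
    fix x assume x: "x \<in> {x. \<psi> x = 0}"
    have "\<psi> (r *\<^sub>R x) = \<phi> r * \<psi> x" for r by (simp add: \<psi>_def \<phi>(2) sum_distrib_left mult.left_commute)
    then show "r *\<^sub>R x \<in> {x. \<psi> x = 0}" for r using x by simp
    fix y assume "y \<in> {x. \<psi> x = 0}"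
    moreover have "\<psi> (x + y) = \<psi> x + \<psi> y" by (simp add: \<psi>_def \<phi>(1) distrib_left sum.distrib)
    ultimately show "x + y \<in> {x. \<psi> x = 0}" using x by simp
  qed
  moreover have "(\<lambda>k. real_point (a k)) ` (- {j}) \<subseteq> {x. \<psi> x = 0}"
  proof
    fix x assume "x \<in> (\<lambda>k. real_point (a k)) ` (- {j})"
    then obtain k where "x = real_point (a k)" "k \<noteq> j" by blast
    then show "x \<in> {x. \<psi> x = 0}" using b[of k] assms(2)[of k] by (simp add: \<psi>)
  qed
  ultimately have "span ((\<lambda>k. real_point (a k)) ` (- {j})) \<subseteq> {x. \<psi> x = 0}" by (intro span_minimal)
  moreover assume "real_point (a j) \<in> span ((\<lambda>k. real_point (a k)) ` (- {j}))"
  ultimately have "\<psi> (real_point (a j)) = 0" by blast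
  then show False using b[of j] by (simp add: \<psi>)
qed

lemma ratfun_var_nonzero: "ratfun_var j \<noteq> 0"
proof
  assume "ratfun_var j = 0"
  then have "poly_var j = 0" by (simp add: ratfun_var_def Zero_fract_def eq_fract)
  then show False unfolding poly_var_def by (metis lookup_single_eq lookup_zero one_neq_zero)
qed

lemma cone_of_eq_hull:
  fixes a :: "'n::finite \<Rightarrow> int ^ 'r"
  shows "cone_of a = convex_cone hull (range (\<lambda>j. real_point (a j)))"
proof
  let ?S = "range (\<lambda>j. real_point (a j))"
  have gen: "real_point (a j) \<in> convex_cone hull ?S" for j by (rule hull_inc) simp
  have sum: "(\<Sum>j\<in>A. c j *\<^sub>R real_point (a j)) \<in> convex_cone hull ?S" if "\<And>j. c j \<ge> 0" for A and c :: "'n \<Rightarrow> real"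
    by (induction A rule: infinite_finite_induct)
       (simp_all add: convex_cone_hull_add convex_cone_hull_mul convex_cone_hull_contains_0 gen that)
  then show "cone_of a \<subseteq> convex_cone hull ?S" by (auto simp: cone_of_def)
  have "convex_cone (cone_of a)"
    unfolding convex_cone_iff
  proof (intro conjI ballI allI impI)
    show "0 \<in> cone_of a" unfolding cone_of_def by (intro CollectI exI[of _ "\<lambda>_. 0"]) simp
    fix x assume "x \<in> cone_of a"
    then obtain c where c: "x = (\<Sum>j\<in>UNIV. c j *\<^sub>R real_point (a j))" "\<forall>j. c j \<ge> 0" by (auto simp: cone_of_def)
    show "r *\<^sub>R x \<in> cone_of a" if "r \<ge> 0" for r
      unfolding cone_of_def using c that
      by (intro CollectI exI[of _ "\<lambda>j. r * c j"]) (simp add: scaleR_sum_right)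
    fix y assume "y \<in> cone_of a"
    then obtain d where d: "y = (\<Sum>j\<in>UNIV. d j *\<^sub>R real_point (a j))" "\<forall>j. d j \<ge> 0" by (auto simp: cone_of_def)
    show "x + y \<in> cone_of a"
      unfolding cone_of_def using c d
      by (intro CollectI exI[of _ "\<lambda>j. c j + d j"]) (simp add: scaleR_add_left sum.distrib)
  qed
  moreover have "?S \<subseteq> cone_of a"
  proof
    fix x assume "x \<in> ?S"
    then obtain j where j: "x = real_point (a j)" by blast
    have "(\<Sum>i\<in>UNIV. (if i = j then 1 else 0) *\<^sub>R real_point (a i)) = (\<Sum>i\<in>UNIV. if i = j then real_point (a j) else 0)"
      by (intro sum.cong) auto
    then show "x \<in> cone_of a" unfolding cone_of_def j by (intro CollectI exI[of _ "\<lambda>i. if i = j then 1 else 0"]) simp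
  qed
  ultimately show "convex_cone hull ?S \<subseteq> cone_of a" by (intro hull_minimal)
qed

text \<open>
  A supporting hyperplane at \<open>x\<close>. Since \<open>0\<close> and \<open>2 x\<close> lie in the cone, it passes through the origin, and a
  representation of \<open>x\<close> with nonnegative coefficients uses only points on it.
\<close>

lemma supporting_functional_at_frontier:
  fixes a :: "'n::finite \<Rightarrow> int ^ 'r"
  assumes span: "span (range (\<lambda>j. real_point (a j))) = UNIV" and x: "x \<in> frontier (cone_of a)"
  shows "\<exists>w e. (\<forall>j. 0 \<le> w \<bullet> real_point (a j)) \<and> (\<exists>k. 0 < w \<bullet> real_point (a k)) \<and>
    x = (\<Sum>j\<in>UNIV. e j *\<^sub>R real_point (a j)) \<and> (\<forall>j. e j \<noteq> 0 \<longrightarrow> w \<bullet> real_point (a j) = 0)"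
proof -
  let ?S = "range (\<lambda>j. real_point (a j))"
  have cc: "convex_cone (cone_of a)" unfolding cone_of_eq_hull by (rule convex_cone_convex_cone_hull)
  have convex: "convex (cone_of a)" using cc by (simp add: convex_cone_def)
  have zero: "0 \<in> cone_of a" by (rule convex_cone_contains_0[OF cc])
  have double: "2 *\<^sub>R y \<in> cone_of a" if "y \<in> cone_of a" for y
    by (rule convex_cone_scaleR[OF cc _ that]) simp
  have S: "?S \<subseteq> cone_of a" unfolding cone_of_eq_hull by (rule hull_subset)
  have "closed (cone_of a)" unfolding cone_of_eq_hull by (rule closed_convex_cone_hull) simp
  then have xin: "x \<in> cone_of a" and "x \<notin> interior (cone_of a)" using x by (auto simp: frontier_def)
  have "affine hull (cone_of a) = span (cone_of a)" by (rule affine_hull_span_0) (simp add: hull_inc zero)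
  also have "\<dots> = UNIV" using span span_mono[OF S] by auto
  finally have nri: "x \<notin> rel_interior (cone_of a)" using \<open>x \<notin> interior (cone_of a)\<close> by (simp add: rel_interior_interior)
  obtain w where w: "w \<noteq> 0" "\<And>y. y \<in> cone_of a \<Longrightarrow> w \<bullet> x \<le> w \<bullet> y"
    by (rule supporting_hyperplane_rel_boundary[OF convex xin nri]) (rule that)
  have "w \<bullet> x \<le> 0" using w(2)[OF zero] by simp
  moreover have "w \<bullet> x \<le> w \<bullet> (2 *\<^sub>R x)" using w(2)[OF double[OF xin]] by simp
  ultimately have wx: "w \<bullet> x = 0" by simp
  have pos: "0 \<le> w \<bullet> real_point (a j)" for j using w(2)[of "real_point (a j)"] S wx by auto
  have ex_pos: "\<exists>k. 0 < w \<bullet> real_point (a k)"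
  proof (rule ccontr)
    assume "\<not> ?thesis"
    then have "\<not> 0 < w \<bullet> real_point (a k)" for k by simp
    then have "w \<bullet> real_point (a k) = 0" for k using pos[of k] by (simp add: order.antisym not_less)
    then have "?S \<subseteq> {y. w \<bullet> y = 0}" by (simp add: image_subset_iff)
    then have "span ?S \<subseteq> {y. w \<bullet> y = 0}" by (rule span_minimal) (rule subspace_hyperplane)
    then have "w \<bullet> w = 0" using span by (simp add: subset_iff)
    then show False using w(1) by simp
  qed
  obtain e where e: "x = (\<Sum>j\<in>UNIV. e j *\<^sub>R real_point (a j))" "\<And>j. e j \<ge> 0"
    using xin by (auto simp: cone_of_def)
  have face: "w \<bullet> real_point (a j) = 0" if "e j \<noteq> 0" for j
  proof -
    have "(\<Sum>j\<in>UNIV. e j * (w \<bullet> real_point (a j))) = 0" using wx by (simp add: e(1) inner_sum_right)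
    then have "e j * (w \<bullet> real_point (a j)) = 0"
      using e(2) pos by (subst (asm) sum_nonneg_eq_0_iff) auto
    then show ?thesis using that by simp
  qed
  show ?thesis
    by (intro exI[of _ w] exI[of _ e] conjI allI impI pos ex_pos e(1) face)
qed

text \<open>
  Points on the supporting hyperplane contain a basis of the span of the face, and \<open>x\<close> is a real
  combination of this basis. Adding sufficiently many copies of the basis points makes the coefficients
  nonnegative. The existence of the functional \<open>w\<close>, positive at \<open>a\<^sub>k\<close>, gives the condition on relations.
\<close>

lemma gamma_series_on_face:
  fixes a :: "'n::{finite,linorder} \<Rightarrow> int ^ 'r"
  assumes span: "span (range (\<lambda>j. real_point (a j))) = UNIV" and x: "x \<in> frontier (cone_of a)"
  shows "\<exists>(N :: 'n \<Rightarrow> int) \<gamma> \<sigma> k. gamma_series a \<gamma> (\<chi> i. complex_of_real ((x + real_point (\<Sum>j\<in>UNIV. N j *s a j)) $ i)) \<sigma> k"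
proof -
  let ?p = "\<lambda>j. real_point (a j)"
  obtain w e k where w: "\<And>j. 0 \<le> w \<bullet> ?p j" "0 < w \<bullet> ?p k"
    and e: "x = (\<Sum>j\<in>UNIV. e j *\<^sub>R ?p j)" "\<And>j. e j \<noteq> 0 \<Longrightarrow> w \<bullet> ?p j = 0"
  proof -
    from supporting_functional_at_frontier[OF span x] obtain w e where
      we: "(\<forall>j. 0 \<le> w \<bullet> ?p j) \<and> (\<exists>k. 0 < w \<bullet> ?p k) \<and>
        x = (\<Sum>j\<in>UNIV. e j *\<^sub>R ?p j) \<and> (\<forall>j. e j \<noteq> 0 \<longrightarrow> w \<bullet> ?p j = 0)"
      by (elim exE)
    then obtain k where "0 < w \<bullet> ?p k" by (elim conjE exE)
    then show ?thesis by (rule that[of w k e, rotated]) (use we in simp_all)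
  qed
  define F where "F = {j. w \<bullet> ?p j = 0}"
  obtain B where B: "B \<subseteq> ?p ` F" "independent B" "?p ` F \<subseteq> span B"
    by (rule basis_exists[of "?p ` F"]) (rule that)
  have finB: "finite B" using B(2) by (rule independent_imp_finite)
  have "\<forall>b\<in>B. \<exists>j\<in>F. ?p j = b" using B(1) by blast
  then obtain f where f: "\<And>b. b \<in> B \<Longrightarrow> f b \<in> F" "\<And>b. b \<in> B \<Longrightarrow> ?p (f b) = b"
    using bchoice[of B "\<lambda>b j. j \<in> F \<and> ?p j = b"] by (auto simp: Bex_def)
  define \<sigma> where "\<sigma> = f ` B"
  have \<sigma>F: "\<sigma> \<subseteq> F" using f(1) by (auto simp: \<sigma>_def)
  have inj: "inj_on f B" using f(2) by (metis inj_onI)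
  have reindex: "(\<Sum>j\<in>\<sigma>. u j *\<^sub>R ?p j) = (\<Sum>b\<in>B. u (f b) *\<^sub>R b)" for u
    unfolding \<sigma>_def by (subst sum.reindex[OF inj]) (simp add: f(2))
  have "x \<in> span B"
    unfolding e(1)
  proof (intro span_sum)
    fix j
    show "e j *\<^sub>R ?p j \<in> span B"
    proof (cases "e j = 0")
      case False
      then have "?p j \<in> span B" using e(2) B(3) by (auto simp: F_def)
      then show ?thesis by (rule span_scale)
    qed (simp add: span_zero)
  qed
  then obtain u where u: "x = (\<Sum>b\<in>B. u b *\<^sub>R b)" by (auto simp: span_finite[OF finB])
  define c where "c j = (if j \<in> \<sigma> then u (?p j) else 0)" for j
  have "(\<Sum>j\<in>UNIV. c j *\<^sub>R ?p j) = (\<Sum>j\<in>\<sigma>. c j *\<^sub>R ?p j)"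
    by (intro sum.mono_neutral_right) (auto simp: c_def)
  also have "\<dots> = (\<Sum>b\<in>B. c (f b) *\<^sub>R b)" by (rule reindex)
  also have "\<dots> = x" unfolding u by (intro sum.cong refl) (simp add: c_def \<sigma>_def f(2))
  finally have c: "x = (\<Sum>j\<in>UNIV. c j *\<^sub>R ?p j)" by simp
  define N where "N j = (if j \<in> \<sigma> then \<lceil>\<bar>c j\<bar>\<rceil> else 0)" for j
  define \<gamma> where "\<gamma> j = complex_of_real (c j + of_int (N j))" for j
  have "gamma_series a \<gamma> (\<chi> i. complex_of_real ((x + real_point (\<Sum>j\<in>UNIV. N j *s a j)) $ i)) \<sigma> k"
  proof
    show "(\<Sum>j\<in>UNIV. of_int (a j $ i) * \<gamma> j) = (\<chi> i. complex_of_real ((x + real_point (\<Sum>j\<in>UNIV. N j *s a j)) $ i)) $ i" for i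
    proof -
      have "(x + real_point (\<Sum>j\<in>UNIV. N j *s a j)) $ i = (\<Sum>j\<in>UNIV. of_int (a j $ i) * (c j + of_int (N j)))"
        by (subst c) (simp add: real_point_def distrib_left sum.distrib mult.commute)
      then show ?thesis by (simp only: \<gamma>_def vec_lambda_beta of_real_sum of_real_mult of_real_of_int_eq)
    qed
    show "\<gamma> j = 0" if "j \<notin> \<sigma>" for j using that by (simp add: \<gamma>_def c_def N_def)
    show "\<gamma> j \<noteq> - of_nat (Suc n)" for j n
    proof
      have "\<bar>c j\<bar> \<le> of_int \<lceil>\<bar>c j\<bar>\<rceil>" by (rule le_of_int_ceiling)
      then have "0 \<le> c j + of_int \<lceil>\<bar>c j\<bar>\<rceil>" by linarith
      then have nonneg: "0 \<le> c j + of_int (N j)" by (cases "j \<in> \<sigma>") (simp_all only: N_def if_True if_False, simp add: c_def)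
      assume "\<gamma> j = - of_nat (Suc n)"
      then have "complex_of_real (c j + of_int (N j)) = complex_of_real (- real (Suc n))" by (simp add: \<gamma>_def)
      then have "c j + of_int (N j) = - real (Suc n)" by (simp only: of_real_eq_iff)
      then show False using nonneg by simp
    qed
    have lattice: "(\<Sum>j\<in>UNIV. real_of_int (l j) *\<^sub>R ?p j) = 0" if "l \<in> relation_lattice a" for l
    proof -
      have "(\<Sum>j\<in>UNIV. l j *s a j) = 0" using that by (simp add: relation_lattice_def)
      then have "real_point (\<Sum>j\<in>UNIV. l j *s a j) = 0" by (simp add: real_point_def vec_eq_iff)
      then show ?thesis by (simp add: real_point_def vec_eq_iff)
    qed
    show "l = (\<lambda>_. 0)" if l: "l \<in> relation_lattice a" "\<And>j. j \<notin> \<sigma> \<Longrightarrow> l j = 0" for l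
    proof
      fix j
      have "(\<Sum>j\<in>UNIV. real_of_int (l j) *\<^sub>R ?p j) = (\<Sum>j\<in>\<sigma>. real_of_int (l j) *\<^sub>R ?p j)"
        using l(2) by (intro sum.mono_neutral_right) auto
      then have zero: "(\<Sum>b\<in>B. real_of_int (l (f b)) *\<^sub>R b) = 0" using lattice[OF l(1)] by (simp add: reindex)
      show "l j = 0"
      proof (cases "j \<in> \<sigma>")
        case True
        then obtain b where "b \<in> B" "j = f b" by (auto simp: \<sigma>_def)
        then show ?thesis using independentD[OF B(2) finB order_refl zero] by simp
      qed (rule l(2))
    qed
    show "k \<notin> \<sigma>" using w(2) \<sigma>F by (auto simp: F_def)
    show "l k \<le> 0" if l: "l \<in> relation_lattice a" "\<And>j. j \<notin> \<sigma> \<Longrightarrow> 0 \<le> l j" for l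
    proof -
      have "(\<Sum>j\<in>UNIV. real_of_int (l j) * (w \<bullet> ?p j)) = w \<bullet> (\<Sum>j\<in>UNIV. real_of_int (l j) *\<^sub>R ?p j)"
        by (simp add: inner_sum_right)
      also have "\<dots> = 0" by (simp add: lattice[OF l(1)])
      finally have sum: "(\<Sum>j\<in>UNIV. real_of_int (l j) * (w \<bullet> ?p j)) = 0" .
      have "0 \<le> real_of_int (l j) * (w \<bullet> ?p j)" for j
      proof (cases "j \<in> \<sigma>")
        case True
        then show ?thesis using \<sigma>F by (auto simp: F_def)
      next
        case False
        then show ?thesis using l(2)[OF False] w(1)[of j] by simp
      qed
      then have "real_of_int (l k) * (w \<bullet> ?p k) = 0"
        using sum by (subst (asm) sum_nonneg_eq_0_iff) auto
      then show ?thesis using w(2) by simp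
    qed
  qed
  then show ?thesis by blast
qed

theorem theorem1p3:
  fixes a :: "'n::{finite,linorder} \<Rightarrow> int ^ 'r" and \<alpha> :: "complex ^ 'r"
  assumes "CARD('n) > CARD('r)"
    and "inj a"
    and "\<forall>z :: int ^ 'r. \<exists>c :: 'n \<Rightarrow> int. z = (\<Sum>j\<in>UNIV. c j *s a j)"
    and "\<exists>h :: real ^ 'r \<Rightarrow> real. linear h \<and> (\<forall>j. h (real_point (a j)) = 1)"
    and "toric_Cohen_Macaulay a"
    and "\<not> pyramid a"
    and "resonant a \<alpha>"
  shows "hypergeom_reducible a \<alpha>"
proof
  assume "hypergeom_irreducible a \<alpha>"
  then have irr: "irreducible_symbols a \<alpha>" by (rule irreducible_symbols_if_irreducible)
  interpret homogeneous_points a by unfold_locales (rule assms(4))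
  interpret regular_euler_forms a ratfun_var by (rule syzygies_of_euler_forms[OF assms(3,5)])
  have span: "span (range (\<lambda>j. real_point (a j))) = UNIV" by (rule integral_span_imp_real_span[OF assms(3)])
  obtain n where "\<forall>u. n \<le> total_degree u \<longrightarrow> mon u 1 \<in> toric_euler_ideal a ratfun_var"
    using large_monomials_in_toric_euler_ideal by blast
  then have "\<exists>B. finite B \<and> spanned_by B \<inter> toric_euler_ideal a ratfun_var \<subseteq> {0} \<and>
     (\<forall>p. \<exists>s\<in>spanned_by B. p - s \<in> toric_euler_ideal a ratfun_var)"
    by (intro monomial_complement_toric_euler_ideal) blast
  then obtain B where B: "finite B" "spanned_by B \<inter> toric_euler_ideal a ratfun_var \<subseteq> {0}"
    "\<And>p. \<exists>s\<in>spanned_by B. p - s \<in> toric_euler_ideal a ratfun_var"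
    by blast
  interpret contiguous_systems a B
  proof
    show "finite B" by (rule B(1))
    show "spanned_by B \<inter> hypergeom_symbols a \<beta> \<subseteq> {0}" "\<exists>s\<in>spanned_by B. p - s \<in> hypergeom_symbols a \<beta>" for \<beta> p
      unfolding hypergeom_symbols_def by (rule monomial_complement_euler_ideal[OF B(2,3)])+
    show "xi j \<notin> hypergeom_symbols a \<beta>" for \<beta> j
    proof
      assume "xi j \<in> hypergeom_symbols a \<beta>"
      then have "real_point (a j) \<notin> span ((\<lambda>k. real_point (a k)) ` (- {j}))"
        unfolding hypergeom_symbols_def
        by (rule separated_if_xi_in_euler_ideal[OF assms(2) ratfun_var_nonzero, where \<phi> = "\<lambda>x. ratfun_const (complex_of_real x)"])
           (simp_all add: ratfun_const_add ratfun_const_mult ratfun_const_of_int)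
      then show False using pyramid_if_separated[OF span] assms(6) by blast
    qed
  qed
  obtain z x where zx: "x \<in> frontier (cone_of a)" "\<And>i. \<alpha> $ i + of_int (z $ i) = complex_of_real (x $ i)"
    using assms(7) by (auto simp: resonant_def)
  obtain N :: "'n \<Rightarrow> int" and \<gamma> \<sigma> k where
    "gamma_series a \<gamma> (\<chi> i. complex_of_real ((x + real_point (\<Sum>j\<in>UNIV. N j *s a j)) $ i)) \<sigma> k"
    using gamma_series_on_face[OF span zx(1)] by blast
  moreover obtain c :: "'n \<Rightarrow> int" where c: "z + (\<Sum>j\<in>UNIV. N j *s a j) = (\<Sum>j\<in>UNIV. c j *s a j)"
    using assms(3) by blast
  have "\<alpha> + complex_point (\<Sum>j\<in>UNIV. c j *s a j) = (\<chi> i. complex_of_real ((x + real_point (\<Sum>j\<in>UNIV. N j *s a j)) $ i))"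
    unfolding c[symmetric] vec_eq_iff
    using zx(2) by (simp add: complex_point_def real_point_def add.assoc[symmetric])
  ultimately have "gamma_series a \<gamma> (\<alpha> + complex_point (\<Sum>j\<in>UNIV. c j *s a j)) \<sigma> k" by simp
  then have "1 - xi k * q \<notin> hypergeom_symbols a (\<alpha> + complex_point (\<Sum>j\<in>UNIV. c j *s a j))" for q
    by (rule gamma_series.one_notin_hypergeom_symbols_plus_xi)
  then show False using xi_surjective_if_irreducible[OF irreducible_shift[OF irr]] by blast
qed

end
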